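(* Let $G$ be a controllable graph on $n$ vertices, and let $\mathcal{C}(G)$ be the set of all unlabeled graphs (isomorphism classes) generalized cospectral with $G$ (including $G$). Then there is a one-to-one correspondence between $\mathcal{C}(G)$ and the set of maximum cliques of $\Omega(G)$, given by sending a maximum clique $\{\xi_1,\ldots,\xi_n\}$ to the isomorphism class of the graph with adjacency matrix $Q^TA(G)Q$, where $Q=\frac1L[\xi_1,\ldots,\xi_n]$.
   Context: Graphs are simple, undirected on $n$ vertices; $A=A(G)$, $e$ the all-ones vector, $J$ the all-ones matrix. $W(G)=[e,Ae,\ldots,A^{n-1}e]$; $G$ is controllable if $\mathrm{rank}\,W(G)=n$. Two graphs are generalized cospectral if they have the same spectrum and their complements have the same spectrum. $d_n(M)$ is the last invariant factor of an integral matrix, $\mathrm{ord}_p$ the $p$-adic exponent, $\Delta(G)$ the discriminant of $\det(xI-A)$. $M_p(G;x)$: for odd $p$, $\chi(A;x)/\mathrm{sfp}(\gcd(\chi(A;x),\chi(A+J;x)))$ in $\mathbb{F}_p[x]$ ($\chi(B;x)=\det(xI-B)$, $\mathrm{sfp}$ = product of distinct monic irreducible factors); for $p=2$, with $\chi(A;x)=x^n+c_1x^{n-1}+\cdots+c_n$, $k=\lfloor n/2\rfloor$, it is $x^k+c_2x^{k-1}+\cdots+c_n$ ($n$ even) or $x(x^k+c_2x^{k-1}+\cdots+c_{n-1})$ ($n$ odd) mod 2; coefficients in $\{0,\ldots,p-1\}$, $s_p=\deg M_p$, $M_p(A)e\equiv0\pmod p$. For $p$ with $\mathrm{rank}_pW(G)\le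 n-1$: $W^{(p)}(G)=[e,\ldots,A^{s_p-1}e,\frac{M_p(A)e}{p},\ldots,\frac{A^{n-1-s_p}M_p(A)e}{p}]$. Let $d=d_n(W(G))$, $S=\{2\}\cup\{p\text{ odd prime}: p\mid\gcd(\Delta(G),d),\ p^2\mid\Delta(G)\}$; potential primes $p_1,\ldots,p_s$ are the $p\in S$ with $\mathrm{rank}_pW(G)\le n-1$ and $\mathrm{ord}_p(d_n(W^{(p)}(G)))\ge1$; $t_i=\mathrm{ord}_{p_i}(d_n(W^{(p_i)}(G)))$, $L=\prod p_i^{t_i}$ ($L=1$ if $s=0$). $\Omega(G)$ is the graph whose vertex set is the set of integral solutions $x$ of: $(W^{(p_i)}(G))^Tx\equiv0\pmod{p_i^{t_i}}$ ($i=1,\ldots,s$), $x^Tx=L^2$, $e^Tx=L$, $x^TA(G)x=0$; two vertices $\xi,\eta$ are adjacent iff $\xi^T\eta=0$ and $\xi^TA(G)\eta\in\{0,L^2\}$. ($\Omega(G)$ contains the $n$-clique $\{Le^{(1)},\ldots,Le^{(n)}\}$ and no larger clique.) *)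

theory Defs
  imports
    "Jordan_Normal_Form.Char_Poly"
    "Jordan_Normal_Form.DL_Rank"
    "Subresultants.Resultant_Prelim"
    "Berlekamp_Zassenhaus.Poly_Mod"
    "HOL-Computational_Algebra.Computational_Algebra"
begin

section \<open>Simple graphs on the vertex set \<open>{0,\<dots>,n-1}\<close>\<close>

text \<open>A graph is given by its set of edges, each edge being a two-element set of vertices.\<close>

definition all_edges :: "nat \<Rightarrow> nat set set" where
  "all_edges n = {{u, v} | u v. u < n \<and> v < n \<and> u \<noteq> v}"

definition simple_graph :: "nat \<Rightarrow> nat set set \<Rightarrow> bool" where
  "simple_graph n G \<longleftrightarrow> G \<subseteq> all_edges n"

definition complement :: "nat \<Rightarrow> nat set set \<Rightarrow> nat set set" where
  "complement n G = all_edges n - G"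

definition isomorphic :: "nat \<Rightarrow> nat set set \<Rightarrow> nat set set \<Rightarrow> bool" where
  "isomorphic n G H \<longleftrightarrow> (\<exists>f. bij_betw f {..<n} {..<n} \<and>
     (\<forall>u<n. \<forall>v<n. {u, v} \<in> G \<longleftrightarrow> {f u, f v} \<in> H))"

definition iso_class :: "nat \<Rightarrow> nat set set \<Rightarrow> nat set set set" where
  "iso_class n G = {H. simple_graph n H \<and> isomorphic n G H}"

definition adj_mat :: "nat \<Rightarrow> nat set set \<Rightarrow> int mat" where
  "adj_mat n G = mat n n (\<lambda>(i, j). if {i, j} \<in> G then 1 else 0)"

definition ones_vec :: "nat \<Rightarrow> int vec" where
  "ones_vec n = vec n (\<lambda>_. 1)"

definition ones_mat :: "nat \<Rightarrow> int mat" where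
  "ones_mat n = mat n n (\<lambda>_. 1)"

text \<open>The spectrum is the multiset of eigenvalues, counted with algebraic multiplicity.\<close>

definition spectrum_mset :: "nat \<Rightarrow> nat set set \<Rightarrow> complex multiset" where
  "spectrum_mset n G = proots (char_poly (map_mat complex_of_int (adj_mat n G)))"

definition gen_cospectral :: "nat \<Rightarrow> nat set set \<Rightarrow> nat set set \<Rightarrow> bool" where
  "gen_cospectral n G H \<longleftrightarrow>
     spectrum_mset n G = spectrum_mset n H \<and>
     spectrum_mset n (complement n G) = spectrum_mset n (complement n H)"

text \<open>Cospectral graphs have equally many vertices, so it suffices to consider graphs
  on the same vertex set.\<close>

definition gen_cospectral_classes :: "nat \<Rightarrow> nat set set \<Rightarrow> nat set set set set" where
  "gen_cospectral_classes n G = {iso_class n H | H. simple_graph n H \<and> gen_cospectral n G H}"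

definition walk_mat :: "nat \<Rightarrow> nat set set \<Rightarrow> int mat" where
  "walk_mat n G = mat_of_cols n (map (\<lambda>j. (adj_mat n G ^\<^sub>m j) *\<^sub>v ones_vec n) [0..<n])"

definition controllable :: "nat \<Rightarrow> nat set set \<Rightarrow> bool" where
  "controllable n G \<longleftrightarrow> vec_space.rank n (map_mat rat_of_int (walk_mat n G)) = n"

definition graph_disc :: "nat \<Rightarrow> nat set set \<Rightarrow> int" where
  "graph_disc n G =
     (let \<chi> = char_poly (adj_mat n G)
      in (-1) ^ (n * (n - 1) div 2) * resultant \<chi> (pderiv \<chi>))"


section \<open>Integral matrices\<close>

definition smith_normal_form :: "int mat \<Rightarrow> int mat \<Rightarrow> bool" where
  "smith_normal_form M D \<longleftrightarrow>
     D \<in> carrier_mat (dim_row M) (dim_col M) \<and> diagonal_mat D \<and>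
     (\<forall>i < min (dim_row M) (dim_col M). D $$ (i, i) \<ge> 0) \<and>
     (\<forall>i. Suc i < min (dim_row M) (dim_col M) \<longrightarrow> D $$ (i, i) dvd D $$ (Suc i, Suc i)) \<and>
     (\<exists>U V. U \<in> carrier_mat (dim_row M) (dim_row M) \<and> invertible_mat U \<and>
            V \<in> carrier_mat (dim_col M) (dim_col M) \<and> invertible_mat V \<and>
            U * M * V = D)"

definition last_invariant_factor :: "int mat \<Rightarrow> int" where
  "last_invariant_factor M =
     (THE d. \<exists>D. smith_normal_form M D \<and>
        d = (let r = min (dim_row M) (dim_col M) in D $$ (r - 1, r - 1)))"

definition cols_indep_mod :: "int \<Rightarrow> int mat \<Rightarrow> nat set \<Rightarrow> bool" where
  "cols_indep_mod p M I \<longleftrightarrow>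
     (\<forall>c :: nat \<Rightarrow> int. (\<forall>i < dim_row M. p dvd (\<Sum>j\<in>I. c j * M $$ (i, j))) \<longrightarrow> (\<forall>j\<in>I. p dvd c j))"

text \<open>The rank over the field with \<open>p\<close> elements, as the maximal number of linearly
  independent columns.\<close>

definition rank_mod :: "int \<Rightarrow> int mat \<Rightarrow> nat" where
  "rank_mod p M = Max {card I | I. I \<subseteq> {..<dim_col M} \<and> cols_indep_mod p M I}"

definition poly_mat :: "int poly \<Rightarrow> int mat \<Rightarrow> int mat" where
  "poly_mat f A = mat (dim_row A) (dim_row A)
     (\<lambda>(i, j). \<Sum>k\<le>degree f. coeff f k * (A ^\<^sub>m k) $$ (i, j))"


section \<open>Polynomials over the field with \<open>p\<close> elements\<close>

text \<open>As the prime \<open>p\<close> varies inside the statement, a polynomial over the field with \<open>p\<close>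
  elements is represented by the integer polynomial with coefficients in \<open>{0,\<dots>,p-1}\<close>, i.e.\ by a
  fixed point of \<^const>\<open>poly_mod.Mp\<close>; divisibility and irreducibility are those modulo \<open>p\<close>.\<close>

definition monic_mod :: "int \<Rightarrow> int poly \<Rightarrow> bool" where
  "monic_mod p f \<longleftrightarrow> poly_mod.Mp p f = f \<and> monic f"

definition gcd_mod :: "int \<Rightarrow> int poly \<Rightarrow> int poly \<Rightarrow> int poly" where
  "gcd_mod p f g = (THE h. monic_mod p h \<and> poly_mod.dvdm p h f \<and> poly_mod.dvdm p h g \<and>
     (\<forall>h'. poly_mod.dvdm p h' f \<and> poly_mod.dvdm p h' g \<longrightarrow> poly_mod.dvdm p h' h))"

definition sfp_mod :: "int \<Rightarrow> int poly \<Rightarrow> int poly" where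
  "sfp_mod p f = poly_mod.Mp p
     (\<Prod>h | monic_mod p h \<and> poly_mod.irreducible_m p h \<and> poly_mod.dvdm p h f. h)"

definition quot_mod :: "int \<Rightarrow> int poly \<Rightarrow> int poly \<Rightarrow> int poly" where
  "quot_mod p f g = (THE q. poly_mod.Mp p q = q \<and> poly_mod.Mp p (q * g) = poly_mod.Mp p f)"


section \<open>The graph \<open>\<Omega>(G)\<close>\<close>

text \<open>The coefficient \<open>c\<^sub>i\<close> of \<open>x\<^sup>n\<^sup>-\<^sup>i\<close> in \<open>\<chi>\<close> is \<open>coeff \<chi> (n - i)\<close>. For \<open>p = 2\<close> only the
  coefficients \<open>c\<^sub>0 = 1, c\<^sub>2, c\<^sub>4, \<dots>\<close> occur.\<close>

definition M_poly :: "nat \<Rightarrow> nat set set \<Rightarrow> int \<Rightarrow> int poly" where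
  "M_poly n G p =
     (let A = adj_mat n G; \<chi> = char_poly A; k = n div 2;
          g = (\<Sum>j\<le>k. monom (coeff \<chi> (n - 2 * j)) (k - j))
      in if p = 2 then poly_mod.Mp 2 (if even n then g else [:0, 1:] * g)
         else quot_mod p \<chi> (sfp_mod p (gcd_mod p \<chi> (char_poly (A + ones_mat n)))))"

text \<open>For a prime \<open>p\<close> all entries of \<open>M\<^sub>p(A)e\<close> are divisible by \<open>p\<close>, so \<open>div\<close> is the exact
  division here.\<close>

definition walk_mat_p :: "nat \<Rightarrow> nat set set \<Rightarrow> int \<Rightarrow> int mat" where
  "walk_mat_p n G p =
     (let A = adj_mat n G; e = ones_vec n; M = M_poly n G p; s = degree M;
          w = map_vec (\<lambda>a. a div p) (poly_mat M A *\<^sub>v e)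
      in mat_of_cols n (map (\<lambda>j. if j < s then (A ^\<^sub>m j) *\<^sub>v e else (A ^\<^sub>m (j - s)) *\<^sub>v w) [0..<n]))"

definition candidate_primes :: "nat \<Rightarrow> nat set set \<Rightarrow> int set" where
  "candidate_primes n G = {2} \<union>
     {p. prime p \<and> odd p \<and>
         p dvd gcd (graph_disc n G) (last_invariant_factor (walk_mat n G)) \<and>
         p ^ 2 dvd graph_disc n G}"

definition prime_exponent :: "nat \<Rightarrow> nat set set \<Rightarrow> int \<Rightarrow> nat" where
  "prime_exponent n G p = multiplicity p (last_invariant_factor (walk_mat_p n G p))"

definition potential_primes :: "nat \<Rightarrow> nat set set \<Rightarrow> int set" where
  "potential_primes n G =
     {p \<in> candidate_primes n G. rank_mod p (walk_mat n G) < n \<and> prime_exponent n G p \<ge> 1}"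

definition level_bound :: "nat \<Rightarrow> nat set set \<Rightarrow> int" where
  "level_bound n G = (\<Prod>p\<in>potential_primes n G. p ^ prime_exponent n G p)"

definition omega_verts :: "nat \<Rightarrow> nat set set \<Rightarrow> int vec set" where
  "omega_verts n G =
     (let A = adj_mat n G; L = level_bound n G in
      {x \<in> carrier_vec n.
         (\<forall>p\<in>potential_primes n G. \<forall>i<n.
            p ^ prime_exponent n G p dvd (transpose_mat (walk_mat_p n G p) *\<^sub>v x) $ i) \<and>
         x \<bullet> x = L ^ 2 \<and> ones_vec n \<bullet> x = L \<and> x \<bullet> (A *\<^sub>v x) = 0})"

definition omega_adj :: "nat \<Rightarrow> nat set set \<Rightarrow> int vec \<Rightarrow> int vec \<Rightarrow> bool" where
  "omega_adj n G \<xi> \<eta> \<longleftrightarrow>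
     \<xi> \<bullet> \<eta> = 0 \<and> \<xi> \<bullet> (adj_mat n G *\<^sub>v \<eta>) \<in> {0, level_bound n G ^ 2}"

definition omega_clique :: "nat \<Rightarrow> nat set set \<Rightarrow> int vec set \<Rightarrow> bool" where
  "omega_clique n G K \<longleftrightarrow>
     K \<subseteq> omega_verts n G \<and> (\<forall>\<xi>\<in>K. \<forall>\<eta>\<in>K. \<xi> \<noteq> \<eta> \<longrightarrow> omega_adj n G \<xi> \<eta>)"

definition omega_max_cliques :: "nat \<Rightarrow> nat set set \<Rightarrow> int vec set set" where
  "omega_max_cliques n G =
     {K. omega_clique n G K \<and> finite K \<and>
         (\<forall>K'. omega_clique n G K' \<longrightarrow> finite K' \<and> card K' \<le> card K)}"

definition clique_mat :: "nat \<Rightarrow> nat set set \<Rightarrow> int vec list \<Rightarrow> rat mat" where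
  "clique_mat n G \<xi>s =
     (1 / rat_of_int (level_bound n G)) \<cdot>\<^sub>m map_mat rat_of_int (mat_of_cols n \<xi>s)"

end

theory Submission
  imports Defs
begin

text \<open>
  Write \<open>e\<close> for the all-ones vector and \<open>W(G)\<close> for the walk matrix. If \<open>H\<close> is generalized cospectral
  with the controllable graph \<open>G\<close>, then \<open>W(G)\<^sup>T W(G) = W(H)\<^sup>T W(H)\<close>, so \<open>R = W(H) W(G)\<^sup>-\<^sup>1\<close> is the unique
  rational orthogonal matrix with \<open>R e = e\<close> and \<open>R A(G) = A(H) R\<close>; the rows of \<open>L R\<close> form a clique as
  soon as \<open>L R\<close> is integral, and conversely an \<open>n\<close>-clique scaled by \<open>1/L\<close> is such an \<open>R\<close>. Orthogonality
  bounds cliques by \<open>n\<close>. It remains to see that the level \<open>\<ell>\<close> of \<open>R\<close>, the least positive integer with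
  \<open>\<ell> R\<close> integral, divides \<open>L\<close>.

  Since \<open>R W\<^sup>(\<^sup>p\<^sup>)(G) = W\<^sup>(\<^sup>p\<^sup>)(H)\<close>, \<open>\<ell>\<close> divides the last invariant factor of \<open>W\<^sup>(\<^sup>p\<^sup>)(G)\<close>, and likewise that of
  \<open>W(G)\<close>. If \<open>p\<close> divides \<open>\<ell>\<close>, some row \<open>q\<close> of \<open>\<ell> R\<close> is nonzero modulo \<open>p\<close>, and \<open>q\<^sup>T A\<^sup>k q\<close> is divisible by
  \<open>p\<^sup>2\<close> for all \<open>k\<close>. Both this situation and the divisibility \<open>p | M\<^sub>p(A) e\<close> are governed by the entries
  of \<open>adj(t I - A)\<close>: a \<open>2 \<times> 2\<close> minor of the adjugate is divisible by the determinant \<open>\<chi>\<close>, so for a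
  symmetric \<open>A\<close> the square of \<open>u\<^sup>T adj(t I - A) x\<close> is congruent modulo \<open>\<chi>\<close> to the product of
  \<open>u\<^sup>T adj(t I - A) u\<close> and \<open>x\<^sup>T adj(t I - A) x\<close>. For \<open>x = e\<close> every irreducible factor of
  \<open>gcd(\<chi>(A), \<chi>(A + J))\<close> therefore divides all entries of \<open>adj(t I - A) e\<close>, which gives \<open>M\<^sub>p(A) e = 0\<close>
  modulo \<open>p\<close>. For \<open>x = q\<close> it gives \<open>\<chi>'(A) q = 0\<close> modulo \<open>p\<close>, and with \<open>p\<^sup>2 | q\<^sup>T \<chi>'(A) q\<close> this forces
  \<open>p\<^sup>2\<close> to divide \<open>det \<chi>'(A)\<close>, which is the discriminant up to sign.
\<close>

text \<open>Since the prime varies, every argument modulo p is an explicit identity in Z[t] modulo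
  the ideal generated by p. The entries of adj(t I - A) enter only as \<open>num_poly\<close> of
  moment sequences, which exist over the integers. Two facts make them usable: the coefficient of
  t^(n-1) is the zeroth moment, and by Cayley-Hamilton multiplication by f, taken modulo \<chi>,
  replaces the moments of x by those of f(A) x. A statement f(A) x = 0 modulo p thus becomes a
  divisibility by \<chi>. The minor identity controls only squares modulo \<chi>, so it cannot see
  the multiplicity of irreducible factors. The squarefree part in M_p for odd p and the factor
  \<chi>' for the discriminant both compensate for this loss. For p = 2 another mechanism is at
  work: modulo 2 a symmetric matrix with zero diagonal is skew-symmetric, which makes M_p a square
  root of \<chi> or of t \<chi>. Controllability enters through det W(G) being nonzero: it gives
  existence and uniqueness of R, and it identifies the resultant with det \<chi>'(A).\<close>

hide_const (open) module.smult
no_notation fps_nth (infixl \<open>$\<close> 75)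

section \<open>Rank updates and the adjugate of the characteristic matrix\<close>

text \<open>Two eliminations act on the block matrix with rows \<open>(M, -X)\<close> and
  \<open>(Y, 1)\<close>: adding X times the lower rows clears -X, and scaling the lower rows by d
  before subtracting \<open>Y * N\<close> times the upper ones clears Y. With N the adjugate of M
  this is the matrix determinant lemma without division.\<close>

lemma det_rank_update:
  fixes M :: "'a :: idom mat"
  assumes M: "M \<in> carrier_mat n n" and N: "N \<in> carrier_mat n n" and X: "X \<in> carrier_mat n k"
    and Y: "Y \<in> carrier_mat k n" and NM: "N * M = d \<cdot>\<^sub>m 1\<^sub>m n"
  shows "d ^ k * det (M + X * Y) = det M * det (d \<cdot>\<^sub>m 1\<^sub>m k + Y * N * X)"
proof -
  let ?B = "four_block_mat M (- X) Y (1\<^sub>m k)"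
  have B: "?B \<in> carrier_mat (n + k) (n + k)" using M X Y by auto
  have "det (four_block_mat (1\<^sub>m n) X (0\<^sub>m k n) (1\<^sub>m k) * ?B) = det ?B"
    using X B by (subst det_mult[of _ "n + k"])
      (auto simp: det_four_block_mat_lower_left_zero[of _ n _ k])
  also have "four_block_mat (1\<^sub>m n) X (0\<^sub>m k n) (1\<^sub>m k) * ?B = four_block_mat (M + X * Y) (0\<^sub>m n k) Y (1\<^sub>m k)"
    using M X Y by (subst mult_four_block_mat[of _ n n _ k _ k]) (auto simp: uminus_l_inv_mat)
  also have "det \<dots> = det (M + X * Y)"
    using M X Y by (subst det_four_block_mat_upper_right_zero[of _ n _ k]) auto
  finally have 1: "det (M + X * Y) = det ?B" .
  have YN: "Y * N \<in> carrier_mat k n" using Y N by simp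
  have YNM: "Y * N * M = d \<cdot>\<^sub>m Y"
    using assoc_mult_mat[OF Y N M] mult_smult_distrib[OF Y one_carrier_mat[of n]] Y by (simp add: NM)
  have "det (four_block_mat (1\<^sub>m n) (0\<^sub>m n k) (- (Y * N)) (d \<cdot>\<^sub>m 1\<^sub>m k) * ?B) = d ^ k * det ?B"
    using YN B by (subst det_mult[of _ "n + k"])
      (auto simp: det_four_block_mat_upper_right_zero[of _ n _ k])
  also have "four_block_mat (1\<^sub>m n) (0\<^sub>m n k) (- (Y * N)) (d \<cdot>\<^sub>m 1\<^sub>m k) * ?B
     = four_block_mat M (- X) (0\<^sub>m k n) (d \<cdot>\<^sub>m 1\<^sub>m k + Y * N * X)"
  proof -
    have "- P * M + d \<cdot>\<^sub>m 1\<^sub>m k * Y = 0\<^sub>m k n" if "P * M = d \<cdot>\<^sub>m Y" "P \<in> carrier_mat k n" for P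
      using Y that M by (simp add: mult_smult_assoc_mat[of _ k k] uminus_l_inv_mat[of _ k n])
    then have a: "- (Y * N) * M + d \<cdot>\<^sub>m 1\<^sub>m k * Y = 0\<^sub>m k n" using YNM YN by blast
    have "- P * - X + d \<cdot>\<^sub>m 1\<^sub>m k * 1\<^sub>m k = d \<cdot>\<^sub>m 1\<^sub>m k + P * X" if "P \<in> carrier_mat k n" for P
      using X that by auto
    then have b: "- (Y * N) * - X + d \<cdot>\<^sub>m 1\<^sub>m k * 1\<^sub>m k = d \<cdot>\<^sub>m 1\<^sub>m k + Y * N * X"
      using YN by blast
    show ?thesis
      using M X Y YN a b by (subst mult_four_block_mat[of _ n n _ k _ k]) auto
  qed
  also have "det \<dots> = det M * det (d \<cdot>\<^sub>m 1\<^sub>m k + Y * N * X)"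
    using M X Y N by (subst det_four_block_mat_lower_left_zero[of _ n _ k]) auto
  finally show ?thesis using 1 by simp
qed

text \<open>For the moments \<open>m k = y\<^sup>T A\<^sup>k x\<close> and \<open>\<chi>\<close> the characteristic polynomial of \<open>A\<close>, this is
  \<open>y\<^sup>T adj(t I - A) x\<close>, the numerator of the generating function of the moments.\<close>
definition num_poly :: "'a :: comm_ring_1 poly \<Rightarrow> (nat \<Rightarrow> 'a) \<Rightarrow> 'a poly" where
  "num_poly \<chi> m = (\<Sum>j<degree \<chi>. monom (\<Sum>i=j+1..degree \<chi>. coeff \<chi> i * m (i - j - 1)) j)"

lemma coeff_num_poly:
  "coeff (num_poly \<chi> m) j = (\<Sum>i=j+1..degree \<chi>. coeff \<chi> i * m (i - j - 1))"
  by (auto simp: num_poly_def coeff_sum if_distrib cong: if_cong)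

lemma degree_num_poly:
  assumes "degree \<chi> > 0" shows "degree (num_poly \<chi> m) < degree \<chi>"
  using assms by (intro degree_lessI) (auto simp: coeff_num_poly)

lemma num_poly_sum:
  "num_poly \<chi> (\<lambda>k. \<Sum>r\<in>R. c r * m r k) = (\<Sum>r\<in>R. smult (c r) (num_poly \<chi> (m r)))"
  by (rule poly_eqI) (simp add: coeff_num_poly coeff_sum sum_distrib_left mult_ac sum.swap[of _ R])

lemma num_poly_add:
  "num_poly \<chi> (\<lambda>k. m k + m' k) = num_poly \<chi> m + num_poly \<chi> m'"
  by (rule poly_eqI) (simp add: coeff_num_poly sum.distrib algebra_simps)

lemma num_poly_smult:
  "num_poly \<chi> (\<lambda>k. c * m k) = smult c (num_poly \<chi> m)"
  by (rule poly_eqI) (simp add: coeff_num_poly sum_distrib_left mult_ac)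

text \<open>The sum for coefficient j of the product starts at i = j instead of j + 1, and the extra
  term yields the multiple of \<chi>. The recurrence accounts for coefficient 0, which is absent
  from a multiple of t.\<close>

lemma num_poly_shift:
  assumes rec: "(\<Sum>i\<le>degree \<chi>. coeff \<chi> i * m i) = 0"
  shows "[:0, 1:] * num_poly \<chi> m = num_poly \<chi> (\<lambda>k. m (Suc k)) + smult (m 0) \<chi>"
proof (rule poly_eqI)
  fix j
  have "(\<Sum>i=j..degree \<chi>. coeff \<chi> i * m (i - j)) =
    (\<Sum>i=j+1..degree \<chi>. coeff \<chi> i * m (i - j)) + m 0 * coeff \<chi> j"
  proof (cases "j \<le> degree \<chi>")
    case True then show ?thesis by (simp add: sum.atLeast_Suc_atMost)
  next
    case False then show ?thesis by (simp add: coeff_eq_0)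
  qed
  moreover have "(\<Sum>i=j+1..degree \<chi>. coeff \<chi> i * m (Suc (i - j - 1))) =
     (\<Sum>i=j+1..degree \<chi>. coeff \<chi> i * m (i - j))"
    by (intro sum.cong) (auto simp: Suc_diff_Suc)
  moreover have "coeff ([:0, 1:] * num_poly \<chi> m) j = (\<Sum>i=j..degree \<chi>. coeff \<chi> i * m (i - j))"
    using rec by (cases j) (simp_all add: coeff_num_poly atLeast0AtMost)
  ultimately show "coeff ([:0, 1:] * num_poly \<chi> m) j =
      coeff (num_poly \<chi> (\<lambda>k. m (Suc k)) + smult (m 0) \<chi>) j"
    by (simp add: coeff_num_poly)
qed

text \<open>Horner's scheme with \<open>num_poly_shift\<close>: modulo \<chi>, multiplication by t
  shifts the sequence. The recurrence is assumed at every offset k because the induction passes to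
  the shifted sequence.\<close>

lemma num_poly_mult:
  assumes "\<And>k. (\<Sum>i\<le>degree \<chi>. coeff \<chi> i * m (i + k)) = 0"
  shows "\<exists>g. f * num_poly \<chi> m = \<chi> * g + num_poly \<chi> (\<lambda>k. \<Sum>j\<le>degree f. coeff f j * m (j + k))"
  using assms
proof (induction f arbitrary: m)
  case 0
  have "num_poly \<chi> (\<lambda>k. 0) = 0" by (rule poly_eqI) (simp add: coeff_num_poly)
  then show ?case by (auto intro: exI[of _ 0])
next
  case (pCons a f)
  let ?m = "\<lambda>k. m (Suc k)"
  have rec: "(\<Sum>i\<le>degree \<chi>. coeff \<chi> i * ?m (i + k)) = 0" for k
    using pCons.prems[of "Suc k"] by simp
  obtain g where g: "f * num_poly \<chi> ?m = \<chi> * g + num_poly \<chi> (\<lambda>k. \<Sum>j\<le>degree f. coeff f j * ?m (j + k))"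
    using pCons.IH[OF rec] by blast
  have eq: "(\<Sum>j\<le>degree (pCons a f). coeff (pCons a f) j * m (j + k)) =
     a * m k + (\<Sum>j\<le>degree f. coeff f j * ?m (j + k))" for k
    by (cases "f = 0") (simp_all add: sum.atMost_Suc_shift del: sum.atMost_Suc)
  have "pCons a f * num_poly \<chi> m = smult a (num_poly \<chi> m) + f * ([:0, 1:] * num_poly \<chi> m)"
    by (simp add: mult_pCons_left)
  also have "[:0, 1:] * num_poly \<chi> m = num_poly \<chi> ?m + smult (m 0) \<chi>"
    using pCons.prems[of 0] by (intro num_poly_shift) simp
  also have "smult a (num_poly \<chi> m) + f * \<dots> = \<chi> * (g + smult (m 0) f) +
     num_poly \<chi> (\<lambda>k. \<Sum>j\<le>degree (pCons a f). coeff (pCons a f) j * m (j + k))"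
    unfolding eq num_poly_add num_poly_smult using g by (simp add: algebra_simps)
  finally show ?case by blast
qed

section \<open>Powers of a matrix, the Cayley-Hamilton theorem and moments\<close>

lemma pow_mat_add:
  assumes "A \<in> carrier_mat n n"
  shows "A ^\<^sub>m (i + j) = A ^\<^sub>m i * A ^\<^sub>m j"
proof (induction j)
  case (Suc j)
  then show ?case using assms by (simp add: assoc_mult_mat[of _ n n _ n _ n])
qed (use assms in auto)

lemma pow_mat_Suc_left:
  assumes "A \<in> carrier_mat n n"
  shows "A ^\<^sub>m Suc j = A * A ^\<^sub>m j"
  using pow_mat_add[OF assms, of 1 j] assms by simp

lemma transpose_pow_mat:
  assumes "(A :: 'a :: comm_semiring_1 mat) \<in> carrier_mat n n"
  shows "transpose_mat (A ^\<^sub>m k) = transpose_mat A ^\<^sub>m k"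
proof (induction k)
  case (Suc k)
  then show ?case using assms pow_mat_Suc_left[of "transpose_mat A" n k]
    by (simp add: transpose_mult[of _ n n _ n])
qed (use assms in auto)

text \<open>Comparing coefficients in (t I - A) adj(t I - A) = \<chi> I gives a recursion from
  \<open>a (Suc k)\<close> to \<open>a k\<close>, where \<open>a k\<close> is the k-th coefficient
  matrix of the adjugate. The partial sums then telescope to \<open>- A^(k+1) * a k\<close>, which
  vanishes beyond the degree of the adjugate.\<close>

lemma cayley_hamilton_entry:
  fixes A :: "'a :: comm_ring_1 mat"
  assumes A: "A \<in> carrier_mat n n" and r: "r < n" and c: "c < n"
  shows "(\<Sum>i\<le>n. coeff (char_poly A) i * (A ^\<^sub>m i) $$ (r, c)) = 0"
proof -
  let ?C = "char_poly_matrix A" and ?\<chi> = "char_poly A"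
  define N where "N = Determinant.adj_mat ?C"
  have C: "?C \<in> carrier_mat n n" using A by simp
  have N: "N \<in> carrier_mat n n" and CN: "?C * N = ?\<chi> \<cdot>\<^sub>m 1\<^sub>m n"
    using Determinant.adj_mat[OF C] by (auto simp: N_def char_poly_def)
  define a where "a k = mat n n (\<lambda>ij. coeff (N $$ ij) k)" for k
  have a: "a k \<in> carrier_mat n n" for k by (simp add: a_def)
  have ent: "[:0,1:] * N $$ (i,j) - (\<Sum>s<n. smult (A $$ (i,s)) (N $$ (s,j))) = (if i = j then ?\<chi> else 0)"
    if "i < n" "j < n" for i j
  proof -
    have "(if i = j then ?\<chi> else 0) = (?C * N) $$ (i,j)" using that by (simp add: CN)
    also have "\<dots> = (\<Sum>s<n. ((if i = s then [:0,1:] else 0) - [:A $$ (i,s):]) * N $$ (s,j))"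
      using A N that by (auto simp: scalar_prod_def atLeast0LessThan char_poly_matrix_def intro!: sum.cong)
    also have "\<dots> = [:0,1:] * N $$ (i,j) - (\<Sum>s<n. smult (A $$ (i,s)) (N $$ (s,j)))"
      using that by (simp add: left_diff_distrib sum_subtractf if_distrib[of "\<lambda>x. x * _"] sum.delta cong: if_cong)
    finally show ?thesis by simp
  qed
  have Aa: "(A * a k) $$ (i,j) = (\<Sum>s<n. A $$ (i,s) * coeff (N $$ (s,j)) k)" if "i < n" "j < n" for i j k
    using A that by (simp add: scalar_prod_def a_def atLeast0LessThan)
  have a0: "A * a 0 = - (coeff ?\<chi> 0 \<cdot>\<^sub>m 1\<^sub>m n)"
  proof (rule eq_matI)
    fix i j assume "i < dim_row (- (coeff ?\<chi> 0 \<cdot>\<^sub>m 1\<^sub>m n :: 'a mat))" "j < dim_col (- (coeff ?\<chi> 0 \<cdot>\<^sub>m 1\<^sub>m n :: 'a mat))"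
    then have ij: "i < n" "j < n" by auto
    show "(A * a 0) $$ (i,j) = (- (coeff ?\<chi> 0 \<cdot>\<^sub>m 1\<^sub>m n)) $$ (i,j)"
      using arg_cong[OF ent[OF ij], of "\<lambda>f. coeff f 0"] Aa[OF ij, of 0] ij
      by (simp add: coeff_sum minus_equation_iff[of "sum _ _"] split: if_splits)
  qed (use A a in auto)
  have aS: "a k = A * a (Suc k) + coeff ?\<chi> (Suc k) \<cdot>\<^sub>m 1\<^sub>m n" for k
  proof (rule eq_matI)
    fix i j assume "i < dim_row (A * a (Suc k) + coeff ?\<chi> (Suc k) \<cdot>\<^sub>m 1\<^sub>m n)"
      "j < dim_col (A * a (Suc k) + coeff ?\<chi> (Suc k) \<cdot>\<^sub>m 1\<^sub>m n)"
    then have ij: "i < n" "j < n" by auto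
    show "a k $$ (i,j) = (A * a (Suc k) + coeff ?\<chi> (Suc k) \<cdot>\<^sub>m 1\<^sub>m n) $$ (i,j)"
      using arg_cong[OF ent[OF ij], of "\<lambda>f. coeff f (Suc k)"] Aa[OF ij] ij A a[of "Suc k"]
      by (auto simp: coeff_sum a_def algebra_simps split: if_splits)
  qed (use A a in auto)
  have part: "(\<Sum>i\<le>k. coeff ?\<chi> i * (A ^\<^sub>m i) $$ (r,c)) = - (A ^\<^sub>m Suc k * a k) $$ (r,c)" for k
  proof (induction k)
    case 0
    then show ?case using A a0 r c by simp
  next
    case (Suc k)
    have "A ^\<^sub>m Suc k * a k = A ^\<^sub>m Suc k * (A * a (Suc k)) + A ^\<^sub>m Suc k * (coeff ?\<chi> (Suc k) \<cdot>\<^sub>m 1\<^sub>m n)"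
      using A a by (subst aS, subst mult_add_distrib_mat[of _ n n _ n]) (auto simp del: pow_mat.simps)
    also have "A ^\<^sub>m Suc k * (A * a (Suc k)) = A ^\<^sub>m Suc (Suc k) * a (Suc k)"
      using A a by (simp add: assoc_mult_mat[of _ n n _ n _ n])
    also have "A ^\<^sub>m Suc k * (coeff ?\<chi> (Suc k) \<cdot>\<^sub>m 1\<^sub>m n) = coeff ?\<chi> (Suc k) \<cdot>\<^sub>m A ^\<^sub>m Suc k"
      using A pow_carrier_mat[OF A, of "Suc k"] by (subst mult_smult_distrib[of _ n n _ n]) (auto simp del: pow_mat.simps)
    finally have eq: "A ^\<^sub>m Suc k * a k = A ^\<^sub>m Suc (Suc k) * a (Suc k) + coeff ?\<chi> (Suc k) \<cdot>\<^sub>m A ^\<^sub>m Suc k" .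
    have "(A ^\<^sub>m Suc k * a k) $$ (r,c) = (A ^\<^sub>m Suc (Suc k) * a (Suc k)) $$ (r,c)
       + coeff ?\<chi> (Suc k) * (A ^\<^sub>m Suc k) $$ (r,c)"
      using carrier_matD[OF pow_carrier_mat[OF A, of "Suc k"]] r c unfolding eq
      by (simp del: pow_mat.simps pow_mat_dim)
    then show ?case unfolding sum.atMost_Suc Suc by simp
  qed
  \<comment> \<open>K exceeds n and the degrees of all entries of N: \<open>a K\<close> is zero, and
    the partial sum up to K is already the full one.\<close>
  define K where "K = Suc (n + Max ((\<lambda>ij. degree (N $$ ij)) ` ({..<n} \<times> {..<n})))"
  have "degree (N $$ (i,j)) < K" if "i < n" "j < n" for i j
    unfolding K_def less_Suc_eq_le using that by (intro trans_le_add2 Max_ge) auto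
  then have "a K = 0\<^sub>m n n" by (intro eq_matI) (auto simp: a_def coeff_eq_0)
  then have "(\<Sum>i\<le>K. coeff ?\<chi> i * (A ^\<^sub>m i) $$ (r,c)) = 0"
    using part[of K] A r c by (simp del: pow_mat.simps)
  moreover have "(\<Sum>i\<le>K. coeff ?\<chi> i * (A ^\<^sub>m i) $$ (r,c)) = (\<Sum>i\<le>n. coeff ?\<chi> i * (A ^\<^sub>m i) $$ (r,c))"
    using degree_monic_char_poly[OF A] by (intro sum.mono_neutral_right) (auto simp: K_def coeff_eq_0)
  ultimately show ?thesis by simp
qed


lemma pow_mat_mult_vec_Suc:
  assumes "A \<in> carrier_mat n n" "x \<in> carrier_vec n"
  shows "(A ^\<^sub>m Suc k) *\<^sub>v x = A *\<^sub>v ((A ^\<^sub>m k) *\<^sub>v x)"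
  using assms by (simp only: pow_mat_Suc_left) (simp add: assoc_mult_mat_vec[of _ n n _ n])

lemma pow_mat_mult_vec_add:
  assumes "A \<in> carrier_mat n n" "x \<in> carrier_vec n"
  shows "(A ^\<^sub>m (j + k)) *\<^sub>v x = (A ^\<^sub>m j) *\<^sub>v ((A ^\<^sub>m k) *\<^sub>v x)"
  using assms by (simp add: pow_mat_add assoc_mult_mat_vec[of _ n n _ n])

lemma cayley_hamilton_vec:
  fixes A :: "'a :: comm_ring_1 mat"
  assumes A: "A \<in> carrier_mat n n" and x: "x \<in> carrier_vec n" and r: "r < n"
  shows "(\<Sum>i\<le>n. coeff (char_poly A) i * ((A ^\<^sub>m (i + k)) *\<^sub>v x) $ r) = 0"
proof -
  define z where "z = (A ^\<^sub>m k) *\<^sub>v x"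
  have z: "z \<in> carrier_vec n" using A x by (simp add: z_def mult_mat_vec_carrier[of _ n n])
  have "(\<Sum>i\<le>n. coeff (char_poly A) i * ((A ^\<^sub>m (i + k)) *\<^sub>v x) $ r)
     = (\<Sum>i\<le>n. \<Sum>c<n. coeff (char_poly A) i * (A ^\<^sub>m i) $$ (r,c) * z $ c)"
    using A x r z carrier_matD[OF pow_carrier_mat[OF A]]
    by (intro sum.cong refl)
      (simp add: pow_mat_mult_vec_add flip: z_def, simp add: scalar_prod_def atLeast0LessThan sum_distrib_left mult.assoc)
  also have "\<dots> = (\<Sum>c<n. (\<Sum>i\<le>n. coeff (char_poly A) i * (A ^\<^sub>m i) $$ (r,c)) * z $ c)"
    by (subst sum.swap) (simp add: sum_distrib_right)
  also have "\<dots> = 0" using A r by (simp add: cayley_hamilton_entry)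
  finally show ?thesis .
qed

definition mom :: "'a :: comm_ring_1 mat \<Rightarrow> 'a vec \<Rightarrow> 'a vec \<Rightarrow> nat \<Rightarrow> 'a" where
  "mom A y x k = y \<bullet> ((A ^\<^sub>m k) *\<^sub>v x)"

lemma mom_recurrence:
  assumes A: "A \<in> carrier_mat n n" and x: "x \<in> carrier_vec n" and y: "y \<in> carrier_vec n"
  shows "(\<Sum>i\<le>degree (char_poly A). coeff (char_poly A) i * mom A y x (i + k)) = 0"
proof -
  have "(\<Sum>i\<le>n. coeff (char_poly A) i * mom A y x (i + k))
    = (\<Sum>r<n. y $ r * (\<Sum>i\<le>n. coeff (char_poly A) i * ((A ^\<^sub>m (i + k)) *\<^sub>v x) $ r))"
    using carrier_matD[OF pow_carrier_mat[OF A]]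
    by (simp add: mom_def scalar_prod_def atLeast0LessThan sum_distrib_left mult_ac sum.swap[of _ "{..n}"]
       del: index_mult_mat_vec)
  then show ?thesis using cayley_hamilton_vec[OF A x] degree_monic_char_poly[OF A] by simp
qed

text \<open>This is adj(t I - A), written through the powers of A so that its bilinear forms are
  visibly numerators of moment sequences.\<close>

definition resolvent_mat :: "'a :: comm_ring_1 mat \<Rightarrow> 'a poly mat" where
  "resolvent_mat A = mat (dim_row A) (dim_row A) (\<lambda>ij. num_poly (char_poly A) (\<lambda>k. (A ^\<^sub>m k) $$ ij))"

text \<open>Multiplication by t shifts the powers of A, and the product with A cancels the shifted
  part. What remains is the boundary term of \<open>num_poly_shift\<close>, which is A^0 times
  \<chi>.\<close>

lemma resolvent_mat_mult:
  fixes A :: "'a :: comm_ring_1 mat"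
  assumes A: "A \<in> carrier_mat n n"
  shows "resolvent_mat A * char_poly_matrix A = char_poly A \<cdot>\<^sub>m 1\<^sub>m n"
proof (rule eq_matI)
  fix i j assume "i < dim_row (char_poly A \<cdot>\<^sub>m 1\<^sub>m n)" "j < dim_col (char_poly A \<cdot>\<^sub>m 1\<^sub>m n)"
  then have ij: "i < n" "j < n" by auto
  let ?N = "\<lambda>i j. num_poly (char_poly A) (\<lambda>k. (A ^\<^sub>m k) $$ (i,j))"
  have "(resolvent_mat A * char_poly_matrix A) $$ (i,j) =
      (\<Sum>s<n. ?N i s * ((if s = j then [:0,1:] else 0) - [:A $$ (s,j):]))"
    using A ij by (auto simp: scalar_prod_def atLeast0LessThan char_poly_matrix_def resolvent_mat_def intro!: sum.cong)
  also have "\<dots> = [:0,1:] * ?N i j - (\<Sum>s<n. smult (A $$ (s,j)) (?N i s))"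
    using ij by (simp add: right_diff_distrib sum_subtractf if_distrib[of "\<lambda>x. _ * x"] sum.delta cong: if_cong)
  also have "(\<Sum>s<n. smult (A $$ (s,j)) (?N i s)) = num_poly (char_poly A) (\<lambda>k. \<Sum>s<n. A $$ (s,j) * (A ^\<^sub>m k) $$ (i,s))"
    by (simp add: num_poly_sum)
  also have "(\<lambda>k. \<Sum>s<n. A $$ (s,j) * (A ^\<^sub>m k) $$ (i,s)) = (\<lambda>k. (A ^\<^sub>m Suc k) $$ (i,j))"
    using ij A carrier_matD[OF pow_carrier_mat[OF A]]
    by (simp add: scalar_prod_def atLeast0LessThan mult.commute)
  also have "[:0,1:] * ?N i j = num_poly (char_poly A) (\<lambda>k. (A ^\<^sub>m Suc k) $$ (i,j)) + smult ((A ^\<^sub>m 0) $$ (i,j)) (char_poly A)"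
    using cayley_hamilton_entry[OF A ij] degree_monic_char_poly[OF A] by (intro num_poly_shift) simp
  finally show "(resolvent_mat A * char_poly_matrix A) $$ (i,j) = (char_poly A \<cdot>\<^sub>m 1\<^sub>m n) $$ (i,j)"
    using ij A by simp
qed (use A in \<open>auto simp: resolvent_mat_def char_poly_matrix_def\<close>)

lemma mom_alt:
  assumes A: "A \<in> carrier_mat n n" and "x \<in> carrier_vec n" "y \<in> carrier_vec n"
  shows "mom A y x k = (\<Sum>i<n. \<Sum>j<n. y $ i * (A ^\<^sub>m k) $$ (i,j) * x $ j)"
  using assms carrier_matD[OF pow_carrier_mat[OF A]]
  by (simp add: mom_def scalar_prod_def atLeast0LessThan sum_distrib_left mult.assoc)

lemma bilinear_resolvent_mat:
  assumes A: "A \<in> carrier_mat n n" and X: "X \<in> carrier_mat n k" and Y: "Y \<in> carrier_mat l n"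
    and ab: "a < l" "b < k"
  shows "(map_mat (\<lambda>c. [:c:]) Y * resolvent_mat A * map_mat (\<lambda>c. [:c:]) X) $$ (a,b) =
    num_poly (char_poly A) (mom A (row Y a) (col X b))"
proof -
  have "(map_mat (\<lambda>c. [:c:]) Y * resolvent_mat A * map_mat (\<lambda>c. [:c:]) X) $$ (a,b) =
    (\<Sum>j<n. (\<Sum>i<n. smult (Y $$ (a,i)) (resolvent_mat A $$ (i,j))) * [:X $$ (j,b):])"
    using A X Y ab by (simp add: scalar_prod_def atLeast0LessThan resolvent_mat_def)
  also have "\<dots> = (\<Sum>ij\<in>{..<n} \<times> {..<n}. smult (Y $$ (a,fst ij) * X $$ (snd ij,b)) (num_poly (char_poly A) (\<lambda>k. (A ^\<^sub>m k) $$ ij)))"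
    using A by (subst sum.cartesian_product', subst sum.swap)
      (auto simp: resolvent_mat_def sum_distrib_right smult_sum2 mult.commute intro!: sum.cong)
  also have "\<dots> = num_poly (char_poly A) (\<lambda>k. \<Sum>ij\<in>{..<n} \<times> {..<n}. (Y $$ (a,fst ij) * X $$ (snd ij,b)) * (A ^\<^sub>m k) $$ ij)"
    by (simp add: num_poly_sum)
  also have "(\<lambda>k. \<Sum>ij\<in>{..<n} \<times> {..<n}. (Y $$ (a,fst ij) * X $$ (snd ij,b)) * (A ^\<^sub>m k) $$ ij) = mom A (row Y a) (col X b)"
  proof
    fix k
    show "(\<Sum>ij\<in>{..<n} \<times> {..<n}. (Y $$ (a,fst ij) * X $$ (snd ij,b)) * (A ^\<^sub>m k) $$ ij) = mom A (row Y a) (col X b) k"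
      using X Y ab by (subst mom_alt[OF A]) (auto simp: sum.cartesian_product' mult_ac intro!: sum.cong simp del: sum.cartesian_product)
  qed
  finally show ?thesis .
qed

text \<open>\<open>det_rank_update\<close> for t I - A, with the resolvent in the role of N and d =
  \<chi>.\<close>

lemma char_poly_rank_update:
  fixes A :: "'a :: idom mat"
  assumes A: "A \<in> carrier_mat n n" and X: "X \<in> carrier_mat n k" and Y: "Y \<in> carrier_mat k n"
  shows "char_poly A ^ k * char_poly (A - X * Y) = char_poly A *
    det (char_poly A \<cdot>\<^sub>m 1\<^sub>m k + mat k k (\<lambda>(a,b). num_poly (char_poly A) (mom A (row Y a) (col X b))))"
proof -
  let ?c = "map_mat (\<lambda>c. [:c:] :: 'a poly)"
  have "char_poly_matrix (A - X * Y) = char_poly_matrix A + ?c X * ?c Y"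
    using A X Y by (subst map_poly_mult(1)[symmetric]) (auto intro!: eq_matI simp: char_poly_matrix_def)
  moreover have "?c Y * resolvent_mat A * ?c X = mat k k (\<lambda>(a,b). num_poly (char_poly A) (mom A (row Y a) (col X b)))"
    using A X Y by (intro eq_matI) (auto simp: bilinear_resolvent_mat[OF A X Y] simp del: index_mult_mat(1))
  ultimately show ?thesis
    using det_rank_update[of "char_poly_matrix A" n "resolvent_mat A" "?c X" k "?c Y" "char_poly A"] A X Y
    by (simp add: resolvent_mat_mult char_poly_def) (simp add: resolvent_mat_def)
qed

lemma char_poly_nonzero:
  assumes "(A :: 'a :: idom mat) \<in> carrier_mat n n" shows "char_poly A \<noteq> 0"
  using degree_monic_char_poly[OF assms] by auto

lemma char_poly_rank_one_update:
  fixes A :: "'a :: idom mat"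
  assumes A: "A \<in> carrier_mat n n" and x: "x \<in> carrier_vec n" and y: "y \<in> carrier_vec n"
  shows "char_poly (A - mat_of_cols n [x] * mat_of_rows n [y]) = char_poly A + num_poly (char_poly A) (mom A y x)"
proof -
  have "det (char_poly A \<cdot>\<^sub>m 1\<^sub>m 1 + mat 1 1 (\<lambda>(a,b). num_poly (char_poly A)
     (mom A (row (mat_of_rows n [y]) a) (col (mat_of_cols n [x]) b)))) = char_poly A + num_poly (char_poly A) (mom A y x)"
    using x y by (subst det_single) auto
  then show ?thesis
    using char_poly_rank_update[OF A, of "mat_of_cols n [x]" 1 "mat_of_rows n [y]"] char_poly_nonzero[OF A]
      mat_of_cols_carrier(1)[of n "[x]"] mat_of_rows_carrier(1)[of n "[y]"] by simp
qed

lemma det_2: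
  assumes "(A :: 'a :: comm_ring_1 mat) \<in> carrier_mat 2 2"
  shows "det A = A $$ (0,0) * A $$ (1,1) - A $$ (0,1) * A $$ (1,0)"
  using laplace_expansion_row[OF assms, of 0] assms
  by (simp add: numeral_2_eq_2 cofactor_def det_single[of _] mat_delete_def)

text \<open>In a rank-two update one factor \<chi> cancels, so \<chi> divides a 2 x 2 determinant
  whose matrix is \<chi> I plus the numerators. All terms of its expansion except the minor contain
  \<chi>.\<close>

lemma char_poly_dvd_num_poly_minor:
  fixes A :: "'a :: idom mat"
  assumes A: "A \<in> carrier_mat n n" and x: "x \<in> carrier_vec n" and y: "y \<in> carrier_vec n"
    and z: "z \<in> carrier_vec n" and w: "w \<in> carrier_vec n"
  shows "char_poly A dvd num_poly (char_poly A) (mom A y x) * num_poly (char_poly A) (mom A w z)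
    - num_poly (char_poly A) (mom A y z) * num_poly (char_poly A) (mom A w x)"
proof -
  let ?\<chi> = "char_poly A" and ?num = "\<lambda>y x. num_poly (char_poly A) (mom A y x)"
  let ?D = "?\<chi> \<cdot>\<^sub>m 1\<^sub>m 2 + mat 2 2 (\<lambda>(a,b). num_poly ?\<chi> (mom A (row (mat_of_rows n [y,w]) a) (col (mat_of_cols n [x,z]) b)))"
  have "det ?D = (?\<chi> + ?num y x) * (?\<chi> + ?num w z) - ?num y z * ?num w x"
    using x y z w by (subst det_2) (auto simp: numeral_2_eq_2)
  moreover have "?\<chi> * (?\<chi> * char_poly (A - mat_of_cols n [x,z] * mat_of_rows n [y,w])) = ?\<chi> * det ?D"
    using char_poly_rank_update[OF A, of "mat_of_cols n [x,z]" 2 "mat_of_rows n [y,w]"]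
      mat_of_cols_carrier(1)[of n "[x,z]"] mat_of_rows_carrier(1)[of n "[y,w]"]
    by (simp add: numeral_2_eq_2 flip: numeral_2_eq_2) (simp add: power2_eq_square mult.assoc)
  ultimately have "?num y x * ?num w z - ?num y z * ?num w x =
     ?\<chi> * (char_poly (A - mat_of_cols n [x,z] * mat_of_rows n [y,w]) - ?\<chi> - ?num y x - ?num w z)"
    using char_poly_nonzero[OF A] by (simp add: algebra_simps)
  then show ?thesis by (metis dvd_triv_left)
qed

section \<open>Polynomials modulo a prime\<close>

lemma Mp_eq_iff: "poly_mod.Mp p f = poly_mod.Mp p g \<longleftrightarrow> [:p:] dvd f - g"
  by (simp add: poly_eq_iff poly_mod.Mp_coeff poly_mod.M_def const_poly_dvd_iff mod_eq_dvd_iff)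

lemma dvd_Mp_diff: "[:p:] dvd poly_mod.Mp p f - f"
  by (simp flip: Mp_eq_iff add: poly_mod.Mp_Mp)

lemma Mp_eq_0_iff: "poly_mod.Mp p f = 0 \<longleftrightarrow> [:p:] dvd f"
  using Mp_eq_iff[of p f 0] by (simp add: poly_mod.Mp_0)

text \<open>Divisibility modulo p is membership in the ideal (f, p) of Z[t]. With explicit witnesses
  the later arguments reduce to ring identities.\<close>

lemma dvdm_iff: "poly_mod.dvdm p f g \<longleftrightarrow> (\<exists>h s. g = f * h + [:p:] * s)"
  unfolding poly_mod.dvdm_def Mp_eq_iff dvd_def by (simp add: algebra_simps)

lemma dvdmI: "g = f * h + [:p:] * s \<Longrightarrow> poly_mod.dvdm p f g"
  unfolding dvdm_iff by blast

lemma dvdm_refl: "poly_mod.dvdm p f f"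
  by (rule dvdmI[of _ _ 1 _ 0]) simp

lemma dvdm_trans: assumes "poly_mod.dvdm p f g" "poly_mod.dvdm p g h" shows "poly_mod.dvdm p f h"
proof -
  obtain a b c d where "g = f * a + [:p:] * b" "h = g * c + [:p:] * d"
    using assms unfolding dvdm_iff by auto
  then have "h = f * (a * c) + [:p:] * (b * c + d)" by (simp only: algebra_simps)
  then show ?thesis by (rule dvdmI)
qed

lemma dvdm_mult: assumes "poly_mod.dvdm p f g" shows "poly_mod.dvdm p f (g * h)"
proof -
  have "poly_mod.dvdm p g (g * h)" by (rule dvdmI[of _ _ h _ 0]) simp
  with assms show ?thesis by (rule dvdm_trans)
qed

lemma dvdm_add: assumes "poly_mod.dvdm p f g" "poly_mod.dvdm p f h" shows "poly_mod.dvdm p f (g + h)"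
proof -
  obtain a b c d where "g = f * a + [:p:] * b" "h = f * c + [:p:] * d"
    using assms unfolding dvdm_iff by auto
  then have "g + h = f * (a + c) + [:p:] * (b + d)" by (simp only: algebra_simps)
  then show ?thesis by (rule dvdmI)
qed

lemma dvdm_const_dvd: "[:p:] dvd g \<Longrightarrow> poly_mod.dvdm p f g"
  by (auto simp: dvd_def intro: dvdmI[of _ _ 0])

lemma dvdm_cong: "[:p:] dvd g - h \<Longrightarrow> poly_mod.dvdm p f g \<longleftrightarrow> poly_mod.dvdm p f h"
  by (simp add: poly_mod.dvdm_def flip: Mp_eq_iff)

lemma dvdm_of_dvd: "f dvd g \<Longrightarrow> poly_mod.dvdm p f g"
  by (auto simp: dvd_def intro: dvdmI[of _ _ _ _ 0])

lemma monic_not_const_dvd: "prime (p :: int) \<Longrightarrow> monic f \<Longrightarrow> \<not> [:p:] dvd f"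
  by (metis const_poly_dvd_iff not_prime_unit)

lemma monic_mod_cancel:
  assumes "prime (p :: int)" "monic f" "[:p:] dvd f * h" shows "[:p:] dvd h"
proof -
  have "prime_elem [:p:]" using assms(1) by (metis lift_prime_elem_poly normalization_semidom_class.prime_def)
  then show ?thesis using assms monic_not_const_dvd by (metis prime_elem_dvd_mult_iff)
qed

text \<open>With the cofactor reduced to coefficients in {0,...,p-1}, a nonzero leading coefficient
  would survive in the product with the monic f, at a degree that r does not reach; it would then be
  divisible by p.\<close>

lemma monic_dvdm_degree_less:
  assumes p: "prime (p :: int)" and f: "monic f" and d: "poly_mod.dvdm p f r" and r: "degree r < degree f"
  shows "[:p:] dvd r"
proof -
  obtain h s where hs: "r = f * h + [:p:] * s" using d by (auto simp: dvdm_iff)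
  define h' where "h' = poly_mod.Mp p h"
  have "[:p:] dvd h' - h" by (simp add: h'_def dvd_Mp_diff)
  moreover have "f * h' - r = f * (h' - h) - [:p:] * s" by (simp only: hs algebra_simps)
  ultimately have fr: "[:p:] dvd f * h' - r" by (metis dvd_diff dvd_mult dvd_triv_left)
  have "h' = 0"
  proof (rule ccontr)
    assume "h' \<noteq> 0"
    let ?k = "degree f + degree h'"
    have "p dvd coeff (f * h' - r) ?k" using fr by (simp add: const_poly_dvd_iff)
    then have "p dvd lead_coeff h'" using r f by (simp add: coeff_mult_degree_sum coeff_eq_0)
    moreover have "lead_coeff h' = lead_coeff h' mod p"
      using poly_mod.Mp_Mp[of p h] by (metis h'_def poly_mod.Mp_coeff poly_mod.M_def)
    ultimately have "lead_coeff h' = 0" by auto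
    with \<open>h' \<noteq> 0\<close> show False by simp
  qed
  then show ?thesis using fr by simp
qed

lemma monic_dvdm_degree_le:
  assumes "prime (p :: int)" "monic f" "monic g" "poly_mod.dvdm p f g" shows "degree f \<le> degree g"
  using monic_dvdm_degree_less[OF assms(1,2,4)] monic_not_const_dvd[OF assms(1,3)] by force

lemma monic_mod_dvdm_antisym:
  assumes p: "prime (p :: int)" and f: "monic_mod p f" and g: "monic_mod p g"
    and "poly_mod.dvdm p f g" "poly_mod.dvdm p g f"
  shows "f = g"
proof -
  have fg: "monic f" "monic g" using f g by (auto simp: monic_mod_def)
  have deg: "degree f = degree g" using monic_dvdm_degree_le[OF p] assms fg by (meson antisym)
  have "poly_mod.dvdm p f (g + f * (- 1))" using assms by (intro dvdm_add dvdm_mult dvdm_refl)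
  then have d: "poly_mod.dvdm p f (g - f)" by simp
  have "[:p:] dvd g - f"
  proof (cases "degree f = 0")
    case True
    then show ?thesis using fg deg by (metis monic_degree_0 diff_self dvd_0_right)
  next
    case False
    then have "degree (g - f) < degree f"
      using deg fg by (intro degree_lessI) (auto simp: coeff_eq_0 le_less)
    then show ?thesis using monic_dvdm_degree_less[OF p fg(1) d] by simp
  qed
  then show ?thesis using f g by (metis Mp_eq_iff monic_mod_def)
qed

lemma monic_division:
  assumes "monic (h :: int poly)"
  obtains q r where "f = h * q + r" "r = 0 \<or> degree r < degree h"
proof -
  obtain q r where "pseudo_divmod f h = (q, r)" by force
  from pseudo_divmod[OF _ this] assms leading_coeff_0_iff[of h] have "f = h * q + r" "r = 0 \<or> degree r < degree h" by auto
  then show ?thesis using that by blast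
qed

lemma lead_coeff_Mp: assumes "prime (p :: int)" "monic f"
  shows "monic (poly_mod.Mp p f)" "degree (poly_mod.Mp p f) = degree f"
proof -
  have 1: "lead_coeff f mod p = 1" using assms prime_gt_1_int[of p] by simp
  then show d: "degree (poly_mod.Mp p f) = degree f"
    using prime_gt_1_int[OF assms(1)] by (intro poly_mod.degree_m_eq) auto
  have "coeff (poly_mod.Mp p f) (degree f) = lead_coeff f mod p" by (simp only: poly_mod.Mp_coeff poly_mod.M_def)
  then show "monic (poly_mod.Mp p f)" using 1 d by simp
qed

lemma monic_mod_Mp: "prime (p :: int) \<Longrightarrow> monic f \<Longrightarrow> monic_mod p (poly_mod.Mp p f)"
  using lead_coeff_Mp(1) poly_mod.Mp_Mp unfolding monic_mod_def by blast

section \<open>Bezout identities, irreducible factors and quotients modulo p\<close>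

lemma monic_mod_associate:
  assumes p: "prime (p :: int)" and f: "poly_mod.Mp p f = f" "f \<noteq> 0"
  obtains c where "monic_mod p (poly_mod.Mp p (smult c f))" "degree (poly_mod.Mp p (smult c f)) = degree f"
proof -
  have "lead_coeff f mod p = lead_coeff f" using f by (metis poly_mod.Mp_coeff poly_mod.M_def)
  then have "\<not> p dvd lead_coeff f" using f(2) by auto
  then have "gcd (lead_coeff f) p = 1"
    using p prime_imp_coprime_int by (metis coprime_iff_gcd_eq_1 gcd.commute)
  then obtain c v where c: "c * lead_coeff f + v * p = 1" by (metis bezout_int)
  let ?g = "poly_mod.Mp p (smult c f)"
  have "(c * lead_coeff f) mod p = 1 mod p" using c by (metis mod_mult_self1)
  then have co: "coeff ?g (degree f) = 1"
    using prime_gt_1_int[OF p] by (simp add: poly_mod.Mp_coeff poly_mod.M_def)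
  have "degree ?g \<le> degree f"
    using degree_smult_le le_trans poly_mod.degree_m_le by blast
  then have "degree ?g = degree f" using co by (metis le_antisym le_degree zero_neq_one)
  moreover have "monic_mod p ?g" using co calculation by (simp add: monic_mod_def poly_mod.Mp_Mp)
  ultimately show ?thesis using that by blast
qed

text \<open>d is a nonzero reduced element of least degree in the ideal (f, g, p), normalized to be
  monic so that division with remainder is possible over Z. A remainder not divisible by p would
  give a reduced element of smaller degree.\<close>

lemma bezout_mod:
  assumes p: "prime (p :: int)" and fg: "\<not> ([:p:] dvd f \<and> [:p:] dvd g)"
  obtains d u v s where "monic_mod p d" "poly_mod.dvdm p d f" "poly_mod.dvdm p d g" "d = u * f + v * g + [:p:] * s"
proof -
  define S where "S = {d. \<exists>u v s. d = u * f + v * g + [:p:] * s}"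
  have SI: "u * f + v * g + [:p:] * s \<in> S" for u v s by (auto simp: S_def)
  have S_comb: "a - b * c \<in> S" if ab: "a \<in> S" "b \<in> S" for a b c
  proof -
    obtain u v s where "a = u * f + v * g + [:p:] * s" using ab(1) unfolding S_def by blast
    moreover obtain u' v' s' where "b = u' * f + v' * g + [:p:] * s'" using ab(2) unfolding S_def by blast
    ultimately have "a - b * c = (u - u' * c) * f + (v - v' * c) * g + [:p:] * (s - s' * c)"
      by (simp only: algebra_simps)
    then show ?thesis by (simp only: SI)
  qed
  have S_smult: "smult c a \<in> S" if "a \<in> S" for c a
    using S_comb[OF SI[of 0 0 0] that, of "- [:c:]"] by simp
  have S_Mp: "poly_mod.Mp p a \<in> S" if "a \<in> S" for a
  proof -
    obtain t where t: "poly_mod.Mp p a - a = [:p:] * t" using dvd_Mp_diff by (metis dvdE)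
    have "a - [:p:] * (- t) \<in> S" using S_comb[OF that SI[of 0 0 1], of "- t"] by simp
    moreover have "a - [:p:] * (- t) = poly_mod.Mp p a" using t by (simp only: algebra_simps)
    ultimately show ?thesis by simp
  qed
  define T where "T = {d \<in> S. poly_mod.Mp p d = d \<and> d \<noteq> 0}"
  have "f \<in> S" "g \<in> S" using SI[of 1 0 0] SI[of 0 1 0] by simp_all
  then have "poly_mod.Mp p f \<in> S \<and> poly_mod.Mp p g \<in> S" using S_Mp by blast
  moreover have "poly_mod.Mp p f \<noteq> 0 \<or> poly_mod.Mp p g \<noteq> 0" using fg by (simp add: Mp_eq_0_iff)
  ultimately have "\<exists>d. d \<in> T" by (auto simp: T_def poly_mod.Mp_Mp)
  then obtain d0 where d0: "d0 \<in> T" and min0: "\<And>e. e \<in> T \<Longrightarrow> degree d0 \<le> degree e"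
    using ex_has_least_nat[of "\<lambda>d. d \<in> T" _ degree] by blast
  obtain c where c: "monic_mod p (poly_mod.Mp p (smult c d0))" "degree (poly_mod.Mp p (smult c d0)) = degree d0"
    using monic_mod_associate[OF p, of d0] d0 by (auto simp: T_def)
  define d where "d = poly_mod.Mp p (smult c d0)"
  have dS: "d \<in> S" using d0 S_smult S_Mp by (simp add: d_def T_def)
  have dvd: "poly_mod.dvdm p d a" if "a \<in> S" for a
  proof -
    have "monic d" using c by (simp add: d_def monic_mod_def)
    then obtain q r where qr: "a = d * q + r" "r = 0 \<or> degree r < degree d" by (rule monic_division)
    have "r = a - d * q" using qr by simp
    then have rS: "r \<in> S" using S_comb[OF that dS] by simp
    have "[:p:] dvd r"
    proof (rule ccontr)
      assume r: "\<not> [:p:] dvd r"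
      then have "poly_mod.Mp p r \<in> T" using S_Mp[OF rS] by (simp add: T_def poly_mod.Mp_Mp Mp_eq_0_iff)
      then have "degree d \<le> degree (poly_mod.Mp p r)" using min0 c by (simp add: d_def)
      also have "\<dots> \<le> degree r" by (rule poly_mod.degree_m_le)
      finally show False using qr r by auto
    qed
    then show ?thesis using qr by (auto simp: dvd_def intro: dvdmI)
  qed
  show ?thesis using that c(1) dvd[OF \<open>f \<in> S\<close>] dvd[OF \<open>g \<in> S\<close>] dS
    by (auto simp: S_def d_def[symmetric])
qed

lemma const_dvd_smult [simp]: "[:p:] dvd smult p (f :: int poly)"
  by (simp add: const_poly_dvd_iff)

lemma gcd_mod_props:
  assumes p: "prime (p :: int)" and f: "\<not> [:p:] dvd f"
  shows "monic_mod p (gcd_mod p f g)" "poly_mod.dvdm p (gcd_mod p f g) f" "poly_mod.dvdm p (gcd_mod p f g) g"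
proof -
  obtain d u v s where d: "monic_mod p d" "poly_mod.dvdm p d f" "poly_mod.dvdm p d g"
    and dd: "d = u * f + v * g + [:p:] * s"
    using bezout_mod[OF p] f by metis
  have max: "poly_mod.dvdm p h d" if "poly_mod.dvdm p h f" "poly_mod.dvdm p h g" for h
    unfolding dd using that dvdm_mult[of p h f u] dvdm_mult[of p h g v]
    by (intro dvdm_add dvdm_const_dvd[of p "[:p:] * s"]) (simp_all add: mult.commute)
  have "gcd_mod p f g = d" unfolding gcd_mod_def
    using d max monic_mod_dvdm_antisym[OF p] by (intro the_equality) blast+
  with d show "monic_mod p (gcd_mod p f g)" "poly_mod.dvdm p (gcd_mod p f g) f" "poly_mod.dvdm p (gcd_mod p f g) g"
    by simp_all
qed

text \<open>Take the Bezout divisor d of \<phi> and a. If d is a unit modulo p, multiply the Bezout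
  identity by b; if its cofactor in \<phi> is a unit, then \<phi> divides d and hence a.\<close>

lemma irreducible_m_prime:
  assumes p: "prime (p :: int)" and irr: "poly_mod.irreducible_m p \<phi>" and ab: "poly_mod.dvdm p \<phi> (a * b)"
    and na: "\<not> poly_mod.dvdm p \<phi> a"
  shows "poly_mod.dvdm p \<phi> b"
proof -
  have "\<not> [:p:] dvd \<phi>" using irr Mp_eq_0_iff[of p \<phi>] by (auto simp: poly_mod.irreducible_m_def poly_mod.Mp_0)
  then obtain d u v s where d: "poly_mod.dvdm p d \<phi>" "poly_mod.dvdm p d a"
    and dd: "d = u * \<phi> + v * a + [:p:] * s"
    using bezout_mod[OF p] by metis
  obtain h t where h: "\<phi> = d * h + [:p:] * t" using d(1) by (auto simp: dvdm_iff)
  then have "poly_mod.Mp p \<phi> = poly_mod.Mp p (d * h)" by (simp add: Mp_eq_iff)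
  then consider "poly_mod.dvdm p d 1" | "poly_mod.dvdm p h 1"
    using irr by (auto simp: poly_mod.irreducible_m_def)
  then show ?thesis
  proof cases
    case 1
    then obtain w t' where w: "1 = d * w + [:p:] * t'" by (auto simp: dvdm_iff)
    have "b = b * (d * w + [:p:] * t')" using w by simp
    also have "\<dots> = \<phi> * (b * w * u) + (a * b) * (v * w) + [:p:] * (b * t' + b * w * s)"
      unfolding dd by (simp only: algebra_simps)
    finally show ?thesis
      using ab by (metis dvdm_add dvdm_mult dvdm_refl dvdm_const_dvd dvd_triv_left)
  next
    case 2
    then obtain w t' where w: "1 = h * w + [:p:] * t'" by (auto simp: dvdm_iff)
    have "d = d * (h * w + [:p:] * t')" using w by simp
    also have "\<dots> = \<phi> * w + [:p:] * (d * t' - t * w)"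
      unfolding h by (simp only: algebra_simps)
    finally have "poly_mod.dvdm p \<phi> d" by (rule dvdmI)
    then show ?thesis using na d(2) dvdm_trans by blast
  qed
qed

lemma irreducible_m_dvdm_eq:
  assumes p: "prime (p :: int)" and \<phi>: "monic_mod p \<phi>" "poly_mod.irreducible_m p \<phi>"
    and \<psi>: "monic_mod p \<psi>" "poly_mod.irreducible_m p \<psi>" and d: "poly_mod.dvdm p \<phi> \<psi>"
  shows "\<phi> = \<psi>"
proof -
  obtain h t where h: "\<psi> = \<phi> * h + [:p:] * t" using d by (auto simp: dvdm_iff)
  then have "poly_mod.Mp p \<psi> = poly_mod.Mp p (\<phi> * h)" by (simp add: Mp_eq_iff)
  then have "poly_mod.dvdm p h 1"
    using \<phi>(2) \<psi>(2) by (auto simp: poly_mod.irreducible_m_def)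
  then obtain w t' where w: "1 = h * w + [:p:] * t'" by (auto simp: dvdm_iff)
  have "\<phi> = \<phi> * (h * w + [:p:] * t')" using w by simp
  also have "\<dots> = \<psi> * w + [:p:] * (\<phi> * t' - t * w)"
    unfolding h by (simp only: algebra_simps)
  finally have "poly_mod.dvdm p \<psi> \<phi>" by (rule dvdmI)
  then show ?thesis using monic_mod_dvdm_antisym p \<phi> \<psi> d by blast
qed

lemma irreducible_m_dvdm_prod:
  assumes p: "prime (p :: int)" and "poly_mod.irreducible_m p \<phi>" and "finite S"
    and "poly_mod.dvdm p \<phi> (\<Prod>S)"
  shows "\<exists>\<psi>\<in>S. poly_mod.dvdm p \<phi> \<psi>"
  using assms(3,4)
proof (induction S)
  case empty
  then show ?case using assms(2) by (simp add: poly_mod.irreducible_m_def)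
next
  case (insert \<psi> S)
  then show ?case using irreducible_m_prime[OF p assms(2), of \<psi> "\<Prod>S"] by auto
qed

text \<open>Distinct monic irreducibles do not divide each other, so a new factor cannot divide the
  product of the earlier ones and must divide the remaining cofactor of f.\<close>

lemma prod_irreducible_m_dvdm:
  assumes p: "prime (p :: int)" and "finite S"
    and "\<And>\<phi>. \<phi> \<in> S \<Longrightarrow> monic_mod p \<phi> \<and> poly_mod.irreducible_m p \<phi> \<and> poly_mod.dvdm p \<phi> f"
  shows "poly_mod.dvdm p (\<Prod>S) f"
  using assms(2,3)
proof (induction S)
  case empty
  show ?case by (simp add: dvdm_of_dvd)
next
  case (insert \<phi> S)
  then have \<phi>: "monic_mod p \<phi>" "poly_mod.irreducible_m p \<phi>" "poly_mod.dvdm p \<phi> f" by auto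
  obtain h t where h: "f = \<Prod>S * h + [:p:] * t" using insert by (auto simp: dvdm_iff)
  have "\<not> poly_mod.dvdm p \<phi> (\<Prod>S)"
    using irreducible_m_dvdm_prod[OF p \<phi>(2) insert.hyps(1)] irreducible_m_dvdm_eq[OF p \<phi>(1,2)] insert.hyps insert.prems
    by blast
  moreover have "poly_mod.dvdm p \<phi> (\<Prod>S * h)"
    using \<phi>(3) dvdm_cong[of p f "\<Prod>S * h" \<phi>] h by simp
  ultimately have "poly_mod.dvdm p \<phi> h" using irreducible_m_prime[OF p \<phi>(2)] by blast
  then obtain k t' where k: "h = \<phi> * k + [:p:] * t'" by (auto simp: dvdm_iff)
  have "f = (\<phi> * \<Prod>S) * k + [:p:] * (\<Prod>S * t' + t)" unfolding h k by (simp only: algebra_simps)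
  then show ?case using insert.hyps by (auto intro: dvdmI)
qed

text \<open>Over an infinite index set the product in \<open>sfp_mod\<close> would take its default
  value 1. Reduced coefficients and bounded degree leave only finitely many divisors.\<close>

lemma finite_monic_mod_dvdm:
  assumes p: "prime (p :: int)" and f: "monic f"
  shows "finite {h. monic_mod p h \<and> poly_mod.dvdm p h f}"
proof (rule finite_subset)
  let ?L = "{xs. set xs \<subseteq> {0..<p} \<and> length xs \<le> degree f + 1}"
  show "{h. monic_mod p h \<and> poly_mod.dvdm p h f} \<subseteq> Poly ` ?L"
  proof
    fix h assume "h \<in> {h. monic_mod p h \<and> poly_mod.dvdm p h f}"
    then have h: "poly_mod.Mp p h = h" "monic h" "poly_mod.dvdm p h f" by (auto simp: monic_mod_def)
    have "coeff h i \<in> {0..<p}" for i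
      using arg_cong[OF h(1), of "\<lambda>g. coeff g i"] prime_gt_0_int[OF p]
      by (simp add: poly_mod.Mp_coeff poly_mod.M_def) (metis pos_mod_bound pos_mod_sign)
    then have "set (coeffs h) \<subseteq> {0..<p}" by (auto simp: coeffs_def)
    moreover have "length (coeffs h) \<le> degree f + 1"
      using monic_dvdm_degree_le[OF p h(2) f h(3)] h(2) by (cases "h = 0") (auto simp: length_coeffs_degree)
    ultimately show "h \<in> Poly ` ?L" by (metis (mono_tags, lifting) Poly_coeffs image_eqI mem_Collect_eq)
  qed
  show "finite (Poly ` ?L)" by (intro finite_imageI finite_lists_length_le) simp
qed

text \<open>The third claim is the gain from passing to the squarefree part: an irreducible divisor
  of \<open>f * f\<close> already divides f.\<close>

lemma sfp_mod_props:
  assumes p: "prime (p :: int)" and g: "monic g"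
  shows "monic_mod p (sfp_mod p g)" "poly_mod.dvdm p (sfp_mod p g) g"
    "poly_mod.dvdm p g (f * f) \<Longrightarrow> poly_mod.dvdm p (sfp_mod p g) f"
proof -
  let ?S = "{h. monic_mod p h \<and> poly_mod.irreducible_m p h \<and> poly_mod.dvdm p h g}"
  have fin: "finite ?S" by (rule finite_subset[OF _ finite_monic_mod_dvdm[OF p g]]) auto
  have "monic (\<Prod>?S)" by (intro monic_prod) (auto simp: monic_mod_def)
  then show "monic_mod p (sfp_mod p g)" unfolding sfp_mod_def by (intro monic_mod_Mp p)
  show "poly_mod.dvdm p (sfp_mod p g) g"
    unfolding sfp_mod_def poly_mod.Mp_dvdm by (intro prod_irreducible_m_dvdm p fin) auto
  show "poly_mod.dvdm p (sfp_mod p g) f" if gf: "poly_mod.dvdm p g (f * f)"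
    unfolding sfp_mod_def poly_mod.Mp_dvdm
  proof (intro prod_irreducible_m_dvdm p fin)
    fix \<phi> assume \<phi>: "\<phi> \<in> ?S"
    then have "poly_mod.dvdm p \<phi> (f * f)" using gf dvdm_trans by blast
    then show "monic_mod p \<phi> \<and> poly_mod.irreducible_m p \<phi> \<and> poly_mod.dvdm p \<phi> f"
      using \<phi> irreducible_m_prime[OF p] by blast
  qed
qed

text \<open>Dividing by the monic g over Z leaves a remainder of smaller degree that g divides
  modulo p, so this remainder vanishes modulo p and the reduced quotient is the one that
  \<open>quot_mod\<close> describes. Uniqueness holds because a monic factor cancels modulo
  p.\<close>

lemma quot_mod_props:
  assumes p: "prime (p :: int)" and f: "monic f" and g: "monic g" and d: "poly_mod.dvdm p g f"
  shows "monic_mod p (quot_mod p f g)" "[:p:] dvd quot_mod p f g * g - f"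
    "degree (quot_mod p f g) \<le> degree f"
proof -
  obtain q r where qr: "f = g * q + r" "r = 0 \<or> degree r < degree g" using g by (rule monic_division)
  have "r = f + g * (- q)" using qr by simp
  then have "poly_mod.dvdm p g r" using d by (metis dvdm_add dvdm_mult dvdm_refl)
  then have r: "[:p:] dvd r" using qr monic_dvdm_degree_less[OF p g] by auto
  let ?q = "poly_mod.Mp p q"
  have "degree g \<le> degree f" using monic_dvdm_degree_le[OF p g f d] .
  have q0: "q \<noteq> 0" using qr r monic_not_const_dvd[OF p f] by auto
  have lc: "lead_coeff (g * q) = lead_coeff q" using g by (simp add: lead_coeff_mult)
  have dg: "degree (g * q) = degree g + degree q" using q0 g by (intro degree_mult_eq) auto
  have "monic q \<and> degree q \<le> degree f"
  proof (cases "r = 0")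
    case True
    then show ?thesis using qr f lc dg by simp
  next
    case False
    then have "degree r < degree (g * q)" using qr(2) dg by simp
    then have "lead_coeff f = lead_coeff (g * q)" "degree f = degree (g * q)"
      using qr(1) by (auto simp: degree_add_eq_left coeff_eq_0)
    then show ?thesis using f lc dg by simp
  qed
  then have q: "monic q" "degree q \<le> degree f" by auto
  have eq: "[:p:] dvd ?q * g - f"
  proof -
    have "?q * g - f = (?q - q) * g - r" using qr(1) by (simp add: algebra_simps)
    then show ?thesis using r dvd_Mp_diff by (metis dvd_diff dvd_mult2)
  qed
  have "quot_mod p f g = ?q" unfolding quot_mod_def
  proof (rule the_equality)
    show "poly_mod.Mp p ?q = ?q \<and> poly_mod.Mp p (?q * g) = poly_mod.Mp p f"
      using eq by (simp add: Mp_eq_iff[of p "_ * g"] poly_mod.Mp_Mp)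
    fix q' assume q': "poly_mod.Mp p q' = q' \<and> poly_mod.Mp p (q' * g) = poly_mod.Mp p f"
    then have "[:p:] dvd q' * g - f" by (simp add: Mp_eq_iff)
    then have "[:p:] dvd (q' * g - f) - (?q * g - f)" using eq by (rule dvd_diff)
    moreover have "(q' * g - f) - (?q * g - f) = g * (q' - ?q)" by (simp only: algebra_simps)
    ultimately have "[:p:] dvd q' - ?q" using monic_mod_cancel[OF p g] by metis
    then show "q' = ?q" using q' by (metis Mp_eq_iff poly_mod.Mp_Mp)
  qed
  then show "monic_mod p (quot_mod p f g)" "[:p:] dvd quot_mod p f g * g - f" "degree (quot_mod p f g) \<le> degree f"
    using eq monic_mod_Mp[OF p q(1)] lead_coeff_Mp(2)[OF p q(1)] q(2) by simp_all
qed

text \<open>With \<open>g = gcd(\<chi>, v)\<close>, \<open>\<chi> = g c\<close> and \<open>v = g b\<close>, the assumption forces \<open>c | g\<close>, so \<open>\<chi> = c\<^sup>2 g'\<close>; then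
  \<open>c | \<chi>'\<close> and \<open>c g' | v\<close>.\<close>
lemma dvdm_square_pderiv:
  assumes p: "prime (p :: int)" and \<chi>: "monic \<chi>" and d: "poly_mod.dvdm p \<chi> (v * v)"
  shows "poly_mod.dvdm p \<chi> (pderiv \<chi> * v)"
proof -
  let ?P = "[:p:]"
  obtain g u w s where g: "monic_mod p g" "poly_mod.dvdm p g \<chi>" "poly_mod.dvdm p g v"
    and gg: "g = u * \<chi> + w * v + ?P * s"
    using bezout_mod[OF p] monic_not_const_dvd[OF p \<chi>] by metis
  obtain c a1 where c: "\<chi> = g * c + ?P * a1" using g by (auto simp: dvdm_iff)
  obtain b a2 where b: "v = g * b + ?P * a2" using g by (auto simp: dvdm_iff)
  obtain k a3 where k: "v * v = \<chi> * k + ?P * a3" using d by (auto simp: dvdm_iff)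
  have mg: "monic g" using g by (simp add: monic_mod_def)
  have "g * (1 - u * c - w * b) = ?P * (u * a1 + w * a2 + s)"
    using gg unfolding c b by (simp only: algebra_simps)
  then have "?P dvd 1 - u * c - w * b" using monic_mod_cancel[OF p mg] by (metis dvd_triv_left)
  then obtain a4 where a4: "1 - u * c - w * b = ?P * a4" by (auto simp only: dvd_def)
  have "g * (g * b * b - c * k) = ?P * (a1 * k + a3 - a2 * v - g * b * a2)"
    using k unfolding c b by (simp only: algebra_simps)
  then have "?P dvd g * b * b - c * k" using monic_mod_cancel[OF p mg] by (metis dvd_triv_left)
  then obtain a5 where a5: "g * b * b - c * k = ?P * a5" by (auto simp only: dvd_def)
  \<comment> \<open>\<open>z\<close> is congruent to 1. Expanding \<open>g * (z * z)\<close> and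
    replacing \<open>g * b * b\<close> by \<open>c * k\<close> leaves a multiple of c; therefore c
    divides g modulo p, with quotient \<open>g'\<close>.\<close>
  define z where "z = u * c + w * b"
  have z: "z = 1 - ?P * a4" using a4 by (simp add: z_def algebra_simps)
  have gz: "g * (z * z) = c * (g * (u * u * c + 2 * u * w * b) + w * w * k) + ?P * (w * w * a5)"
  proof -
    have "g * (z * z) = c * (g * (u * u * c + 2 * u * w * b)) + w * w * (g * b * b)"
      unfolding z_def by (simp add: algebra_simps)
    also have "g * b * b = c * k + ?P * a5" using a5 by (simp only: algebra_simps)
    finally show ?thesis by (simp only: algebra_simps)
  qed
  have gz2: "g * (z * z) = g - ?P * (g * (a4 + a4 - ?P * a4 * a4))"
    unfolding z by (simp only: algebra_simps)
  define g' where "g' = g * (u * u * c + 2 * u * w * b) + w * w * k"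
  obtain a6 where a6: "g = c * g' + ?P * a6"
  proof
    show "g = c * g' + ?P * (w * w * a5 + g * (a4 + a4 - ?P * a4 * a4))"
      using gz gz2 unfolding g'_def by (simp only: algebra_simps)
  qed
  have \<chi>2: "\<chi> = c * c * g' + ?P * (a6 * c + a1)" unfolding c by (subst a6) (simp only: algebra_simps)
  have pP: "pderiv (?P * f) = ?P * pderiv f" for f by (simp add: pderiv_smult)
  have pd: "pderiv \<chi> = c * (pderiv c * g' + pderiv c * g' + c * pderiv g') + ?P * pderiv (a6 * c + a1)"
    by (subst \<chi>2) (simp only: pderiv_add[of "c * c * g'"] pP, simp only: pderiv_mult algebra_simps)
  have "pderiv \<chi> * v = \<chi> * (b * (pderiv c * g' + pderiv c * g' + c * pderiv g')) +
     ?P * (pderiv (a6 * c + a1) * v + c * (pderiv c * g' + pderiv c * g' + c * pderiv g') * (a6 * b + a2)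
       - (a6 * c + a1) * b * (pderiv c * g' + pderiv c * g' + c * pderiv g'))" (is "_ = ?R")
  proof -
    define D where "D = pderiv c * g' + pderiv c * g' + c * pderiv g'"
    define E where "E = pderiv (a6 * c + a1)"
    have v: "v = c * g' * b + ?P * (a6 * b + a2)" unfolding b by (subst a6) (simp only: algebra_simps)
    have "pderiv \<chi> * v = (c * D + ?P * E) * v" using pd by (simp only: D_def E_def)
    also have "\<dots> = c * D * (c * g' * b + ?P * (a6 * b + a2)) + ?P * E * v"
      using v by (metis distrib_right)
    also have "\<dots> = (c * c * g' + ?P * (a6 * c + a1)) * (b * D) + ?P * (E * v + c * D * (a6 * b + a2) - (a6 * c + a1) * b * D)"
      by (simp only: algebra_simps)
    also have "c * c * g' + ?P * (a6 * c + a1) = \<chi>" using \<chi>2 by simp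
    finally show ?thesis unfolding D_def E_def .
  qed
  then show ?thesis by (rule dvdmI)
qed

section \<open>The Smith normal form\<close>

text \<open>Unimodularity is expressed through the determinant, which is easy to follow through
  products, transposes and block matrices; \<open>unimodular_invertible\<close> converts it to the
  form in \<open>smith_normal_form\<close>.\<close>

definition unimodular_equiv :: "nat \<Rightarrow> int mat \<Rightarrow> int mat \<Rightarrow> bool" where
  "unimodular_equiv n M N \<longleftrightarrow> (\<exists>U V. U \<in> carrier_mat n n \<and> V \<in> carrier_mat n n \<and>
     det U dvd 1 \<and> det V dvd 1 \<and> N = U * M * V)"

lemma unimodular_equivI:
  "U \<in> carrier_mat n n \<Longrightarrow> V \<in> carrier_mat n n \<Longrightarrow> det U dvd 1 \<Longrightarrow> det V dvd 1 \<Longrightarrow>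
   unimodular_equiv n M (U * M * V)"
  unfolding unimodular_equiv_def by blast

lemma unimodular_equiv_trans:
  assumes "M \<in> carrier_mat n n" "unimodular_equiv n M N" "unimodular_equiv n N K"
  shows "unimodular_equiv n M K"
proof -
  obtain U V U' V' where C: "U \<in> carrier_mat n n" "V \<in> carrier_mat n n" "U' \<in> carrier_mat n n" "V' \<in> carrier_mat n n"
    and d: "det U dvd 1" "det V dvd 1" "det U' dvd 1" "det V' dvd 1" and e: "N = U * M * V" "K = U' * N * V'"
    using assms(2,3) unfolding unimodular_equiv_def by blast
  have "det (U' * U) dvd 1" "det (V * V') dvd 1" using C d by (simp_all add: det_mult abs_mult)
  moreover have "K = (U' * U) * M * (V * V')"
    using C assms(1) unfolding e by (simp add: assoc_mult_mat[of _ n n _ n _ n])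
  ultimately show ?thesis using C unimodular_equivI[of "U' * U" n "V * V'" M] by simp
qed

lemma unimodular_equiv_left:
  assumes "U \<in> carrier_mat n n" "det U dvd 1" "M \<in> carrier_mat n n"
  shows "unimodular_equiv n M (U * M)"
  using unimodular_equivI[of U n "1\<^sub>m n" M] assms by simp

lemma unimodular_equiv_carrier:
  "unimodular_equiv n M N \<Longrightarrow> N \<in> carrier_mat n n"
  unfolding unimodular_equiv_def by auto

lemma unimodular_equiv_transpose:
  assumes "M \<in> carrier_mat n n" "unimodular_equiv n M N"
  shows "unimodular_equiv n (transpose_mat M) (transpose_mat N)"
proof -
  obtain U V where C: "U \<in> carrier_mat n n" "V \<in> carrier_mat n n"
    and d: "det U dvd 1" "det V dvd 1" and e: "N = U * M * V"
    using assms(2) unfolding unimodular_equiv_def by blast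
  have "transpose_mat N = transpose_mat V * transpose_mat M * transpose_mat U"
    using C assms(1) unfolding e by (simp add: transpose_mult[of _ n n _ n] assoc_mult_mat[of _ n n _ n _ n])
  then show ?thesis
    using unimodular_equivI[of "transpose_mat V" n "transpose_mat U" "transpose_mat M"] C d by (simp add: det_transpose)
qed

text \<open>An entry of least absolute value among all matrices equivalent to \<open>M\<close> divides its row and column,
  since a nonzero remainder would be a smaller entry of an equivalent matrix.\<close>
definition least_entry :: "nat \<Rightarrow> int \<Rightarrow> int mat \<Rightarrow> bool" where
  "least_entry n a M \<longleftrightarrow> M \<in> carrier_mat n n \<and> a \<noteq> 0 \<and>
     (\<forall>N i j. unimodular_equiv n M N \<longrightarrow> i < n \<longrightarrow> j < n \<longrightarrow> N $$ (i,j) \<noteq> 0 \<longrightarrow> \<bar>a\<bar> \<le> \<bar>N $$ (i,j)\<bar>)"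

lemma least_entry_equiv:
  assumes "least_entry n a M" "unimodular_equiv n M N" shows "least_entry n a N"
  using assms unimodular_equiv_trans unimodular_equiv_carrier unfolding least_entry_def by metis

lemma least_entry_transpose:
  assumes "least_entry n a M" shows "least_entry n a (transpose_mat M)"
proof -
  have M: "M \<in> carrier_mat n n" using assms by (simp add: least_entry_def)
  have "\<bar>a\<bar> \<le> \<bar>N $$ (i,j)\<bar>" if "unimodular_equiv n (transpose_mat M) N" "i < n" "j < n" "N $$ (i,j) \<noteq> 0" for N i j
  proof -
    have "unimodular_equiv n M (transpose_mat N)"
      using unimodular_equiv_transpose[OF _ that(1)] M by simp
    moreover have "transpose_mat N $$ (j,i) = N $$ (i,j)"
      using that unimodular_equiv_carrier[OF that(1)] by simp
    ultimately show ?thesis using assms that unfolding least_entry_def by metis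
  qed
  then show ?thesis using assms by (auto simp: least_entry_def)
qed

lemma least_entry_dvd_col:
  assumes M: "least_entry n a M" and a: "M $$ (0,0) = a" and i: "i < n"
  shows "a dvd M $$ (i,0)"
proof (cases "i = 0")
  case False
  have C: "M \<in> carrier_mat n n" using M by (simp add: least_entry_def)
  let ?q = "- (M $$ (i,0) div a)"
  have "unimodular_equiv n M (addrow_mat n ?q i 0 * M)"
    using C False by (intro unimodular_equiv_left) (auto simp: det_addrow_mat)
  moreover have "(addrow_mat n ?q i 0 * M) $$ (i,0) = M $$ (i,0) mod a"
    using C i a by (subst addrow_mat[symmetric, of _ _ n]) (auto simp: minus_div_mult_eq_mod[symmetric])
  moreover have "a \<noteq> 0" using M by (simp add: least_entry_def)
  ultimately have "M $$ (i,0) mod a = 0"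
    using M i abs_mod_less[of a "M $$ (i,0)"] unfolding least_entry_def by (metis bot_nat_0.not_eq_extremum not_le not_less_zero)
  then show ?thesis by auto
qed (use a in simp)

lemma least_entry_dvd_row:
  assumes M: "least_entry n a M" and a: "M $$ (0,0) = a" and j: "j < n"
  shows "a dvd M $$ (0,j)"
proof -
  have C: "M \<in> carrier_mat n n" using M by (simp add: least_entry_def)
  then show ?thesis
    using least_entry_dvd_col[OF least_entry_transpose[OF M], of j] a j by simp
qed

lemma least_entry_exists:
  assumes M: "M \<in> carrier_mat n n" and nz: "i0 < n" "j0 < n" "M $$ (i0,j0) \<noteq> 0"
  obtains N where "unimodular_equiv n M N" "least_entry n (N $$ (0,0)) N"
proof -
  define P where "P x \<longleftrightarrow> (\<exists>N i j. unimodular_equiv n M N \<and> i < n \<and> j < n \<and> N $$ (i,j) \<noteq> 0 \<and> x = N $$ (i,j))" for x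
  have "unimodular_equiv n M M" using unimodular_equiv_left[of "1\<^sub>m n" n M] M by simp
  then have "P (M $$ (i0,j0))" unfolding P_def using nz by blast
  then obtain a where a: "P a" and min: "\<And>b. P b \<Longrightarrow> nat \<bar>a\<bar> \<le> nat \<bar>b\<bar>"
    using ex_has_least_nat[of P _ "\<lambda>x. nat \<bar>x\<bar>"] by blast
  obtain N i j where N: "unimodular_equiv n M N" "i < n" "j < n" "N $$ (i,j) \<noteq> 0" "a = N $$ (i,j)"
    using a unfolding P_def by blast
  have NC: "N \<in> carrier_mat n n" using unimodular_equiv_carrier[OF N(1)] .
  have "\<bar>a\<bar> \<le> \<bar>K $$ (k,l)\<bar>" if "unimodular_equiv n N K" "k < n" "l < n" "K $$ (k,l) \<noteq> 0" for K k l
    using min[of "K $$ (k,l)"] unimodular_equiv_trans[OF M N(1) that(1)] that unfolding P_def by force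
  then have l: "least_entry n a N" using N NC by (auto simp: least_entry_def)
  let ?S = "\<lambda>k. swaprows_mat n 0 k :: int mat"
  have S: "det (?S k) dvd 1" "?S k \<in> carrier_mat n n" if "k < n" for k
  proof -
    \<comment> \<open>The trivial swap has determinant 1, every other one has determinant
      -1.\<close>
    have "?S 0 = 1\<^sub>m n" by (intro eq_matI) auto
    then show "det (?S k) dvd 1"
      using that det_swaprows_mat[of 0 n k, where ?'a = int] by (cases "k = 0") simp_all
    show "?S k \<in> carrier_mat n n" by simp
  qed
  \<comment> \<open>A row swap on the left and a column swap on the right bring the least entry to
    the corner.\<close>
  let ?K = "?S i * N * transpose_mat (?S j)"
  have eq: "unimodular_equiv n N ?K"
    using S N by (intro unimodular_equivI) (auto simp: det_transpose[of _ n])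
  have "?K = transpose_mat (?S j * transpose_mat (?S i * N))"
    using S N NC by (simp add: transpose_mult[of _ n n _ n])
  then have "?K $$ (0,0) = (?S j * transpose_mat (?S i * N)) $$ (0,0)" using N by simp
  also have "\<dots> = swaprows 0 j (transpose_mat (?S i * N)) $$ (0,0)"
    using N NC by (subst swaprows_mat[of _ n n]) auto
  also have "\<dots> = (?S i * N) $$ (0,j)" using N NC by (auto simp: mat_swaprows_def)
  also have "\<dots> = swaprows 0 i N $$ (0,j)" using N NC by (subst swaprows_mat[of _ n n]) auto
  also have "\<dots> = a" using N NC by (auto simp: mat_swaprows_def)
  finally have "?K $$ (0,0) = a" .
  then show ?thesis
    using that[of ?K] unimodular_equiv_trans[OF M N(1) eq] least_entry_equiv[OF l eq] by metis
qed

text \<open>Writing the first row and column as \<open>A * R\<close> and \<open>C * A\<close>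
  encodes their divisibility by the corner, so that the eliminating matrices have integral
  entries.\<close>

lemma four_block_reduce:
  fixes R C E :: "int mat"
  assumes "R \<in> carrier_mat 1 m" "C \<in> carrier_mat m 1" "E \<in> carrier_mat m m" "A \<in> carrier_mat 1 1"
  shows "unimodular_equiv (Suc m) (four_block_mat A (A * R) (C * A) E)
     (four_block_mat A (0\<^sub>m 1 m) (0\<^sub>m m 1) (E - C * A * R))"
proof -
  let ?U = "four_block_mat (1\<^sub>m 1) (0\<^sub>m 1 m) (- C) (1\<^sub>m m)" and ?V = "four_block_mat (1\<^sub>m 1) (- R) (0\<^sub>m m 1) (1\<^sub>m m)"
  let ?N = "four_block_mat A (A * R) (C * A) E"
  define F where "F = E - C * A * R"
  have CA: "C * A \<in> carrier_mat m 1" and AR: "A * R \<in> carrier_mat 1 m" and F: "F \<in> carrier_mat m m"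
    and CAR: "C * (A * R) = C * A * R"
    using assms by (auto simp: F_def)
  have "det ?U = 1" "det ?V = 1"
    using assms by (simp_all add: det_four_block_mat_upper_right_zero[of _ 1 _ m] det_four_block_mat_lower_left_zero[of _ 1 _ m])
  moreover have "?U \<in> carrier_mat (Suc m) (Suc m)" "?V \<in> carrier_mat (Suc m) (Suc m)"
    using four_block_carrier_mat[of "1\<^sub>m 1" 1 1 "1\<^sub>m m" m m] by simp_all
  moreover have "?U * ?N = four_block_mat A (A * R) (0\<^sub>m m 1) F"
  proof -
    have e: "1\<^sub>m 1 * A + 0\<^sub>m 1 m * (C * A) = A" "1\<^sub>m 1 * (A * R) + 0\<^sub>m 1 m * E = A * R"
      "- C * A + 1\<^sub>m m * (C * A) = 0\<^sub>m m 1" "- C * (A * R) + 1\<^sub>m m * E = F"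
      using assms CA AR CAR by (simp_all add: uminus_l_inv_mat[of _ m 1] F_def) (intro eq_matI, auto)
    show ?thesis
      by (subst mult_four_block_mat[of _ 1 1 _ m _ m _ _ 1 _ m]) (simp_all only: e assms AR CA one_carrier_mat zero_carrier_mat uminus_carrier_mat)
  qed
  moreover have "four_block_mat A (A * R) (0\<^sub>m m 1) F * ?V = four_block_mat A (0\<^sub>m 1 m) (0\<^sub>m m 1) F"
  proof -
    have zero_uminus: "- 0\<^sub>m m m = (0\<^sub>m m m :: int mat)" by (intro eq_matI) auto
    have e: "A * 1\<^sub>m 1 + (A * R) * 0\<^sub>m m 1 = A" "A * - R + (A * R) * 1\<^sub>m m = 0\<^sub>m 1 m"
      "0\<^sub>m m 1 * 1\<^sub>m 1 + F * 0\<^sub>m m 1 = 0\<^sub>m m 1" "0\<^sub>m m 1 * - R + F * 1\<^sub>m m = F"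
      using assms AR F zero_uminus by (simp_all add: uminus_l_inv_mat[of _ 1 m])
    show ?thesis
      by (subst mult_four_block_mat[of _ 1 1 _ m _ m _ _ 1 _ m]) (simp_all only: e assms AR F one_carrier_mat zero_carrier_mat uminus_carrier_mat)
  qed
  ultimately show ?thesis using unimodular_equivI[of ?U "Suc m" ?V ?N] by (simp add: F_def)
qed


lemma unimodular_inverse:
  assumes "(U :: int mat) \<in> carrier_mat n n" "det U dvd 1"
  obtains U' where "U' \<in> carrier_mat n n" "U * U' = 1\<^sub>m n" "U' * U = 1\<^sub>m n"
proof
  have dd: "det U * det U = 1" using assms(2) by (metis abs_mult_self_eq mult.right_neutral zdvd1_eq)
  note a = Determinant.adj_mat[OF assms(1)]
  show "det U \<cdot>\<^sub>m Determinant.adj_mat U \<in> carrier_mat n n" using a by simp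
  show "U * (det U \<cdot>\<^sub>m Determinant.adj_mat U) = 1\<^sub>m n" "det U \<cdot>\<^sub>m Determinant.adj_mat U * U = 1\<^sub>m n"
    using a assms dd
    by (simp_all add: mult_smult_distrib[of _ n n _ n] mult_smult_assoc_mat[of _ n n _ n], auto intro!: eq_matI)
qed

lemma unimodular_invertible:
  assumes "(U :: int mat) \<in> carrier_mat n n" "det U dvd 1" shows "invertible_mat U"
proof -
  obtain U' where "U' \<in> carrier_mat n n" "U * U' = 1\<^sub>m n" "U' * U = 1\<^sub>m n" by (rule unimodular_inverse[OF assms])
  then show ?thesis using assms unfolding invertible_mat_def inverts_mat_def by auto
qed

definition snf_diag :: "nat \<Rightarrow> int mat \<Rightarrow> bool" where
  "snf_diag n D \<longleftrightarrow> D \<in> carrier_mat n n \<and> (\<forall>i<n. \<forall>j<n. i \<noteq> j \<longrightarrow> D $$ (i,j) = 0) \<and>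
     (\<forall>i<n. D $$ (i,i) \<ge> 0) \<and> (\<forall>i. Suc i < n \<longrightarrow> D $$ (i,i) dvd D $$ (Suc i, Suc i))"

text \<open>The unit s allows the corner to change its sign, which makes the diagonal
  nonnegative.\<close>

lemma unimodular_equiv_four_block:
  assumes N: "N \<in> carrier_mat m m" and "unimodular_equiv m N D" and s: "s dvd (1 :: int)" and A: "A \<in> carrier_mat 1 1"
  shows "unimodular_equiv (Suc m) (four_block_mat A (0\<^sub>m 1 m) (0\<^sub>m m 1) N)
    (four_block_mat (s \<cdot>\<^sub>m A) (0\<^sub>m 1 m) (0\<^sub>m m 1) D)"
proof -
  obtain U V where C: "U \<in> carrier_mat m m" "V \<in> carrier_mat m m"
    and d: "det U dvd 1" "det V dvd 1" and e: "D = U * N * V"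
    using assms(2) unfolding unimodular_equiv_def by blast
  let ?U = "four_block_mat (s \<cdot>\<^sub>m 1\<^sub>m 1) (0\<^sub>m 1 m) (0\<^sub>m m 1) U" and ?V = "four_block_mat (1\<^sub>m 1) (0\<^sub>m 1 m) (0\<^sub>m m 1) V"
  let ?N = "four_block_mat A (0\<^sub>m 1 m) (0\<^sub>m m 1) N"
  have "det ?U = s * det U" "det ?V = det V"
    using C by (simp_all add: det_four_block_mat_upper_right_zero[of _ 1 _ m])
  moreover have "?U \<in> carrier_mat (Suc m) (Suc m)" "?V \<in> carrier_mat (Suc m) (Suc m)"
    using C four_block_carrier_mat[of "s \<cdot>\<^sub>m 1\<^sub>m 1" 1 1 U m m] four_block_carrier_mat[of "1\<^sub>m 1" 1 1 V m m] by simp_all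
  moreover have "?U * ?N * ?V = four_block_mat (s \<cdot>\<^sub>m A) (0\<^sub>m 1 m) (0\<^sub>m m 1) D"
  proof -
    have sA: "s \<cdot>\<^sub>m 1\<^sub>m 1 * A = s \<cdot>\<^sub>m A" using A by (subst mult_smult_assoc_mat[of _ 1 1 _ 1]) auto
    have "?U * ?N = four_block_mat (s \<cdot>\<^sub>m A) (0\<^sub>m 1 m) (0\<^sub>m m 1) (U * N)"
      using C N A sA by (subst mult_four_block_mat[of _ 1 1 _ m _ m _ _ 1 _ m]) auto
    also have "\<dots> * ?V = four_block_mat (s \<cdot>\<^sub>m A) (0\<^sub>m 1 m) (0\<^sub>m m 1) D"
      using C N A e by (subst mult_four_block_mat[of _ 1 1 _ m _ m _ _ 1 _ m]) auto
    finally show ?thesis .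
  qed
  ultimately show ?thesis using unimodular_equivI[of ?U "Suc m" ?V ?N] d s by (simp add: abs_mult)
qed

text \<open>Transfers the divisibility of the lower block by the corner to its diagonal form; this
  is the source of the divisor chain.\<close>

lemma dvd_unimodular_equiv:
  assumes "M \<in> carrier_mat n n" "\<And>i j. i < n \<Longrightarrow> j < n \<Longrightarrow> a dvd M $$ (i,j)" "unimodular_equiv n M N"
    "i < n" "j < n"
  shows "a dvd N $$ (i,j)"
proof -
  obtain U V where C: "U \<in> carrier_mat n n" "V \<in> carrier_mat n n" and e: "N = U * M * V"
    using assms(3) unfolding unimodular_equiv_def by blast
  have ix: "(A * B) $$ (i,k) = (\<Sum>l<n. A $$ (i,l) * B $$ (l,k))"
    if "A \<in> carrier_mat n n" "B \<in> carrier_mat n n" "k < n" for A B :: "int mat" and k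
    using that assms(4) by (simp add: scalar_prod_def atLeast0LessThan)
  have "a dvd (U * M) $$ (i,k)" if "k < n" for k
    unfolding ix[OF C(1) assms(1) that] using assms(2) that by (intro dvd_sum dvd_mult) auto
  moreover have "U * M \<in> carrier_mat n n" using C assms(1) by simp
  ultimately show ?thesis unfolding e ix[OF \<open>U * M \<in> _\<close> C(2) assms(5)] by (intro dvd_sum dvd_mult2) auto
qed

lemma unimodular_equiv_snf_diag:
  assumes "M \<in> carrier_mat n n"
  shows "\<exists>D. unimodular_equiv n M D \<and> snf_diag n D"
  using assms
proof (induction n arbitrary: M)
  case 0
  then show ?case using unimodular_equiv_left[of "1\<^sub>m 0" 0 M] by (auto simp: snf_diag_def)
next
  case (Suc m)
  let ?n = "Suc m"
  show ?case
  proof (cases "\<forall>i<?n. \<forall>j<?n. M $$ (i,j) = 0")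
    case True
    have "unimodular_equiv ?n M M" using unimodular_equiv_left[of "1\<^sub>m ?n" ?n M] Suc.prems by simp
    then show ?thesis using True Suc.prems by (intro exI[of _ M]) (auto simp: snf_diag_def)
  next
    case False
    then obtain N where MN: "unimodular_equiv ?n M N" and least: "least_entry ?n (N $$ (0,0)) N"
      using least_entry_exists[OF Suc.prems] by metis
    define a where "a = N $$ (0,0)"
    have NC: "N \<in> carrier_mat ?n ?n" using least by (simp add: least_entry_def)
    have a0: "a \<noteq> 0" using least by (simp add: least_entry_def a_def)
    define A where "A = mat 1 1 (\<lambda>_. a)"
    define R where "R = mat 1 m (\<lambda>(i,j). N $$ (0, Suc j) div a)"
    define C where "C = mat m 1 (\<lambda>(i,j). N $$ (Suc i, 0) div a)"
    define E where "E = mat m m (\<lambda>(i,j). N $$ (Suc i, Suc j))"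
    define F where "F = E - C * A * R"
    have F: "F \<in> carrier_mat m m" unfolding F_def
      by (rule minus_carrier_mat, rule mult_carrier_mat[of _ m 1], rule mult_carrier_mat[of _ m 1]) (simp_all add: C_def A_def R_def)
    have "N = four_block_mat A (A * R) (C * A) E"
    proof (rule eq_matI)
      fix i j assume "i < dim_row (four_block_mat A (A * R) (C * A) E)" "j < dim_col (four_block_mat A (A * R) (C * A) E)"
      then have ij: "i < ?n" "j < ?n" by (auto simp: A_def E_def)
      show "N $$ (i,j) = four_block_mat A (A * R) (C * A) E $$ (i,j)"
        using ij least_entry_dvd_col[OF least, of i] least_entry_dvd_row[OF least, of j]
        by (cases i; cases j) (auto simp: A_def R_def C_def E_def scalar_prod_def a_def)
    qed (use NC in \<open>auto simp: A_def E_def\<close>)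
    then have eq: "unimodular_equiv ?n N (four_block_mat A (0\<^sub>m 1 m) (0\<^sub>m m 1) F)" (is "unimodular_equiv _ _ ?K")
      using four_block_reduce[of R m C E A] by (simp add: A_def R_def C_def E_def F_def)
    have leastK: "least_entry ?n a ?K" using least_entry_equiv[OF least eq] by (simp add: a_def)
    have KC: "?K \<in> carrier_mat ?n ?n" using leastK by (simp add: least_entry_def)
    \<comment> \<open>Adding row \<open>Suc i\<close> to row 0 leaves the corner unchanged and
      brings row i of \<open>F\<close> into row 0, where the corner divides everything by
      minimality.\<close>
    have aF: "a dvd F $$ (i,j)" if ij: "i < m" "j < m" for i j
    proof -
      let ?L = "addrow_mat ?n 1 0 (Suc i) * ?K"
      have "unimodular_equiv ?n ?K ?L"
        using KC by (intro unimodular_equiv_left) (auto simp: det_addrow_mat)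
      then have leastL: "least_entry ?n a ?L" using least_entry_equiv[OF leastK] by blast
      have L: "?L = addrow 1 0 (Suc i) ?K" using KC ij by (subst addrow_mat[of _ ?n ?n]) auto
      have "?L $$ (0,0) = a" "?L $$ (0, Suc j) = F $$ (i,j)"
        using F ij unfolding L by (auto simp: A_def)
      then show ?thesis using least_entry_dvd_row[OF leastL, of "Suc j"] ij by simp
    qed
    obtain D where D: "unimodular_equiv m F D" "snf_diag m D" using Suc.IH[OF F] by blast
    \<comment> \<open>The factor \<open>sgn a\<close> turns the corner into the absolute value of
      a.\<close>
    define K' where "K' = four_block_mat (sgn a \<cdot>\<^sub>m A) (0\<^sub>m 1 m) (0\<^sub>m m 1) D"
    have "unimodular_equiv ?n ?K K'"
      unfolding K'_def using a0 by (intro unimodular_equiv_four_block F D) (auto simp: A_def sgn_if)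
    then have "unimodular_equiv ?n M K'"
      using unimodular_equiv_trans[OF NC eq] unimodular_equiv_trans[OF Suc.prems MN] by blast
    moreover have "snf_diag ?n K'"
    proof -
      have DC: "D \<in> carrier_mat m m" using D by (simp add: snf_diag_def)
      have aD: "a dvd D $$ (i,j)" if "i < m" "j < m" for i j
        using dvd_unimodular_equiv[OF F aF D(1)] that by blast
      have K: "K' $$ (i,j) = (if i = 0 \<and> j = 0 then \<bar>a\<bar> else if i = 0 \<or> j = 0 then 0 else D $$ (i - 1, j - 1))"
        if "i < ?n" "j < ?n" for i j
        using that DC by (auto simp: K'_def A_def abs_sgn mult.commute)
      have "K' \<in> carrier_mat ?n ?n" using DC by (auto simp: K'_def A_def)
      moreover have "K' $$ (i,i) dvd K' $$ (Suc i, Suc i)" if "Suc i < ?n" for i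
        using that K[of i i] K[of "Suc i" "Suc i"] aD[of 0 0] D(2) by (cases i) (auto simp: snf_diag_def)
      moreover have "K' $$ (i,j) = 0" if "i < ?n" "j < ?n" "i \<noteq> j" for i j
        using that K[of i j] D(2) by (cases i; cases j) (auto simp: snf_diag_def)
      moreover have "K' $$ (i,i) \<ge> 0" if "i < ?n" for i
        using that K[of i i] D(2) by (cases i) (auto simp: snf_diag_def)
      ultimately show ?thesis unfolding snf_diag_def by blast
    qed
    ultimately show ?thesis by blast
  qed
qed

lemma smith_normal_form_exists:
  assumes M: "M \<in> carrier_mat n n"
  shows "\<exists>D. smith_normal_form M D"
proof -
  obtain D where D: "unimodular_equiv n M D" "snf_diag n D" using unimodular_equiv_snf_diag[OF M] by blast
  then obtain U V where UV: "U \<in> carrier_mat n n" "invertible_mat U" "V \<in> carrier_mat n n" "invertible_mat V" "U * M * V = D"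
    using unimodular_invertible unfolding unimodular_equiv_def by metis
  have "dim_row M = n" "dim_col M = n" "dim_row D = n" "dim_col D = n" using M D(2) by (auto simp: snf_diag_def)
  then have "smith_normal_form M D"
    using D(2) UV unfolding smith_normal_form_def snf_diag_def diagonal_mat_def by auto
  then show ?thesis by blast
qed

lemma index_mult_mat_sum:
  "A \<in> carrier_mat nr n \<Longrightarrow> B \<in> carrier_mat n nc \<Longrightarrow> i < nr \<Longrightarrow> j < nc \<Longrightarrow>
   (A * B) $$ (i,j) = (\<Sum>k<n. A $$ (i,k) * B $$ (k,j))"
  by (simp add: scalar_prod_def atLeast0LessThan)

lemma invertible_mat_obtain:
  assumes "(U :: 'a :: semiring_1 mat) \<in> carrier_mat n n" "invertible_mat U"
  obtains U' where "U' \<in> carrier_mat n n" "U * U' = 1\<^sub>m n" "U' * U = 1\<^sub>m n"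
proof -
  obtain B where B: "U * B = 1\<^sub>m n" "B * U = 1\<^sub>m (dim_row B)"
    using assms unfolding invertible_mat_def inverts_mat_def by auto
  have "dim_col B = n" using arg_cong[OF B(1), of dim_col] by simp
  moreover have "dim_row B = n" using arg_cong[OF B(2), of dim_col] assms by simp
  ultimately show ?thesis using that[of B] B by auto
qed

text \<open>The second claim describes d independently of D, as the generator of those m for which m
  times the inverse of M is integral; this makes \<open>last_invariant_factor\<close> well defined.
  In the third claim c is the last column of V, which M maps to a multiple of d.\<close>

lemma smith_normal_form_last:
  assumes M: "M \<in> carrier_mat n n" and n: "n > 0" and det: "det M \<noteq> 0" and D: "smith_normal_form M D"
  defines "d \<equiv> D $$ (n - 1, n - 1)"
  shows "d > 0" "d dvd m \<longleftrightarrow> (\<exists>N\<in>carrier_mat n n. N * M = m \<cdot>\<^sub>m 1\<^sub>m n)"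
    "p dvd d \<Longrightarrow> \<not> p dvd 1 \<Longrightarrow> \<exists>c\<in>carrier_vec n. (\<exists>i<n. \<not> p dvd c $ i) \<and> (\<forall>i<n. p dvd (M *\<^sub>v c) $ i)"
proof -
  from M have dim: "dim_row M = n" "dim_col M = n" by auto
  have DC: "D \<in> carrier_mat n n" and off: "\<And>i j. i < n \<Longrightarrow> j < n \<Longrightarrow> i \<noteq> j \<Longrightarrow> D $$ (i,j) = 0"
    and nn: "\<And>i. i < n \<Longrightarrow> D $$ (i,i) \<ge> 0" and chain: "\<And>i. Suc i < n \<Longrightarrow> D $$ (i,i) dvd D $$ (Suc i, Suc i)"
    using D unfolding smith_normal_form_def dim diagonal_mat_def by auto
  obtain U V where U: "U \<in> carrier_mat n n" "invertible_mat U" and V: "V \<in> carrier_mat n n" "invertible_mat V"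
    and UMV: "U * M * V = D"
    using D unfolding smith_normal_form_def dim by blast
  obtain U' where U': "U' \<in> carrier_mat n n" "U * U' = 1\<^sub>m n" "U' * U = 1\<^sub>m n" by (rule invertible_mat_obtain[OF U])
  obtain V' where V': "V' \<in> carrier_mat n n" "V * V' = 1\<^sub>m n" "V' * V = 1\<^sub>m n" by (rule invertible_mat_obtain[OF V])
  have "det U * det U' = 1" "det V * det V' = 1"
    using U U' V V' det_mult[of U n U'] det_mult[of V n V'] by auto
  then have "det U \<noteq> 0" "det V \<noteq> 0" by auto
  moreover have "det D = det U * det M * det V" unfolding UMV[symmetric] using U V M by (simp add: det_mult)
  ultimately have "det D \<noteq> 0" using det by simp
  moreover have "det D = (\<Prod>i<n. D $$ (i,i))"
    using DC off by (subst det_upper_triangular[of _ n]) (auto simp: prod_list_diag_prod atLeast0LessThan)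
  ultimately have nz: "D $$ (i,i) \<noteq> 0" if "i < n" for i using that by (simp add: prod_zero_iff)
  have dd: "D $$ (i,i) dvd d" if "i < n" for i
  proof -
    have "D $$ (i,i) dvd D $$ (i + k, i + k)" if "i + k < n" for k
      using that
    proof (induction k)
      case (Suc k)
      then show ?case using chain[of "i + k"] by (auto intro: dvd_trans)
    qed simp
    from this[of "n - 1 - i"] show ?thesis using that by (simp add: d_def)
  qed
  show "d > 0" using nz[of "n - 1"] nn[of "n - 1"] n by (simp add: d_def)
  have MV: "M * V = U' * D"
  proof -
    have "U' * D = U' * (U * (M * V))" using UMV U M V by (simp add: assoc_mult_mat[of _ n n _ n _ n])
    also have "\<dots> = (U' * U) * (M * V)" using U U' M V by (intro assoc_mult_mat[of _ n n _ n _ n, symmetric]) auto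
    finally show ?thesis using U' M V by simp
  qed
  show "d dvd m \<longleftrightarrow> (\<exists>N\<in>carrier_mat n n. N * M = m \<cdot>\<^sub>m 1\<^sub>m n)"
  proof
    assume "d dvd m"
    \<comment> \<open>m times the inverse of D, so that \<open>V * E * U\<close> is m times the
      inverse of M.\<close>
    define E where "E = mat n n (\<lambda>(i,j). if i = j then m div D $$ (i,i) else 0)"
    have E: "E \<in> carrier_mat n n" by (simp add: E_def)
    have ED: "E * D = m \<cdot>\<^sub>m 1\<^sub>m n"
    proof (rule eq_matI)
      fix i j assume "i < dim_row (m \<cdot>\<^sub>m 1\<^sub>m n)" "j < dim_col (m \<cdot>\<^sub>m 1\<^sub>m n)"
      then have ij: "i < n" "j < n" by auto
      have "(E * D) $$ (i,j) = (\<Sum>k<n. (if i = k then m div D $$ (i,i) else 0) * D $$ (k,j))"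
        using ij DC by (simp add: E_def scalar_prod_def atLeast0LessThan)
      also have "\<dots> = m div D $$ (i,i) * D $$ (i,j)"
        using ij by (simp add: if_distrib[of "\<lambda>x. x * _"] cong: if_cong)
      finally show "(E * D) $$ (i,j) = (m \<cdot>\<^sub>m 1\<^sub>m n) $$ (i,j)"
        using ij off[of i j] dvd_trans[OF dd[of i] \<open>d dvd m\<close>] by auto
    qed (use DC in \<open>auto simp: E_def\<close>)
    have "V * E * U * M = V * E * (U * M * V) * V'"
      using U V V' E M by (simp add: assoc_mult_mat[of _ n n _ n _ n])
    also have "\<dots> = V * (E * D) * V'"
      using U V V' E DC by (simp add: UMV assoc_mult_mat[of _ n n _ n _ n])
    also have "\<dots> = m \<cdot>\<^sub>m 1\<^sub>m n"
      using V V' by (simp add: ED mult_smult_distrib[of _ n n _ n] mult_smult_assoc_mat[of _ n n _ n])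
    finally show "\<exists>N\<in>carrier_mat n n. N * M = m \<cdot>\<^sub>m 1\<^sub>m n" using U V E by (intro bexI[of _ "V * E * U"]) auto
  next
    assume "\<exists>N\<in>carrier_mat n n. N * M = m \<cdot>\<^sub>m 1\<^sub>m n"
    then obtain N where N: "N \<in> carrier_mat n n" "N * M = m \<cdot>\<^sub>m 1\<^sub>m n" by blast
    define K where "K = V' * N * U'"
    have K: "K \<in> carrier_mat n n" using V' N U' by (simp add: K_def)
    have "K * D = V' * (N * (M * V))" using V' N U' DC by (simp add: K_def MV assoc_mult_mat[of _ n n _ n _ n])
    also have "\<dots> = V' * (m \<cdot>\<^sub>m 1\<^sub>m n * V)"
      by (simp only: assoc_mult_mat[OF N(1) M V(1), symmetric] N(2))
    also have "\<dots> = m \<cdot>\<^sub>m 1\<^sub>m n"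
      using V V' by (simp add: mult_smult_distrib[of _ n n _ n] mult_smult_assoc_mat[of _ n n _ n])
    finally have "(K * D) $$ (n - 1, n - 1) = m" using n by simp
    moreover have "(K * D) $$ (n - 1, n - 1) = (\<Sum>k<n. K $$ (n - 1, k) * D $$ (k, n - 1))"
      using n K DC by (simp add: scalar_prod_def atLeast0LessThan)
    moreover have "d dvd K $$ (n - 1, k) * D $$ (k, n - 1)" if "k < n" for k
      using off[of k "n - 1"] that n by (cases "k = n - 1") (auto simp: d_def)
    ultimately show "d dvd m" by (metis (no_types, lifting) dvd_sum lessThan_iff)
  qed
  show "\<exists>c\<in>carrier_vec n. (\<exists>i<n. \<not> p dvd c $ i) \<and> (\<forall>i<n. p dvd (M *\<^sub>v c) $ i)" if p: "p dvd d" "\<not> p dvd 1"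
  proof (intro bexI conjI allI impI)
    let ?c = "col V (n - 1)"
    show "?c \<in> carrier_vec n" using V by auto
    fix i assume i: "i < n"
    have "(M *\<^sub>v ?c) $ i = (M * V) $$ (i, n - 1)" using M V i n by simp
    also have "\<dots> = (\<Sum>k<n. U' $$ (i,k) * D $$ (k, n - 1))"
      unfolding MV using i n U' DC by (simp add: scalar_prod_def atLeast0LessThan)
    finally have eq: "(M *\<^sub>v ?c) $ i = (\<Sum>k<n. U' $$ (i,k) * D $$ (k, n - 1))" .
    have "p dvd U' $$ (i,k) * D $$ (k, n - 1)" if "k < n" for k
      using off[of k "n - 1"] that n p by (cases "k = n - 1") (auto simp: d_def)
    then show "p dvd (M *\<^sub>v ?c) $ i" unfolding eq by (intro dvd_sum) auto
  next
    \<comment> \<open>A column of an invertible matrix cannot vanish modulo a non-unit.\<close>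
    show "\<exists>i<n. \<not> p dvd col V (n - 1) $ i"
    proof (rule ccontr)
      assume "\<not> ?thesis"
      then have all: "p dvd V $$ (i, n - 1)" if "i < n" for i using that n V by simp
      have "(V' * V) $$ (n - 1, n - 1) = (\<Sum>k<n. V' $$ (n - 1, k) * V $$ (k, n - 1))"
        using n V V'(1) by (intro index_mult_mat_sum) auto
      then have "p dvd (V' * V) $$ (n - 1, n - 1)" using all by (auto intro: dvd_sum)
      then show False using n p V' by simp
    qed
  qed
qed

lemma last_invariant_factor_props:
  assumes M: "M \<in> carrier_mat n n" and n: "n > 0" and det: "det M \<noteq> 0"
  shows "last_invariant_factor M > 0" "\<exists>N\<in>carrier_mat n n. N * M = last_invariant_factor M \<cdot>\<^sub>m 1\<^sub>m n"
    "p dvd last_invariant_factor M \<Longrightarrow> \<not> p dvd 1 \<Longrightarrow>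
      \<exists>c\<in>carrier_vec n. (\<exists>i<n. \<not> p dvd c $ i) \<and> (\<forall>i<n. p dvd (M *\<^sub>v c) $ i)"
proof -
  from M have dim: "dim_row M = n" "dim_col M = n" by auto
  obtain D where D: "smith_normal_form M D" using smith_normal_form_exists[OF M] by blast
  have "last_invariant_factor M = D $$ (n - 1, n - 1)"
    unfolding last_invariant_factor_def dim Let_def min.idem
  proof (rule the_equality)
    show "\<exists>D'. smith_normal_form M D' \<and> D $$ (n - 1, n - 1) = D' $$ (n - 1, n - 1)" using D by blast
    fix d assume "\<exists>D'. smith_normal_form M D' \<and> d = D' $$ (n - 1, n - 1)"
    then obtain D' where D': "smith_normal_form M D'" "d = D' $$ (n - 1, n - 1)" by blast
    note l = smith_normal_form_last[OF M n det D] and l' = smith_normal_form_last[OF M n det D'(1)]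
    have "d dvd D $$ (n - 1, n - 1)" "D $$ (n - 1, n - 1) dvd d"
      unfolding D'(2) l'(2) l(2) using iffD1[OF l(2) dvd_refl] iffD1[OF l'(2) dvd_refl] by blast+
    moreover have "d > 0" "D $$ (n - 1, n - 1) > 0" using l(1) l'(1) D'(2) by auto
    ultimately show "d = D $$ (n - 1, n - 1)" by (simp add: zdvd_antisym_nonneg)
  qed
  note eq = this and last = smith_normal_form_last[OF M n det D]
  show "last_invariant_factor M > 0" unfolding eq by (rule last(1))
  show "\<exists>N\<in>carrier_mat n n. N * M = last_invariant_factor M \<cdot>\<^sub>m 1\<^sub>m n"
    unfolding eq by (rule iffD1[OF last(2) dvd_refl])
  show "\<exists>c\<in>carrier_vec n. (\<exists>i<n. \<not> p dvd c $ i) \<and> (\<forall>i<n. p dvd (M *\<^sub>v c) $ i)"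
    if "p dvd last_invariant_factor M" "\<not> p dvd 1"
    using last(3)[of p] that unfolding eq by blast
qed

section \<open>The resultant with the characteristic polynomial\<close>

lemma poly_mat_carrier [simp]: "A \<in> carrier_mat n n \<Longrightarrow> poly_mat f A \<in> carrier_mat n n"
  by (simp add: poly_mat_def)

lemma poly_mat_mult_vec:
  assumes A: "A \<in> carrier_mat n n" and x: "x \<in> carrier_vec n" and r: "r < n"
  shows "(poly_mat f A *\<^sub>v x) $ r = (\<Sum>k\<le>degree f. coeff f k * ((A ^\<^sub>m k) *\<^sub>v x) $ r)"
proof -
  have "(poly_mat f A *\<^sub>v x) $ r = (\<Sum>c<n. \<Sum>k\<le>degree f. coeff f k * (A ^\<^sub>m k) $$ (r,c) * x $ c)"
    using A x r by (simp add: poly_mat_def scalar_prod_def atLeast0LessThan sum_distrib_right)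
  also have "\<dots> = (\<Sum>k\<le>degree f. coeff f k * ((A ^\<^sub>m k) *\<^sub>v x) $ r)"
    using x r carrier_matD[OF pow_carrier_mat[OF A]]
    by (subst sum.swap) (simp add: scalar_prod_def atLeast0LessThan sum_distrib_left mult.assoc)
  finally show ?thesis .
qed

text \<open>Multiplying the Sylvester matrix by the matrix with rows \<open>A\<^sup>i e\<close> evaluates each of its rows, read as
  a polynomial, at \<open>A\<close> and applies the result to \<open>e\<close>; the rows coming from \<open>\<chi>\<close> vanish.\<close>
lemma resultant_char_poly:
  fixes A :: "int mat"
  assumes A: "A \<in> carrier_mat n n" and e: "e \<in> carrier_vec n"
    and det: "det (mat_of_cols n (map (\<lambda>j. (A ^\<^sub>m j) *\<^sub>v e) [0..<n])) \<noteq> 0"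
  shows "resultant (char_poly A) f = det (poly_mat f A)"
proof -
  let ?\<chi> = "char_poly A" and ?m = "degree f"
  let ?S = "sylvester_mat ?\<chi> f"
  have dn: "degree ?\<chi> = n" and monic: "coeff ?\<chi> n = 1" using degree_monic_char_poly[OF A] by auto
  define k where "k j r = ((A ^\<^sub>m j) *\<^sub>v e) $ r" for j r
  \<comment> \<open>The columns of the Sylvester matrix run through descending degrees, hence the
    exponent \<open>n + ?m - 1 - j\<close>. The matrix \<open>T\<close> completes these Krylov rows
    to a square matrix by unit columns, and the product with \<open>T\<close> becomes block
    triangular.\<close>
  define Kt where "Kt = mat ?m n (\<lambda>(j,r). k (n + ?m - 1 - j) r)"
  define Kb where "Kb = mat n n (\<lambda>(j,r). k (n - 1 - j) r)"
  define T where "T = four_block_mat (1\<^sub>m ?m) Kt (0\<^sub>m n ?m) Kb"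
  define S1 where "S1 = mat ?m ?m (($$) ?S)"
  define S2 where "S2 = mat n ?m (\<lambda>(i,j). ?S $$ (?m + i, j))"
  have Kc: "Kt \<in> carrier_mat ?m n" "Kb \<in> carrier_mat n n" by (simp_all add: Kt_def Kb_def)
  have TC: "T \<in> carrier_mat (n + ?m) (n + ?m)" using Kc by (simp add: T_def add.commute[of n])
  have SC: "?S \<in> carrier_mat (n + ?m) (n + ?m)" using sylvester_carrier_mat[of ?\<chi> f] dn by simp
  have S: "?S $$ (i,j) = (if i < ?m then if i \<le> j \<and> j - i \<le> n then coeff ?\<chi> (n + i - j) else 0
     else if i - ?m \<le> j \<and> j \<le> i then coeff f (i - j) else 0)" if "i < n + ?m" "j < n + ?m" for i j
    using sylvester_index_mat[of i ?\<chi> f j] that dn by simp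
  have T: "T $$ (j,c) = (if c < ?m then if j = c then 1 else 0 else k (n + ?m - 1 - j) (c - ?m))"
    if "j < n + ?m" "c < n + ?m" for j c
    using that Kc by (auto simp: T_def Kt_def Kb_def)
  have top: "(\<Sum>j<n + ?m. ?S $$ (i,j) * k (n + ?m - 1 - j) r) = 0" if i: "i < ?m" and r: "r < n" for i r
  proof -
    have "(\<Sum>j<n + ?m. ?S $$ (i,j) * k (n + ?m - 1 - j) r) = (\<Sum>j\<in>{i..i + n}. coeff ?\<chi> (n + i - j) * k (n + ?m - 1 - j) r)"
      using i by (intro sum.mono_neutral_cong_right) (auto simp: S)
    also have "\<dots> = (\<Sum>t\<le>n. coeff ?\<chi> t * k (t + (?m - 1 - i)) r)"
      using i by (intro sum.reindex_bij_witness[of _ "\<lambda>t. n + i - t" "\<lambda>j. n + i - j"]) (auto intro!: arg_cong2[of _ _ _ _ k])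
    also have "\<dots> = 0" unfolding k_def using cayley_hamilton_vec[OF A e r] .
    finally show ?thesis .
  qed
  have bot: "(\<Sum>j<n + ?m. ?S $$ (?m + i,j) * k (n + ?m - 1 - j) r) = (\<Sum>t\<le>?m. coeff f t * k (t + (n - 1 - i)) r)"
    if i: "i < n" for i r
  proof -
    have "(\<Sum>j<n + ?m. ?S $$ (?m + i,j) * k (n + ?m - 1 - j) r) = (\<Sum>j\<in>{i..?m + i}. coeff f (?m + i - j) * k (n + ?m - 1 - j) r)"
      using i by (intro sum.mono_neutral_cong_right) (auto simp: S)
    also have "\<dots> = (\<Sum>t\<le>?m. coeff f t * k (t + (n - 1 - i)) r)"
      using i by (intro sum.reindex_bij_witness[of _ "\<lambda>t. ?m + i - t" "\<lambda>j. ?m + i - j"]) (auto intro!: arg_cong2[of _ _ _ _ k])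
    finally show ?thesis .
  qed
  have R: "(Kb * transpose_mat (poly_mat f A)) $$ (i,r) = (\<Sum>t\<le>?m. coeff f t * k (t + (n - 1 - i)) r)"
    if i: "i < n" and r: "r < n" for i r
  proof -
    let ?v = "(A ^\<^sub>m (n - 1 - i)) *\<^sub>v e"
    have v: "?v \<in> carrier_vec n" using A e by (simp add: mult_mat_vec_carrier[of _ n n])
    have "(Kb * transpose_mat (poly_mat f A)) $$ (i,r) = (\<Sum>c<n. Kb $$ (i,c) * transpose_mat (poly_mat f A) $$ (c,r))"
      using i r A Kc by (intro index_mult_mat_sum) auto
    also have "\<dots> = (poly_mat f A *\<^sub>v ?v) $ r"
      using i r A Kc v carrier_matD[OF poly_mat_carrier[OF A, of f]]
      by (simp add: Kb_def k_def scalar_prod_def atLeast0LessThan mult.commute del: index_mult_mat_vec)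
         (simp add: scalar_prod_def atLeast0LessThan)
    also have "\<dots> = (\<Sum>t\<le>?m. coeff f t * k (t + (n - 1 - i)) r)"
      unfolding poly_mat_mult_vec[OF A v r] k_def pow_mat_mult_vec_add[OF A e] ..
    finally show ?thesis .
  qed
  have ST: "?S * T = four_block_mat S1 (0\<^sub>m ?m n) S2 (Kb * transpose_mat (poly_mat f A))"
  proof (rule eq_matI)
    fix i c assume "i < dim_row (four_block_mat S1 (0\<^sub>m ?m n) S2 (Kb * transpose_mat (poly_mat f A)))"
      "c < dim_col (four_block_mat S1 (0\<^sub>m ?m n) S2 (Kb * transpose_mat (poly_mat f A)))"
    then have ic: "i < n + ?m" "c < n + ?m" using A by (auto simp: S1_def Kb_def poly_mat_def)
    have "(?S * T) $$ (i,c) = (\<Sum>j<n + ?m. ?S $$ (i,j) * T $$ (j,c))"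
      using SC TC ic by (intro index_mult_mat_sum) auto
    also have "\<dots> = (if c < ?m then ?S $$ (i,c) else (\<Sum>j<n + ?m. ?S $$ (i,j) * k (n + ?m - 1 - j) (c - ?m)))"
      using ic by (simp add: T if_distrib[of "\<lambda>x. _ * x"] cong: if_cong)
    also have "\<dots> = four_block_mat S1 (0\<^sub>m ?m n) S2 (Kb * transpose_mat (poly_mat f A)) $$ (i,c)"
      using ic top[of i "c - ?m"] bot[of "i - ?m" "c - ?m"] R[of "i - ?m" "c - ?m"] A Kc
        carrier_matD[OF poly_mat_carrier[OF A, of f]]
      by (auto simp: S1_def S2_def simp del: index_mult_mat(1))
    finally show "(?S * T) $$ (i,c) = four_block_mat S1 (0\<^sub>m ?m n) S2 (Kb * transpose_mat (poly_mat f A)) $$ (i,c)" .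
  qed (use A SC TC in \<open>auto simp: S1_def Kb_def poly_mat_def\<close>)
  have "det S1 = 1"
    by (subst det_upper_triangular[of _ ?m]) (auto simp: S1_def S prod_list_diag_prod monic)
  moreover have "det (Kb * transpose_mat (poly_mat f A)) = det Kb * det (poly_mat f A)"
    using Kc A by (simp add: det_mult[of _ n] det_transpose[of _ n])
  moreover have "det (?S * T) = det S1 * det (Kb * transpose_mat (poly_mat f A))"
    unfolding ST using Kc A by (intro det_four_block_mat_upper_right_zero[of _ ?m _ n]) (auto simp: S1_def S2_def)
  moreover have "det T = det Kb"
    unfolding T_def using Kc by (subst det_four_block_mat_lower_left_zero[of _ ?m _ n]) auto
  ultimately have "det ?S * det Kb = det Kb * det (poly_mat f A)" using det_mult[OF SC TC] by simp
  \<comment> \<open>\<open>Kb\<close> is the transposed Krylov matrix with its rows in reverse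
    order, so the two have the same kernel.\<close>
  moreover have "det Kb \<noteq> 0"
  proof
    let ?W = "mat_of_cols n (map (\<lambda>j. (A ^\<^sub>m j) *\<^sub>v e) [0..<n])"
    have W: "?W \<in> carrier_mat n n" by (simp add: mat_of_cols_def)
    assume "det Kb = 0"
    then obtain v where v: "v \<in> carrier_vec n" "v \<noteq> 0\<^sub>v n" "Kb *\<^sub>v v = 0\<^sub>v n"
      using det_0_iff_vec_prod_zero[OF Kc(2)] by blast
    have "transpose_mat ?W *\<^sub>v v = 0\<^sub>v n"
    proof (rule eq_vecI)
      fix j assume "j < dim_vec (0\<^sub>v n :: int vec)"
      then have j: "j < n" by simp
      have "(Kb *\<^sub>v v) $ (n - 1 - j) = (\<Sum>r<n. k j r * v $ r)"
        using j v(1) by (simp add: Kb_def scalar_prod_def atLeast0LessThan)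
      then have "(\<Sum>r<n. k j r * v $ r) = 0" unfolding v(3) using j by simp
      then show "(transpose_mat ?W *\<^sub>v v) $ j = 0\<^sub>v n $ j"
        using j v(1) by (simp add: scalar_prod_def atLeast0LessThan mat_of_cols_def k_def)
    qed (simp add: mat_of_cols_def)
    then have "det (transpose_mat ?W) = 0" using W v det_0_iff_vec_prod_zero[of "transpose_mat ?W" n] by auto
    then show False using det W by (simp add: det_transpose)
  qed
  ultimately show ?thesis by (simp add: resultant_def)
qed

section \<open>Square factors of the discriminant\<close>

lemma det_replace_col:
  assumes q: "(q :: 'a :: comm_ring_1 vec) \<in> carrier_vec n" and i: "i < n"
  shows "det (mat n n (\<lambda>(r,c). if c = i then q $ r else if r = c then 1 else 0)) = q $ i"
proof -
  let ?T = "mat n n (\<lambda>(r,c). if c = i then q $ r else if r = c then 1 else 0)"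
  have T: "?T \<in> carrier_mat n n" by simp
  have "det ?T = (\<Sum>c<n. ?T $$ (i,c) * cofactor ?T i c)" using laplace_expansion_row[OF T i] .
  also have "\<dots> = (\<Sum>c<n. if c = i then q $ i * cofactor ?T i i else 0)"
    using i by (intro sum.cong) auto
  also have "\<dots> = q $ i * cofactor ?T i i" using i by simp
  also have "mat_delete ?T i i = 1\<^sub>m (n - 1)"
    by (intro eq_matI) (auto simp: mat_delete_def)
  then have "cofactor ?T i i = 1" by (simp add: cofactor_def)
  finally show ?thesis by simp
qed

text \<open>Replacing the \<open>i\<close>-th basis vector by \<open>q\<close> gives a Gram matrix whose \<open>i\<close>-th row and column are
  divisible by \<open>p\<close> and whose \<open>i\<close>-th diagonal entry is divisible by \<open>p\<^sup>2\<close>.\<close>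
lemma det_dvd_square:
  fixes N :: "int mat"
  assumes N: "N \<in> carrier_mat n n" and sym: "transpose_mat N = N" and q: "q \<in> carrier_vec n"
    and i: "i < n" and p: "prime p" and qi: "\<not> p dvd q $ i"
    and Nq: "\<And>r. r < n \<Longrightarrow> p dvd (N *\<^sub>v q) $ r" and qNq: "p\<^sup>2 dvd q \<bullet> (N *\<^sub>v q)"
  shows "p\<^sup>2 dvd det N"
proof -
  define T where "T = mat n n (\<lambda>(r,c). if c = i then q $ r else if r = c then 1 else 0)"
  have T: "T \<in> carrier_mat n n" by (simp add: T_def)
  define K where "K = transpose_mat T * (N * T)"
  have NT: "N * T \<in> carrier_mat n n" and K: "K \<in> carrier_mat n n" using N T by (auto simp: K_def)
  have colT: "col T c = (if c = i then q else unit_vec n c)" if "c < n" for c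
    using that q by (intro eq_vecI) (auto simp: T_def)
  have NTc: "(N * T) $$ (r,c) = (if c = i then (N *\<^sub>v q) $ r else N $$ (r,c))" if "r < n" "c < n" for r c
    using that N T q colT[of c] by auto
  have Kix: "K $$ (r,c) = col T r \<bullet> col (N * T) c" if "r < n" "c < n" for r c
    unfolding K_def using that T NT by (subst index_mult_mat(1)) auto
  have Kr: "K $$ (r,i) = (if r = i then q \<bullet> (N *\<^sub>v q) else (N *\<^sub>v q) $ r)" if "r < n" for r
  proof -
    have "col (N * T) i = N *\<^sub>v q" using NTc i N T NT q by (intro eq_vecI) auto
    then show ?thesis using that i N q by (simp add: Kix colT)
  qed
  have Ksym: "transpose_mat K = K"
    unfolding K_def using N T sym by (simp add: transpose_mult[of _ n n _ n] assoc_mult_mat[of _ n n _ n _ n])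
  have Kc: "K $$ (i,c) = (if c = i then q \<bullet> (N *\<^sub>v q) else (N *\<^sub>v q) $ c)" if "c < n" for c
    using Kr[OF that] arg_cong[OF Ksym, of "\<lambda>M. M $$ (i,c)"] K i that by simp
  \<comment> \<open>\<open>?E\<close> extracts p from the i-th row and from the i-th column; the two
    extractions meet at the diagonal entry, which therefore has to be divisible by the square of
    p.\<close>
  let ?E = "mat_diag n (\<lambda>r. if r = i then p else 1)"
  define Y where "Y = mat n n (\<lambda>(r,c). K $$ (r,c) div ((if r = i then p else 1) * (if c = i then p else 1)))"
  have Y: "Y \<in> carrier_mat n n" by (simp add: Y_def)
  have "K = ?E * Y * ?E"
  proof (rule eq_matI)
    fix r c assume "r < dim_row (?E * Y * ?E)" "c < dim_col (?E * Y * ?E)"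
    then have rc: "r < n" "c < n" by (auto simp: mat_diag_def)
    have "(?E * Y * ?E) $$ (r,c) = (if r = i then p else 1) * Y $$ (r,c) * (if c = i then p else 1)"
      using rc Y by (simp add: mat_diag_mult_left[of _ _ n] mat_diag_mult_right[of _ n])
    also have "\<dots> = K $$ (r,c)"
      using rc Kr[OF rc(1)] Kc[OF rc(2)] Nq[OF rc(1)] Nq[OF rc(2)] qNq
      by (auto simp: Y_def power2_eq_square mult_ac)
    finally show "K $$ (r,c) = (?E * Y * ?E) $$ (r,c)" by simp
  qed (use K in \<open>auto simp: mat_diag_def\<close>)
  moreover have "det ?E = p"
    using i by (subst det_upper_triangular[of _ n]) (auto simp: mat_diag_def prod_list_diag_prod prod.delta)
  ultimately have "det K = p\<^sup>2 * det Y"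
    using det_mult[OF mult_carrier_mat[OF mat_diag_dim Y] mat_diag_dim] det_mult[OF mat_diag_dim Y]
    by (simp add: power2_eq_square)
  moreover have "det K = (q $ i)\<^sup>2 * det N"
    unfolding K_def using N T NT det_replace_col[OF q i]
    by (simp add: det_mult[of _ n] det_transpose[of _ n] T_def[symmetric] power2_eq_square)
  ultimately have "p\<^sup>2 dvd (q $ i)\<^sup>2 * det N" by simp
  moreover have "gcd (p\<^sup>2) ((q $ i)\<^sup>2) = 1"
    using p qi by (metis prime_imp_coprime coprime_power_left_iff coprime_power_right_iff coprime_iff_gcd_eq_1)
  ultimately show ?thesis by (metis coprime_dvd_mult_right_iff coprime_iff_gcd_eq_1)
qed

lemma num_poly_dvd:
  assumes "\<And>k. (p :: int) dvd m k" shows "[:p:] dvd num_poly \<chi> m"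
  unfolding const_poly_dvd_iff coeff_num_poly using assms by (auto intro!: dvd_sum)

lemma sym_mat_scalar_prod:
  assumes "(A :: 'a :: comm_ring_1 mat) \<in> carrier_mat n n" "transpose_mat A = A" "x \<in> carrier_vec n" "y \<in> carrier_vec n"
  shows "y \<bullet> (A *\<^sub>v x) = x \<bullet> (A *\<^sub>v y)"
  using transpose_vec_mult_scalar[of A n n x y] assms
  by (metis comm_scalar_prod mult_mat_vec_carrier)

lemma mom_sym:
  assumes A: "(A :: 'a :: comm_ring_1 mat) \<in> carrier_mat n n" and "transpose_mat A = A" "x \<in> carrier_vec n" "y \<in> carrier_vec n"
  shows "mom A y x = mom A x y"
  unfolding mom_def
  using sym_mat_scalar_prod[OF pow_carrier_mat[OF A]] assms transpose_pow_mat[OF A] by metis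

text \<open>The sum \<open>y\<^sup>T f(A) x\<close> is the coefficient of \<open>t\<^sup>n\<^sup>-\<^sup>1\<close> in the remainder of \<open>f \<cdot> num_poly\<close> modulo \<open>\<chi>\<close>.\<close>
lemma dvdm_num_poly_imp_dvd:
  fixes A :: "int mat"
  assumes A: "A \<in> carrier_mat n n" and x: "x \<in> carrier_vec n" and y: "y \<in> carrier_vec n"
    and n: "n > 0" and p: "prime p"
    and d: "poly_mod.dvdm p (char_poly A) (f * num_poly (char_poly A) (mom A y x))"
  shows "p dvd (\<Sum>j\<le>degree f. coeff f j * mom A y x j)"
proof -
  let ?\<chi> = "char_poly A" and ?m = "mom A y x"
  have \<chi>: "degree ?\<chi> = n" "monic ?\<chi>" using degree_monic_char_poly[OF A] by auto
  define m' where "m' = (\<lambda>k. \<Sum>j\<le>degree f. coeff f j * ?m (j + k))"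
  obtain g where g: "f * num_poly ?\<chi> ?m = ?\<chi> * g + num_poly ?\<chi> m'"
    using num_poly_mult[OF mom_recurrence[OF A x y]] unfolding m'_def by blast
  have "poly_mod.dvdm p ?\<chi> (f * num_poly ?\<chi> ?m + ?\<chi> * (- g))"
    using d by (intro dvdm_add dvdm_mult[of p ?\<chi> ?\<chi> "- g"] dvdm_refl)
  then have "poly_mod.dvdm p ?\<chi> (num_poly ?\<chi> m')" by (simp add: g)
  then have "[:p:] dvd num_poly ?\<chi> m'"
    using monic_dvdm_degree_less[OF p \<chi>(2)] degree_num_poly[of ?\<chi> m'] \<chi>(1) n by auto
  then have "p dvd coeff (num_poly ?\<chi> m') (n - 1)" by (simp add: const_poly_dvd_iff)
  then show ?thesis using \<chi> n by (simp add: coeff_num_poly m'_def)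
qed

text \<open>Tested against a unit vector, the square of the numerator \<open>?v\<close> is congruent
  modulo \<chi> to a multiple of the numerator for q and q, which vanishes modulo p by isotropy.
  Then \<open>dvdm_square_pderiv\<close> applies to \<open>?v\<close>.\<close>

lemma pderiv_char_poly_isotropic:
  fixes A :: "int mat"
  assumes A: "A \<in> carrier_mat n n" and sym: "transpose_mat A = A" and q: "q \<in> carrier_vec n"
    and p: "prime p" and iso: "\<And>k. p dvd mom A q q k" and r: "r < n"
  shows "p dvd (poly_mat (pderiv (char_poly A)) A *\<^sub>v q) $ r"
proof -
  let ?\<chi> = "char_poly A" and ?e = "unit_vec n r :: int vec"
  let ?v = "num_poly ?\<chi> (mom A ?e q)"
  have \<chi>: "degree ?\<chi> = n" "monic ?\<chi>" using degree_monic_char_poly[OF A] by auto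
  have "?\<chi> dvd num_poly ?\<chi> (mom A ?e ?e) * num_poly ?\<chi> (mom A q q) - ?v * num_poly ?\<chi> (mom A q ?e)"
    using q by (intro char_poly_dvd_num_poly_minor[OF A]) auto
  also have "mom A q ?e = mom A ?e q" using mom_sym[OF A sym] q by simp
  finally have "poly_mod.dvdm p ?\<chi> (num_poly ?\<chi> (mom A ?e ?e) * num_poly ?\<chi> (mom A q q) - ?v * ?v)"
    by (rule dvdm_of_dvd)
  then have "poly_mod.dvdm p ?\<chi> ((num_poly ?\<chi> (mom A ?e ?e) * num_poly ?\<chi> (mom A q q) - ?v * ?v) * (- 1)
      + num_poly ?\<chi> (mom A ?e ?e) * num_poly ?\<chi> (mom A q q))"
    using iso by (intro dvdm_add dvdm_mult[of _ _ _ "- 1"] dvdm_const_dvd[of _ "_ * num_poly _ _"] dvd_mult num_poly_dvd)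
  then have "poly_mod.dvdm p ?\<chi> (?v * ?v)" by simp
  then have "poly_mod.dvdm p ?\<chi> (pderiv ?\<chi> * ?v)" by (rule dvdm_square_pderiv[OF p \<chi>(2)])
  then have "p dvd (\<Sum>j\<le>degree (pderiv ?\<chi>). coeff (pderiv ?\<chi>) j * mom A ?e q j)"
    using r q by (intro dvdm_num_poly_imp_dvd[OF A _ _ _ p]) auto
  moreover have "mom A ?e q j = ((A ^\<^sub>m j) *\<^sub>v q) $ r" for j
    unfolding mom_def using A q r by (intro scalar_prod_left_unit) (auto simp: mult_mat_vec_carrier[of _ n n])
  ultimately show ?thesis by (simp add: poly_mat_mult_vec[OF A q r])
qed

lemma transpose_poly_mat:
  assumes A: "A \<in> carrier_mat n n" and sym: "transpose_mat A = A"
  shows "transpose_mat (poly_mat f A) = poly_mat f A"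
proof (rule eq_matI)
  fix i j assume "i < dim_row (poly_mat f A)" "j < dim_col (poly_mat f A)"
  then have ij: "i < n" "j < n" using A by (auto simp: poly_mat_def)
  have "(A ^\<^sub>m k) $$ (j,i) = (A ^\<^sub>m k) $$ (i,j)" for k
    using arg_cong[OF transpose_pow_mat[OF A, of k], of "\<lambda>M. M $$ (i,j)"] sym ij carrier_matD[OF pow_carrier_mat[OF A, of k]] by simp
  then show "transpose_mat (poly_mat f A) $$ (i,j) = poly_mat f A $$ (i,j)"
    using ij A by (simp add: poly_mat_def)
qed (use A in \<open>auto simp: poly_mat_def\<close>)

lemma prime_square_dvd_resultant:
  fixes A :: "int mat"
  assumes A: "A \<in> carrier_mat n n" and sym: "transpose_mat A = A" and e: "e \<in> carrier_vec n"
    and det: "det (mat_of_cols n (map (\<lambda>j. (A ^\<^sub>m j) *\<^sub>v e) [0..<n])) \<noteq> 0"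
    and q: "q \<in> carrier_vec n" and p: "prime p" and iso: "\<And>k. p\<^sup>2 dvd mom A q q k"
    and i: "i < n" "\<not> p dvd q $ i"
  shows "p\<^sup>2 dvd resultant (char_poly A) (pderiv (char_poly A))"
proof -
  let ?f = "pderiv (char_poly A)"
  let ?N = "poly_mat ?f A"
  have iso1: "p dvd mom A q q k" for k using iso[of k] by (meson dvd_trans dvd_power zero_less_numeral)
  have "q \<bullet> (?N *\<^sub>v q) = (\<Sum>r<n. \<Sum>k\<le>degree ?f. coeff ?f k * (q $ r * ((A ^\<^sub>m k) *\<^sub>v q) $ r))"
    using A carrier_matD[OF poly_mat_carrier[OF A]] poly_mat_mult_vec[OF A q, of _ ?f]
    by (simp add: scalar_prod_def[of q] atLeast0LessThan sum_distrib_left mult_ac del: index_mult_mat_vec)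
  also have "\<dots> = (\<Sum>k\<le>degree ?f. coeff ?f k * mom A q q k)"
    using A carrier_matD[OF pow_carrier_mat[OF A]]
    by (subst sum.swap) (simp add: mom_def scalar_prod_def[of q] atLeast0LessThan sum_distrib_left del: index_mult_mat_vec)
  finally have "p\<^sup>2 dvd q \<bullet> (?N *\<^sub>v q)" using iso by (auto intro!: dvd_sum)
  then have "p\<^sup>2 dvd det ?N"
    using A sym q i p pderiv_char_poly_isotropic[OF A sym q p iso1]
    by (intro det_dvd_square[of _ n q i]) (auto simp: transpose_poly_mat)
  then show ?thesis using resultant_char_poly[OF A e det] by simp
qed

section \<open>Annihilation of the all-ones vector modulo a prime\<close>

text \<open>The linear functional on polynomials that sends t^j to \<open>m j\<close>. For moments
  its values are y^T f(A) x.\<close>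

definition poly_functional :: "(nat \<Rightarrow> 'a :: comm_ring_1) \<Rightarrow> 'a poly \<Rightarrow> 'a" where
  "poly_functional m f = (\<Sum>j\<le>degree f. coeff f j * m j)"

lemma poly_functional_ge:
  assumes "degree f \<le> N" shows "poly_functional m f = (\<Sum>j\<le>N. coeff f j * m j)"
  unfolding poly_functional_def using assms by (intro sum.mono_neutral_left) (auto simp: coeff_eq_0)

lemma poly_functional_pCons:
  "poly_functional m (pCons a f) = a * m 0 + poly_functional (\<lambda>j. m (Suc j)) f"
  by (subst poly_functional_ge[of _ "Suc (degree f)"])
    (auto simp: degree_pCons_le poly_functional_def sum.atMost_Suc_shift simp del: sum.atMost_Suc)

lemma poly_functional_add: "poly_functional m (f + g) = poly_functional m f + poly_functional m g"
  using poly_functional_ge[of _ "max (degree f) (degree g)" m] degree_add_le_max[of f g]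
  by (simp add: sum.distrib distrib_right)

lemma poly_functional_smult: "poly_functional m (smult c f) = c * poly_functional m f"
  using poly_functional_ge[of _ "degree f" m] degree_smult_le[of c f]
  by (simp add: sum_distrib_left mult.assoc)

lemma poly_functional_mult:
  "poly_functional m (f * g) = poly_functional (\<lambda>a. poly_functional (\<lambda>b. m (a + b)) g) f"
proof (induction f arbitrary: m)
  case 0
  show ?case by (simp add: poly_functional_def)
next
  case (pCons a f)
  have "poly_functional m (pCons a f * g) = a * poly_functional m g + poly_functional m (pCons 0 (f * g))"
    by (simp add: mult_pCons_left poly_functional_add poly_functional_smult)
  also have "poly_functional m (pCons 0 (f * g)) = poly_functional (\<lambda>j. m (Suc j)) (f * g)"
    by (simp add: poly_functional_pCons)
  finally show ?case using pCons.IH[of "\<lambda>j. m (Suc j)"] by (simp add: poly_functional_pCons)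
qed

lemma mom_unit:
  assumes "A \<in> carrier_mat n n" "x \<in> carrier_vec n" "r < n"
  shows "mom A (unit_vec n r) x k = ((A ^\<^sub>m k) *\<^sub>v x) $ r"
  unfolding mom_def using assms by (intro scalar_prod_left_unit) (auto simp: mult_mat_vec_carrier[of _ n n])

lemma poly_mat_mult_vec_functional:
  assumes "A \<in> carrier_mat n n" "x \<in> carrier_vec n" "r < n"
  shows "(poly_mat f A *\<^sub>v x) $ r = poly_functional (mom A (unit_vec n r) x) f"
  using assms by (simp add: poly_mat_mult_vec mom_unit poly_functional_def del: index_mult_mat_vec)

text \<open>The Frobenius identity f(t)^2 = f(t^2) modulo 2: in each induction step the cross term
  is even and a^2 is congruent to a.\<close>

lemma square_pcompose_mod_2: "[:2:] dvd f * f - f \<circ>\<^sub>p monom 1 2" for f :: "int poly"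
proof (induction f)
  case (pCons a f)
  define x where "x = ([:0,1:] :: int poly)"
  have x: "monom 1 2 = x * x" "pCons a f = [:a:] + x * f"
    by (simp_all add: x_def monom_altdef power2_eq_square)
  have two: "[:2:] * h = h + h" for h :: "int poly"
    by (metis mult_2 numeral_poly)
  have "pCons a f \<circ>\<^sub>p monom 1 2 = [:a:] + x * x * (f \<circ>\<^sub>p (x * x))"
    by (simp only: pcompose_pCons x(1))
  then have "pCons a f * pCons a f - pCons a f \<circ>\<^sub>p monom 1 2 =
    ([:a:] * [:a:] - [:a:]) + x * x * (f * f - f \<circ>\<^sub>p monom 1 2) + [:2:] * ([:a:] * x * f)"
    unfolding x two by (simp only: algebra_simps)
  moreover have "[:2:] dvd [:a:] * [:a:] - [:a:]"
  proof -
    have "even (a * a - a)" by simp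
    then show ?thesis by (simp add: const_poly_dvd)
  qed
  ultimately show ?case using pCons.IH by (metis dvd_add dvd_mult dvd_triv_left)
qed simp

section \<open>Characteristic polynomials of symmetric matrices modulo 2\<close>

lemma dvd_prod_diff:
  fixes f g :: "'b \<Rightarrow> 'a :: comm_ring_1"
  assumes "\<And>x. x \<in> S \<Longrightarrow> d dvd f x - g x"
  shows "d dvd prod f S - prod g S"
  using assms
proof (induction S rule: infinite_finite_induct)
  case (insert x S)
  have "prod f (insert x S) - prod g (insert x S) = f x * (prod f S - prod g S) + (f x - g x) * prod g S"
    using insert by (simp add: algebra_simps)
  then show ?case using insert by (metis dvd_add dvd_mult dvd_mult2 insertCI)
qed auto

lemma dvd_det_diff:
  fixes A B :: "'a :: comm_ring_1 mat"
  assumes "A \<in> carrier_mat n n" "B \<in> carrier_mat n n"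
    and "\<And>i j. i < n \<Longrightarrow> j < n \<Longrightarrow> d dvd A $$ (i,j) - B $$ (i,j)"
  shows "d dvd det A - det B"
proof -
  have "d dvd (\<Prod>i = 0..<n. A $$ (i, \<pi> i)) - (\<Prod>i = 0..<n. B $$ (i, \<pi> i))" if "\<pi> permutes {0..<n}" for \<pi>
    using assms(3) permutes_in_image[OF that] by (intro dvd_prod_diff) auto
  then have "d dvd (\<Sum>\<pi> | \<pi> permutes {0..<n}. signof \<pi> * ((\<Prod>i = 0..<n. A $$ (i, \<pi> i)) - (\<Prod>i = 0..<n. B $$ (i, \<pi> i))))"
    by (intro dvd_sum dvd_mult) auto
  then show ?thesis
    using assms(1,2) by (simp add: det_def' right_diff_distrib sum_subtractf)
qed

text \<open>The substitution t -> -t turns t I - S into the negative of its transpose, so \<chi>(-t)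
  = (-1)^n \<chi>(t).\<close>

lemma char_poly_skew_coeff:
  fixes S :: "int mat"
  assumes S: "S \<in> carrier_mat n n" and skew: "\<And>i j. i < n \<Longrightarrow> j < n \<Longrightarrow> S $$ (i,j) = - S $$ (j,i)"
    and "odd (n + i)"
  shows "coeff (char_poly S) i = 0"
proof -
  let ?h = "\<lambda>q :: int poly. q \<circ>\<^sub>p [:0, -1:]"
  have "map_mat ?h (char_poly_matrix S) = (- 1) \<cdot>\<^sub>m transpose_mat (char_poly_matrix S)"
  proof (rule eq_matI)
    fix i j assume "i < dim_row ((- 1) \<cdot>\<^sub>m transpose_mat (char_poly_matrix S))"
      "j < dim_col ((- 1) \<cdot>\<^sub>m transpose_mat (char_poly_matrix S))"
    then have ij: "i < n" "j < n" using S by (auto simp: char_poly_matrix_def)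
    have "S $$ (i,j) + S $$ (j,i) = 0" using skew[OF ij] by linarith
    then show "map_mat ?h (char_poly_matrix S) $$ (i,j) = ((- 1) \<cdot>\<^sub>m transpose_mat (char_poly_matrix S)) $$ (i,j)"
      using S ij by (auto simp: char_poly_matrix_def add_eq_0_iff)
  qed (use S in \<open>auto simp: char_poly_matrix_def\<close>)
  then have "det (map_mat ?h (char_poly_matrix S)) = (- 1) ^ n * det (transpose_mat (char_poly_matrix S))"
    using carrier_matD[OF char_poly_matrix_closed[OF S]] by simp
  then have "?h (char_poly S) = (- 1) ^ n * char_poly S"
    using S by (simp add: char_poly_def comm_ring_hom.hom_det[OF pcompose_hom.comm_ring_hom_axioms] det_transpose[of _ n])
  then have "coeff (?h (char_poly S)) i = coeff ((- 1) ^ n * char_poly S) i" by simp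
  moreover have "coeff ((- 1) ^ n * char_poly S) i = (- 1) ^ n * coeff (char_poly S) i"
    by (cases "even n") simp_all
  moreover have "coeff (?h (char_poly S)) i = (- 1) ^ i * coeff (char_poly S) i"
    using coeff_pcompose_linear[of "char_poly S" "-1" i] by simp
  ultimately show ?thesis using assms(3) by (cases "even n") auto
qed

text \<open>Modulo 2, \<open>A\<close> agrees with a skew-symmetric integral matrix.\<close>
lemma char_poly_zero_diag_coeff_even:
  fixes A :: "int mat"
  assumes A: "A \<in> carrier_mat n n" and sym: "transpose_mat A = A" and diag: "\<And>i. i < n \<Longrightarrow> A $$ (i,i) = 0"
    and "odd (n + i)"
  shows "even (coeff (char_poly A) i)"
proof -
  define S where "S = mat n n (\<lambda>(i,j). if i < j then A $$ (i,j) else - A $$ (i,j))"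
  have S: "S \<in> carrier_mat n n" by (simp add: S_def)
  have symij: "A $$ (i,j) = A $$ (j,i)" if "i < n" "j < n" for i j
    using arg_cong[OF sym, of "\<lambda>M. M $$ (j,i)"] A that by simp
  have "[:2:] dvd det (char_poly_matrix A) - det (char_poly_matrix S)"
  proof (rule dvd_det_diff[of _ n])
    fix i j assume ij: "i < n" "j < n"
    have "char_poly_matrix A $$ (i,j) - char_poly_matrix S $$ (i,j) = [:S $$ (i,j) - A $$ (i,j):]"
      using ij A S by (auto simp: char_poly_matrix_def)
    moreover have "2 dvd S $$ (i,j) - A $$ (i,j)" using ij by (auto simp: S_def)
    ultimately show "[:2:] dvd char_poly_matrix A $$ (i,j) - char_poly_matrix S $$ (i,j)" by (simp add: const_poly_dvd)
  qed (use A S in auto)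
  then have "2 dvd coeff (char_poly A) i - coeff (char_poly S) i"
    by (simp add: char_poly_def const_poly_dvd_iff)
  moreover have "coeff (char_poly S) i = 0"
    using symij diag by (intro char_poly_skew_coeff[OF S _ assms(4)]) (auto simp: S_def not_less le_less)
  ultimately show ?thesis by simp
qed

section \<open>Adjacency matrices, the all-ones matrix and the polynomial M_p\<close>

lemma adj_mat_carrier [simp]: "adj_mat n G \<in> carrier_mat n n"
  by (simp add: adj_mat_def)

lemma transpose_adj_mat [simp]: "transpose_mat (adj_mat n G) = adj_mat n G"
  by (intro eq_matI) (auto simp: adj_mat_def insert_commute)

lemma adj_mat_diag: "simple_graph n G \<Longrightarrow> i < n \<Longrightarrow> adj_mat n G $$ (i,i) = 0"
  by (auto simp: adj_mat_def simple_graph_def all_edges_def doubleton_eq_iff)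

lemma ones_vec_carrier [simp]: "ones_vec n \<in> carrier_vec n"
  by (simp add: ones_vec_def)

text \<open>Adding a multiple of J = e e^T is a rank-one update. The case c = 1 serves the
  polynomial M_p, the case c = -1 serves the complement.\<close>

lemma char_poly_add_smult_ones:
  fixes A :: "int mat"
  assumes A: "A \<in> carrier_mat n n"
  shows "char_poly (A + c \<cdot>\<^sub>m ones_mat n) = char_poly A - smult c (num_poly (char_poly A) (mom A (ones_vec n) (ones_vec n)))"
proof -
  let ?e = "ones_vec n"
  have "A - mat_of_cols n [- c \<cdot>\<^sub>v ?e] * mat_of_rows n [?e] = A + c \<cdot>\<^sub>m ones_mat n"
    using A by (intro eq_matI) (auto simp: ones_vec_def ones_mat_def scalar_prod_def mat_of_cols_def mat_of_rows_def)
  moreover have "mom A ?e (- c \<cdot>\<^sub>v ?e) = (\<lambda>k. - c * mom A ?e ?e k)"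
  proof
    fix k
    have v: "(A ^\<^sub>m k) *\<^sub>v ?e \<in> carrier_vec n" using A by (simp add: mult_mat_vec_carrier[of _ n n])
    have "(A ^\<^sub>m k) *\<^sub>v (- c \<cdot>\<^sub>v ?e) = - c \<cdot>\<^sub>v ((A ^\<^sub>m k) *\<^sub>v ?e)"
      using carrier_matD[OF pow_carrier_mat[OF A, of k]] by (intro eq_vecI) (auto simp: scalar_prod_def ones_vec_def sum_distrib_left mult_ac)
    then show "mom A ?e (- c \<cdot>\<^sub>v ?e) k = - c * mom A ?e ?e k"
      using scalar_prod_smult_distrib[OF ones_vec_carrier v, of "- c"] by (simp only: mom_def)
  qed
  then have "num_poly (char_poly A) (mom A ?e (- c \<cdot>\<^sub>v ?e)) = - smult c (num_poly (char_poly A) (mom A ?e ?e))"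
    by (simp only: num_poly_smult) simp
  ultimately show ?thesis using char_poly_rank_one_update[OF A, of "- c \<cdot>\<^sub>v ?e" ?e] by simp
qed

lemma char_poly_add_ones:
  fixes A :: "int mat"
  assumes A: "A \<in> carrier_mat n n"
  shows "char_poly (A + ones_mat n) = char_poly A - num_poly (char_poly A) (mom A (ones_vec n) (ones_vec n))"
proof -
  have "A + 1 \<cdot>\<^sub>m ones_mat n = A + ones_mat n" using A by (intro eq_matI) (auto simp: ones_mat_def)
  then show ?thesis using char_poly_add_smult_ones[OF A, of 1] by simp
qed

lemma quot_sfp_annihilates_ones:
  fixes A :: "int mat"
  assumes A: "A \<in> carrier_mat n n" and sym: "transpose_mat A = A" and n: "n > 0" and p: "prime p"
  defines "M \<equiv> quot_mod p (char_poly A) (sfp_mod p (gcd_mod p (char_poly A) (char_poly (A + ones_mat n))))"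
  shows "monic M" "degree M \<le> n" "r < n \<Longrightarrow> p dvd (poly_mat M A *\<^sub>v ones_vec n) $ r"
proof -
  let ?\<chi> = "char_poly A" and ?e = "ones_vec n"
  let ?num = "\<lambda>y x. num_poly ?\<chi> (mom A y x)"
  have \<chi>: "degree ?\<chi> = n" "monic ?\<chi>" using degree_monic_char_poly[OF A] by auto
  define g where "g = gcd_mod p ?\<chi> (char_poly (A + ones_mat n))"
  define k where "k = sfp_mod p g"
  note gcd = gcd_mod_props[OF p monic_not_const_dvd[OF p \<chi>(2)], of "char_poly (A + ones_mat n)", folded g_def]
  have mg: "monic g" using gcd(1) by (simp add: monic_mod_def)
  note sfp = sfp_mod_props[OF p mg, folded k_def]
  have mk: "monic k" using sfp(1) by (simp add: monic_mod_def)
  have "poly_mod.dvdm p k ?\<chi>" using sfp(2) gcd(2) dvdm_trans by blast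
  note quot = quot_mod_props[OF p \<chi>(2) mk this]
  have M: "M = quot_mod p ?\<chi> k" by (simp add: M_def k_def g_def)
  show "monic M" "degree M \<le> n" using quot \<chi>(1) by (simp_all add: M monic_mod_def)
  show "p dvd (poly_mat M A *\<^sub>v ?e) $ r" if r: "r < n"
  proof -
    let ?u = "unit_vec n r :: int vec"
    \<comment> \<open>The difference of the two characteristic polynomials is the numerator of the
      moments e^T A^k e, so the gcd divides that numerator.\<close>
    have "poly_mod.dvdm p g (?\<chi> + char_poly (A + ones_mat n) * (- 1))"
      using gcd by (intro dvdm_add dvdm_mult)
    then have gee: "poly_mod.dvdm p g (?num ?e ?e)" by (simp add: char_poly_add_ones[OF A])
    have "?\<chi> dvd ?num ?u ?u * ?num ?e ?e - ?num ?u ?e * ?num ?e ?u"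
      by (intro char_poly_dvd_num_poly_minor[OF A]) auto
    also have "mom A ?e ?u = mom A ?u ?e" using mom_sym[OF A sym] by simp
    finally have "poly_mod.dvdm p ?\<chi> (?num ?u ?u * ?num ?e ?e - ?num ?u ?e * ?num ?u ?e)" by (rule dvdm_of_dvd)
    then have "poly_mod.dvdm p g (?num ?u ?u * ?num ?e ?e - ?num ?u ?e * ?num ?u ?e)" using gcd(2) dvdm_trans by blast
    then have "poly_mod.dvdm p g ((?num ?u ?u * ?num ?e ?e - ?num ?u ?e * ?num ?u ?e) * (- 1) + ?num ?e ?e * ?num ?u ?u)"
      using gee by (intro dvdm_add dvdm_mult)
    then have "poly_mod.dvdm p g (?num ?u ?e * ?num ?u ?e)" by (simp add: mult.commute)
    then have "poly_mod.dvdm p k (?num ?u ?e)" by (rule sfp(3))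
    then obtain h s where h: "?num ?u ?e = k * h + [:p:] * s" by (auto simp: dvdm_iff)
    \<comment> \<open>M times the squarefree part k is \<chi> modulo p, and k divides the numerator
      for \<open>?u\<close> and e; multiplying that numerator by M therefore produces a multiple of
      \<chi>.\<close>
    obtain t where t: "M * k - ?\<chi> = [:p:] * t" using quot(2) unfolding M by (auto simp only: dvd_def)
    then have "M * k = ?\<chi> + [:p:] * t" by (simp only: algebra_simps)
    then have "M * ?num ?u ?e = ?\<chi> * h + [:p:] * (t * h + M * s)"
      unfolding h distrib_left mult.assoc[symmetric] by (simp only: algebra_simps)
    then have "poly_mod.dvdm p ?\<chi> (M * ?num ?u ?e)" by (rule dvdmI)
    then have "p dvd poly_functional (mom A ?u ?e) M"
      unfolding poly_functional_def by (intro dvdm_num_poly_imp_dvd[OF A _ _ n p]) auto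
    then show ?thesis using poly_mat_mult_vec_functional[OF A _ r] by simp
  qed
qed

text \<open>The matrix \<open>B = f(A)\<close> is symmetric with \<open>B\<^sup>2 = 0\<close> modulo 2, and the \<open>r\<close>-th diagonal entry of \<open>B\<^sup>2\<close> is
  the sum of the squares of the \<open>r\<close>-th row of \<open>B\<close>, hence congruent to \<open>(B e)\<^sub>r\<close>.\<close>
lemma poly_mat_ones_even:
  fixes A :: "int mat"
  assumes A: "A \<in> carrier_mat n n" and sym: "transpose_mat A = A" and n: "n > 0"
    and f: "poly_mod.dvdm 2 (char_poly A) (f * f)" and r: "r < n"
  shows "even ((poly_mat f A *\<^sub>v ones_vec n) $ r)"
proof -
  let ?u = "unit_vec n r :: int vec" and ?B = "poly_mat f A"
  have B: "?B \<in> carrier_mat n n" using A by simp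
  have "poly_mod.dvdm 2 (char_poly A) ((f * f) * num_poly (char_poly A) (mom A ?u ?u))"
    using f by (rule dvdm_mult)
  then have "even (poly_functional (mom A ?u ?u) (f * f))"
    unfolding poly_functional_def by (intro dvdm_num_poly_imp_dvd[OF A _ _ n]) auto
  also have "poly_functional (mom A ?u ?u) (f * f) = poly_functional (\<lambda>a. poly_functional (\<lambda>b. mom A ?u ?u (a + b)) f) f"
    by (rule poly_functional_mult)
  also have "(\<lambda>a. poly_functional (\<lambda>b. mom A ?u ?u (a + b)) f) = mom A ?u (?B *\<^sub>v ?u)"
  proof
    fix a
    have Ba: "?B *\<^sub>v ?u \<in> carrier_vec n" using B by (simp add: mult_mat_vec_carrier[of _ n n])
    have Aa: "A ^\<^sub>m a \<in> carrier_mat n n" using A by simp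
    have ent: "(?B *\<^sub>v ?u) $ c = poly_functional (mom A (unit_vec n c) ?u) f" if "c < n" for c
      using poly_mat_mult_vec_functional[OF A _ that] by simp
    have "mom A ?u (?B *\<^sub>v ?u) a = ((A ^\<^sub>m a) *\<^sub>v (?B *\<^sub>v ?u)) $ r"
      by (rule mom_unit[OF A Ba r])
    also have "\<dots> = (\<Sum>c<n. (A ^\<^sub>m a) $$ (r,c) * (?B *\<^sub>v ?u) $ c)"
      using carrier_matD[OF Aa] carrier_vecD[OF Ba] r
      by (simp add: scalar_prod_def[of "row (A ^\<^sub>m a) r"] atLeast0LessThan del: dim_mult_mat_vec index_mult_mat_vec(1))
        (simp add: scalar_prod_def atLeast0LessThan)
    also have "\<dots> = (\<Sum>c<n. \<Sum>j\<le>degree f. (A ^\<^sub>m a) $$ (r,c) * (coeff f j * ((A ^\<^sub>m j) *\<^sub>v ?u) $ c))"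
      by (intro sum.cong refl) (simp add: ent poly_functional_def mom_unit[OF A] sum_distrib_left del: index_mult_mat_vec)
    also have "\<dots> = (\<Sum>j\<le>degree f. coeff f j * (\<Sum>c<n. (A ^\<^sub>m a) $$ (r,c) * ((A ^\<^sub>m j) *\<^sub>v ?u) $ c))"
      by (subst sum.swap) (simp add: sum_distrib_left mult_ac del: index_mult_mat_vec)
    also have "\<dots> = (\<Sum>j\<le>degree f. coeff f j * mom A ?u ?u (a + j))"
    proof (intro sum.cong refl arg_cong2[of _ _ _ _ "(*)"])
      fix j
      have v: "(A ^\<^sub>m j) *\<^sub>v ?u \<in> carrier_vec n" using A by (simp add: mult_mat_vec_carrier[of _ n n])
      have "mom A ?u ?u (a + j) = ((A ^\<^sub>m a) *\<^sub>v ((A ^\<^sub>m j) *\<^sub>v ?u)) $ r"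
        using mom_unit[OF A _ r, of ?u] pow_mat_mult_vec_add[OF A, of ?u] by simp
      also have "\<dots> = (\<Sum>c<n. (A ^\<^sub>m a) $$ (r,c) * ((A ^\<^sub>m j) *\<^sub>v ?u) $ c)"
        using carrier_matD[OF Aa] carrier_vecD[OF v] r
        by (simp add: scalar_prod_def[of "row (A ^\<^sub>m a) r"] atLeast0LessThan del: dim_mult_mat_vec index_mult_mat_vec(1))
          (simp add: scalar_prod_def atLeast0LessThan)
      finally show "(\<Sum>c<n. (A ^\<^sub>m a) $$ (r,c) * ((A ^\<^sub>m j) *\<^sub>v ?u) $ c) = mom A ?u ?u (a + j)" by simp
    qed
    finally show "poly_functional (\<lambda>b. mom A ?u ?u (a + b)) f = mom A ?u (?B *\<^sub>v ?u) a"
      by (simp add: poly_functional_def)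
  qed
  also have "poly_functional (mom A ?u (?B *\<^sub>v ?u)) f = (?B *\<^sub>v (?B *\<^sub>v ?u)) $ r"
    using poly_mat_mult_vec_functional[OF A _ r, of "?B *\<^sub>v ?u" f] B by (simp add: mult_mat_vec_carrier[of _ n n])
  also have "\<dots> = (\<Sum>c<n. ?B $$ (r,c) * ?B $$ (c,r))"
    using carrier_matD[OF B] r by (simp add: scalar_prod_def[of "row ?B r"] atLeast0LessThan)
  also have "\<dots> = (\<Sum>c<n. ?B $$ (r,c) * ?B $$ (r,c))"
  proof (intro sum.cong refl)
    fix c assume "c \<in> {..<n}"
    then have "?B $$ (c,r) = ?B $$ (r,c)"
      using arg_cong[OF transpose_poly_mat[OF A sym, of f], of "\<lambda>N. N $$ (r,c)"] carrier_matD[OF B] r by simp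
    then show "?B $$ (r,c) * ?B $$ (c,r) = ?B $$ (r,c) * ?B $$ (r,c)" by simp
  qed
  finally have "even (\<Sum>c<n. ?B $$ (r,c) * ?B $$ (r,c))" .
  moreover have "even (\<Sum>c<n. ?B $$ (r,c) * ?B $$ (r,c) - ?B $$ (r,c))" by (intro dvd_sum) auto
  ultimately have "even (\<Sum>c<n. ?B $$ (r,c))" by (simp add: sum_subtractf)
  moreover have "(?B *\<^sub>v ones_vec n) $ r = (\<Sum>c<n. ?B $$ (r,c))"
    using carrier_matD[OF B] r by (simp add: scalar_prod_def atLeast0LessThan ones_vec_def)
  ultimately show ?thesis by simp
qed

text \<open>Modulo 2 the coefficients at exponents of parity other than that of n vanish, so \<chi>
  = t^b g(t^2) = t^b g^2 with b the parity of n. Hence f^2 is \<chi> for even n; for odd n the extra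
  factor t in f gives f^2 = t \<chi>.\<close>

lemma half_char_poly_square:
  fixes A :: "int mat"
  assumes A: "A \<in> carrier_mat n n" and sym: "transpose_mat A = A" and diag: "\<And>i. i < n \<Longrightarrow> A $$ (i,i) = 0"
  defines "g \<equiv> (\<Sum>j\<le>n div 2. monom (coeff (char_poly A) (n - 2 * j)) (n div 2 - j))"
  defines "f \<equiv> if even n then g else [:0, 1:] * g"
  shows "monic f" "degree f \<le> n" "poly_mod.dvdm 2 (char_poly A) (f * f)"
proof -
  let ?\<chi> = "char_poly A" and ?k = "n div 2"
  have \<chi>: "degree ?\<chi> = n" "coeff ?\<chi> n = 1" using degree_monic_char_poly[OF A] by auto
  have cg: "coeff g i = (if i \<le> ?k then coeff ?\<chi> (n - 2 * (?k - i)) else 0)" for i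
  proof -
    have "coeff g i = (\<Sum>j\<le>?k. if j = ?k - i \<and> i \<le> ?k then coeff ?\<chi> (n - 2 * j) else 0)"
      unfolding g_def coeff_sum by (intro sum.cong) auto
    then show ?thesis by (cases "i \<le> ?k") simp_all
  qed
  have dg: "degree g = ?k"
  proof (rule antisym)
    show "degree g \<le> ?k" by (rule degree_le) (simp add: cg)
    show "?k \<le> degree g" by (rule le_degree) (simp add: cg \<chi>)
  qed
  have mg: "monic g" by (simp add: dg cg \<chi>)
  have g0: "g \<noteq> 0" using mg by auto
  show "monic f" using mg g0 by (simp add: f_def lead_coeff_mult)
  show "degree f \<le> n" using g0 dg by (auto simp: f_def degree_mult_eq elim: oddE)
  define b where "b = n mod 2"
  have n: "n = 2 * ?k + b" and b: "b \<le> 1" by (auto simp: b_def)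
  have "[:2:] dvd ?\<chi> - monom 1 b * (g \<circ>\<^sub>p monom 1 2)"
    unfolding const_poly_dvd_iff
  proof
    fix i
    show "2 dvd coeff (?\<chi> - monom 1 b * (g \<circ>\<^sub>p monom 1 2)) i"
    proof (cases "even (n + i)")
      case False
      have "coeff (monom 1 b * (g \<circ>\<^sub>p monom 1 2)) i = 0"
      proof (cases "b \<le> i")
        case True
        have "odd (i - b)" using n False True by (metis even_add dvd_triv_left le_add_diff_inverse)
        then obtain i' where "i - b = 2 * i' + 1" by (rule oddE)
        then show ?thesis using coeff_pcompose_monom[of 1 2 g i'] True by (simp add: coeff_monom_mult)
      qed (simp add: coeff_monom_mult)
      then show ?thesis using char_poly_zero_diag_coeff_even[OF A sym diag False] by simp
    next
      case True
      have "b \<le> i" using n b True by (cases i) (auto simp: le_Suc_eq)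
      have "even (i - b)" using n True \<open>b \<le> i\<close> by (metis even_add dvd_triv_left le_add_diff_inverse)
      then obtain i' where "i - b = 2 * i'" by (rule evenE)
      then have i': "i = 2 * i' + b" using \<open>b \<le> i\<close> by simp
      have "coeff (monom 1 b * (g \<circ>\<^sub>p monom 1 2)) i = coeff g i'"
        using coeff_pcompose_monom[of 0 2 g i'] by (simp add: i' coeff_monom_mult)
      also have "\<dots> = coeff ?\<chi> i"
      proof (cases "i' \<le> ?k")
        case True
        then have "n - 2 * (?k - i') = i" using n i' by linarith
        then show ?thesis using True by (simp add: cg)
      next
        case False
        then have "degree ?\<chi> < i" using n i' \<chi>(1) by linarith
        then show ?thesis using False by (simp add: cg coeff_eq_0)
      qed
      finally have "coeff (monom 1 b * (g \<circ>\<^sub>p monom 1 2)) i = coeff ?\<chi> i" .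
      then show ?thesis by simp
    qed
  qed
  moreover have "[:2:] dvd g * g - g \<circ>\<^sub>p monom 1 2" by (rule square_pcompose_mod_2)
  ultimately have "[:2:] dvd monom 1 b * (g * g - g \<circ>\<^sub>p monom 1 2) - (?\<chi> - monom 1 b * (g \<circ>\<^sub>p monom 1 2))"
    by (blast intro: dvd_diff dvd_mult)
  then have "[:2:] dvd monom 1 b * (g * g) - ?\<chi>" by (simp add: algebra_simps)
  then obtain t where "monom 1 b * (g * g) - ?\<chi> = [:2:] * t" by (auto simp only: dvd_def)
  then have t: "monom 1 b * (g * g) = ?\<chi> + [:2:] * t" by (simp only: algebra_simps)
  show "poly_mod.dvdm 2 ?\<chi> (f * f)"
  proof (cases "even n")
    case True
    then have "f * f = ?\<chi> * 1 + [:2:] * t" using t by (simp add: f_def b_def monom_0 one_pCons[symmetric])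
    then show ?thesis by (rule dvdmI)
  next
    case False
    then have "monom 1 b = [:0,1 :: int:]" by (simp add: b_def odd_iff_mod_2_eq_one monom_altdef)
    then have "f * f = [:0,1:] * (monom 1 b * (g * g))" using False by (simp only: f_def if_False algebra_simps)
    also have "\<dots> = ?\<chi> * [:0,1:] + [:2:] * ([:0,1:] * t)" unfolding t by (simp only: algebra_simps)
    finally show ?thesis by (rule dvdmI)
  qed
qed


lemma M_poly_props:
  assumes G: "simple_graph n G" and n: "n > 0" and p: "prime p"
  shows "monic (M_poly n G p)" "degree (M_poly n G p) \<le> n"
    "r < n \<Longrightarrow> p dvd (poly_mat (M_poly n G p) (adj_mat n G) *\<^sub>v ones_vec n) $ r"
proof -
  let ?A = "adj_mat n G"
  have "monic (M_poly n G p) \<and> degree (M_poly n G p) \<le> n \<and>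
    (r < n \<longrightarrow> p dvd (poly_mat (M_poly n G p) ?A *\<^sub>v ones_vec n) $ r)"
  proof (cases "p = 2")
    case False
    then show ?thesis
      using quot_sfp_annihilates_ones[OF adj_mat_carrier transpose_adj_mat n p] by (simp add: M_poly_def Let_def)
  next
    case True
    define g where "g = (\<Sum>j\<le>n div 2. monom (coeff (char_poly ?A) (n - 2 * j)) (n div 2 - j))"
    define f where "f = (if even n then g else [:0, 1:] * g)"
    have M: "M_poly n G p = poly_mod.Mp 2 f" by (simp add: M_poly_def Let_def True f_def g_def)
    note f = half_char_poly_square[OF adj_mat_carrier transpose_adj_mat adj_mat_diag[OF G], folded g_def, folded f_def]
    have p2: "prime (2 :: int)" using p True by simp
    \<comment> \<open>As a difference of squares, the change caused by reduction modulo 2 contains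
      the even factor \<open>poly_mod.Mp 2 f - f\<close>.\<close>
    have "f * f - poly_mod.Mp 2 f * poly_mod.Mp 2 f = - ((poly_mod.Mp 2 f - f) * (poly_mod.Mp 2 f + f))"
      by (simp only: algebra_simps)
    then have "[:2:] dvd f * f - poly_mod.Mp 2 f * poly_mod.Mp 2 f"
      using dvd_Mp_diff[of 2 f] by (simp only: dvd_minus_iff dvd_mult2)
    then have "poly_mod.dvdm 2 (char_poly ?A) (poly_mod.Mp 2 f * poly_mod.Mp 2 f)"
      using dvdm_cong f(3) by blast
    then have "r < n \<longrightarrow> even ((poly_mat (poly_mod.Mp 2 f) ?A *\<^sub>v ones_vec n) $ r)"
      using poly_mat_ones_even[OF adj_mat_carrier transpose_adj_mat n] by blast
    then show ?thesis using f(1,2) lead_coeff_Mp[OF p2 f(1)] M True by simp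
  qed
  then show "monic (M_poly n G p)" "degree (M_poly n G p) \<le> n"
    "r < n \<Longrightarrow> p dvd (poly_mat (M_poly n G p) ?A *\<^sub>v ones_vec n) $ r" by auto
qed

text \<open>Generalized cospectral graphs share both characteristic polynomials, hence M_p. Only
  therefore can one matrix R carry \<open>walk_mat_p\<close> of one graph to that of the
  other.\<close>

lemma M_poly_cong:
  assumes "char_poly (adj_mat n G) = char_poly (adj_mat n H)"
    "char_poly (adj_mat n G + ones_mat n) = char_poly (adj_mat n H + ones_mat n)"
  shows "M_poly n G p = M_poly n H p"
  using assms by (simp add: M_poly_def Let_def)

section \<open>Walk matrices\<close>

definition krylov :: "nat \<Rightarrow> nat set set \<Rightarrow> nat \<Rightarrow> int vec" where
  "krylov n G j = (adj_mat n G ^\<^sub>m j) *\<^sub>v ones_vec n"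

lemma krylov_carrier [simp]: "krylov n G j \<in> carrier_vec n"
  by (simp add: krylov_def mult_mat_vec_carrier[of _ n n])

lemma walk_mat_carrier [simp]: "walk_mat n G \<in> carrier_mat n n"
  by (simp add: walk_mat_def mat_of_cols_def)

lemma dim_graph_mats [simp]:
  "dim_row (adj_mat n G) = n" "dim_col (adj_mat n G) = n"
  "dim_row (walk_mat n G) = n" "dim_col (walk_mat n G) = n" "dim_vec (krylov n G j) = n"
  using carrier_matD[OF adj_mat_carrier[of n G]] carrier_matD[OF walk_mat_carrier[of n G]]
    carrier_vecD[OF krylov_carrier[of n G j]] by simp_all

lemma walk_mat_index: "i < n \<Longrightarrow> j < n \<Longrightarrow> walk_mat n G $$ (i,j) = krylov n G j $ i"
  by (simp add: walk_mat_def mat_of_cols_def krylov_def)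

lemma det_walk_mat:
  assumes "controllable n G" shows "det (walk_mat n G) \<noteq> 0"
proof -
  have "det (map_mat rat_of_int (walk_mat n G)) \<noteq> 0"
    using assms vec_space.det_rank_iff[of "map_mat rat_of_int (walk_mat n G)" n] by (simp add: controllable_def)
  then show ?thesis by simp
qed

lemma walk_mat_p_carrier [simp]: "walk_mat_p n G p \<in> carrier_mat n n"
  by (simp add: walk_mat_p_def Let_def mat_of_cols_def)

lemma dim_walk_mat_p [simp]: "dim_row (walk_mat_p n G p) = n" "dim_col (walk_mat_p n G p) = n"
  using carrier_matD[OF walk_mat_p_carrier[of n G p]] by simp_all

text \<open>The columns express \<open>1, t, \<dots>, t\<^sup>s\<^sup>-\<^sup>1, M, t M, \<dots>\<close> in powers of \<open>t\<close>, where \<open>s = degree M\<close>.\<close>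
definition shift_mat :: "nat \<Rightarrow> int poly \<Rightarrow> int mat" where
  "shift_mat n M = mat n n (\<lambda>(i,j). if j < degree M then if i = j then 1 else 0
     else if j - degree M \<le> i then coeff M (i + degree M - j) else 0)"

lemma mult_vec_linear_comb:
  assumes B: "(B :: 'a :: comm_ring_1 mat) \<in> carrier_mat n n" and v: "v \<in> carrier_vec n" and u: "\<And>k. u k \<in> carrier_vec n"
    and "\<And>c. c < n \<Longrightarrow> v $ c = (\<Sum>k\<in>K. f k * u k $ c)" and r: "r < n"
  shows "(B *\<^sub>v v) $ r = (\<Sum>k\<in>K. f k * (B *\<^sub>v u k) $ r)"
proof -
  have "(B *\<^sub>v v) $ r = (\<Sum>c<n. \<Sum>k\<in>K. B $$ (r,c) * (f k * u k $ c))"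
    using assms by (simp add: scalar_prod_def atLeast0LessThan sum_distrib_left)
  also have "\<dots> = (\<Sum>k\<in>K. f k * (B *\<^sub>v u k) $ r)"
    using B r carrier_vecD[OF u] by (subst sum.swap) (simp add: scalar_prod_def atLeast0LessThan sum_distrib_left mult_ac)
  finally show ?thesis .
qed

text \<open>Up to a diagonal factor on one side and a unitriangular one on the other,
  \<open>walk_mat_p\<close> is the walk matrix. Through this identity it inherits nonsingularity and
  the behaviour under R. The annihilation of e by M modulo p makes the entrywise \<open>div\<close>
  exact.\<close>

lemma walk_mat_p_factor:
  assumes G: "simple_graph n G" and n: "n > 0" and p: "prime p"
  defines "M \<equiv> M_poly n G p"
  shows "walk_mat_p n G p * mat_diag n (\<lambda>j. if j < degree M then 1 else p) = walk_mat n G * shift_mat n M"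
proof (rule eq_matI)
  let ?A = "adj_mat n G" and ?e = "ones_vec n" and ?s = "degree M"
  note Mp = M_poly_props[OF G n p, folded M_def]
  define v where "v = poly_mat M ?A *\<^sub>v ?e"
  define w where "w = map_vec (\<lambda>a. a div p) v"
  have v: "v \<in> carrier_vec n" unfolding v_def by (rule mult_mat_vec_carrier[of _ n n]) simp_all
  then have w: "w \<in> carrier_vec n" by (simp add: w_def)
  have "p dvd v $ r" if "r < n" for r using Mp(3)[OF that] by (simp add: v_def)
  then have pw: "v = p \<cdot>\<^sub>v w" using v by (intro eq_vecI) (auto simp: w_def)
  fix r j assume "r < dim_row (walk_mat n G * shift_mat n M)" "j < dim_col (walk_mat n G * shift_mat n M)"
  then have rj: "r < n" "j < n" by (auto simp: shift_mat_def carrier_matD[OF walk_mat_carrier])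
  have "(walk_mat_p n G p * mat_diag n (\<lambda>j. if j < ?s then 1 else p)) $$ (r,j) =
    (if j < ?s then krylov n G j $ r else ((?A ^\<^sub>m (j - ?s)) *\<^sub>v w) $ r * p)"
    using rj by (subst mat_diag_mult_right[of _ n])
      (auto simp: walk_mat_p_def Let_def M_def[symmetric] v_def[symmetric] w_def[symmetric] mat_of_cols_def krylov_def simp del: index_mult_mat_vec)
  also have "\<dots> = (walk_mat n G * shift_mat n M) $$ (r,j)"
  proof -
    have WT: "(walk_mat n G * shift_mat n M) $$ (r,j) = (\<Sum>i<n. krylov n G i $ r * shift_mat n M $$ (i,j))"
      using rj by (subst index_mult_mat_sum[of _ n n _ n]) (auto simp: shift_mat_def walk_mat_index)
    show ?thesis
    proof (cases "j < ?s")
      case True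
      then show ?thesis using rj unfolding WT by (simp add: shift_mat_def if_distrib[of "\<lambda>x. _ * x"] cong: if_cong)
    next
      case False
      let ?t = "j - ?s"
      have "((?A ^\<^sub>m ?t) *\<^sub>v w) $ r * p = ((?A ^\<^sub>m ?t) *\<^sub>v v) $ r"
        \<comment> \<open>A scalar multiple is treated as a linear combination over the one-element
          index set.\<close>
        using mult_vec_linear_comb[of "?A ^\<^sub>m ?t" n v "\<lambda>_. w" "\<lambda>_. p" "{()}" r] rj v w pw by (simp del: index_mult_mat_vec)
      also have "\<dots> = (\<Sum>k\<le>?s. coeff M k * ((?A ^\<^sub>m ?t) *\<^sub>v krylov n G k) $ r)"
        using rj v unfolding v_def krylov_def
        by (intro mult_vec_linear_comb[of _ n] poly_mat_mult_vec) (simp_all add: krylov_def[symmetric] del: index_mult_mat_vec)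
      also have "\<dots> = (\<Sum>k\<le>?s. coeff M k * krylov n G (?t + k) $ r)"
        using pow_mat_mult_vec_add[OF adj_mat_carrier ones_vec_carrier] by (simp add: krylov_def)
      also have "\<dots> = (\<Sum>i\<in>{?t..j}. coeff M (i - ?t) * krylov n G i $ r)"
        using False by (intro sum.reindex_bij_witness[of _ "\<lambda>i. i - ?t" "\<lambda>k. ?t + k"]) auto
      also have "\<dots> = (\<Sum>i<n. krylov n G i $ r * shift_mat n M $$ (i,j))"
        using False rj by (intro sum.mono_neutral_cong_left) (auto simp: shift_mat_def coeff_eq_0)
      finally show ?thesis using False WT by simp
    qed
  qed
  finally show "(walk_mat_p n G p * mat_diag n (\<lambda>j. if j < ?s then 1 else p)) $$ (r,j) = (walk_mat n G * shift_mat n M) $$ (r,j)" .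
qed (auto simp: mat_diag_def shift_mat_def carrier_matD[OF walk_mat_p_carrier] carrier_matD[OF walk_mat_carrier])

lemma det_walk_mat_p:
  assumes G: "simple_graph n G" and n: "n > 0" and p: "prime p" and c: "controllable n G"
  shows "det (walk_mat_p n G p) \<noteq> 0"
proof -
  let ?M = "M_poly n G p"
  have "upper_triangular (shift_mat n ?M)" by (auto simp: shift_mat_def coeff_eq_0)
  then have "det (shift_mat n ?M) = 1"
    using M_poly_props(1)[OF G n p]
    by (subst det_upper_triangular[of _ n]) (auto simp: shift_mat_def prod_list_diag_prod)
  then have "det (walk_mat n G * shift_mat n ?M) \<noteq> 0"
    using det_walk_mat[OF c] by (subst det_mult[of _ n]) (auto simp: shift_mat_def)
  then show ?thesis
    using det_mult[of "walk_mat_p n G p" n "mat_diag n (\<lambda>j. if j < degree ?M then 1 else p)"]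
    unfolding walk_mat_p_factor[OF G n p, symmetric] by auto
qed

definition companion_mat :: "nat \<Rightarrow> int poly \<Rightarrow> int mat" where
  "companion_mat n f = mat n n (\<lambda>(i,j). if Suc j < n then if i = Suc j then 1 else 0 else - coeff f i)"

text \<open>In the Krylov basis A acts as the companion matrix, which depends only on the
  characteristic polynomial; cospectral graphs therefore share it.\<close>

lemma adj_mat_mult_walk_mat:
  "adj_mat n G * walk_mat n G = walk_mat n G * companion_mat n (char_poly (adj_mat n G))"
proof (rule eq_matI)
  let ?A = "adj_mat n G" and ?C = "companion_mat n (char_poly (adj_mat n G))"
  fix r j assume "r < dim_row (walk_mat n G * ?C)" "j < dim_col (walk_mat n G * ?C)"
  then have rj: "r < n" "j < n" by (auto simp: companion_mat_def carrier_matD[OF walk_mat_carrier])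
  have col: "col (walk_mat n G) j = krylov n G j"
    using rj by (intro eq_vecI) (auto simp: walk_mat_index carrier_matD[OF walk_mat_carrier] carrier_vecD[OF krylov_carrier])
  have "(?A * walk_mat n G) $$ (r,j) = krylov n G (Suc j) $ r"
    using rj pow_mat_mult_vec_Suc[OF adj_mat_carrier ones_vec_carrier, of n G j]
    by (simp add: krylov_def[of n G "Suc j"] krylov_def[of n G j, symmetric] col carrier_matD[OF walk_mat_carrier] carrier_matD[OF adj_mat_carrier]
      del: pow_mat.simps)
  also have "\<dots> = (\<Sum>i<n. krylov n G i $ r * ?C $$ (i,j))"
  proof (cases "Suc j < n")
    case True
    then show ?thesis using rj by (simp add: companion_mat_def if_distrib[of "\<lambda>x. _ * x"] cong: if_cong)
  next
    case False
    then have n: "n = Suc j" using rj by simp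
    have "(\<Sum>i\<le>n. coeff (char_poly ?A) i * krylov n G i $ r) = 0"
      using cayley_hamilton_vec[OF adj_mat_carrier ones_vec_carrier rj(1), of G 0] by (simp add: krylov_def)
    then have "(\<Sum>i<n. coeff (char_poly ?A) i * krylov n G i $ r) + krylov n G n $ r = 0"
      using degree_monic_char_poly[OF adj_mat_carrier, of n G] by (simp add: lessThan_Suc_atMost[symmetric])
    moreover have "(\<Sum>i<n. krylov n G i $ r * ?C $$ (i,j)) = - (\<Sum>i<n. coeff (char_poly ?A) i * krylov n G i $ r)"
      using rj False by (simp add: companion_mat_def sum_negf mult.commute)
    ultimately show ?thesis using n by simp
  qed
  also have "\<dots> = (walk_mat n G * ?C) $$ (r,j)"
    using rj by (subst index_mult_mat_sum[of _ n n _ n]) (auto simp: companion_mat_def walk_mat_index)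
  finally show "(?A * walk_mat n G) $$ (r,j) = (walk_mat n G * ?C) $$ (r,j)" .
qed (auto simp: companion_mat_def carrier_matD[OF walk_mat_carrier] carrier_matD[OF adj_mat_carrier])

text \<open>By the symmetry of A the Gram matrix of the walk vectors depends only on the moments e^T
  A^k e, which generalized cospectral graphs have in common.\<close>

lemma gram_walk_mat:
  assumes "i < n" "j < n"
  shows "(transpose_mat (walk_mat n G) * walk_mat n G) $$ (i,j) = mom (adj_mat n G) (ones_vec n) (ones_vec n) (i + j)"
proof -
  let ?A = "adj_mat n G" and ?e = "ones_vec n"
  have col: "col (walk_mat n G) j = krylov n G j" if "j < n" for j
    using that by (intro eq_vecI) (auto simp: walk_mat_index carrier_matD[OF walk_mat_carrier] carrier_vecD[OF krylov_carrier])
  have "(transpose_mat (walk_mat n G) * walk_mat n G) $$ (i,j) = krylov n G i \<bullet> krylov n G j"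
    using assms by (simp add: col carrier_matD[OF walk_mat_carrier])
  also have "\<dots> = krylov n G j \<bullet> ((?A ^\<^sub>m i) *\<^sub>v ?e)"
    unfolding krylov_def[of n G i, symmetric] by (rule comm_scalar_prod[of _ n]) simp_all
  also have "\<dots> = ?e \<bullet> ((?A ^\<^sub>m i) *\<^sub>v krylov n G j)"
    by (rule sym_mat_scalar_prod[of _ n]) (simp_all add: transpose_pow_mat[of _ n])
  also have "\<dots> = mom ?A ?e ?e (i + j)"
    by (simp add: mom_def krylov_def pow_mat_mult_vec_add[of _ n])
  finally show ?thesis .
qed

section \<open>Orthogonal matrices between generalized cospectral graphs\<close>

text \<open>A monic complex polynomial is the product of its linear factors, so the multiset of
  roots determines it, and integer polynomials embed into complex ones.\<close>

lemma spectrum_mset_eq_iff: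
  "spectrum_mset n G = spectrum_mset n H \<longleftrightarrow> char_poly (adj_mat n G) = char_poly (adj_mat n H)"
proof -
  let ?c = "\<lambda>G. map_poly complex_of_int (char_poly (adj_mat n G))"
  have s: "spectrum_mset n G = proots (?c G)" for G
    by (simp add: spectrum_mset_def of_int_hom.char_poly_hom[of _ n])
  have d: "?c G = (\<Prod>x\<in>#proots (?c G). [:- x, 1:])" for G
    using complex_poly_decompose_multiset[of "?c G"] degree_monic_char_poly[OF adj_mat_carrier, of n G] by simp
  have "proots (?c G) = proots (?c H) \<longleftrightarrow> ?c G = ?c H" using d by metis
  then show ?thesis by (simp add: s)
qed

lemma adj_mat_complement:
  assumes "simple_graph n G"
  shows "adj_mat n (complement n G) = ones_mat n - 1\<^sub>m n - adj_mat n G"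
proof (rule eq_matI)
  fix i j assume "i < dim_row (ones_mat n - 1\<^sub>m n - adj_mat n G)" "j < dim_col (ones_mat n - 1\<^sub>m n - adj_mat n G)"
  then have ij: "i < n" "j < n" by (auto simp: adj_mat_def)
  have "{i,j} \<in> all_edges n \<longleftrightarrow> i \<noteq> j" using ij by (auto simp: all_edges_def doubleton_eq_iff)
  then show "adj_mat n (complement n G) $$ (i,j) = (ones_mat n - 1\<^sub>m n - adj_mat n G) $$ (i,j)"
    using ij assms by (auto simp: adj_mat_def ones_mat_def complement_def simple_graph_def)
qed (auto simp: adj_mat_def ones_mat_def)

text \<open>The complement has adjacency matrix J - I - A, so t -> -1 - t turns t I - (A - J) into
  the negative of its characteristic matrix.\<close>

lemma char_poly_complement:
  assumes G: "simple_graph n G"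
  shows "char_poly (adj_mat n G + (- 1) \<cdot>\<^sub>m ones_mat n) \<circ>\<^sub>p [:-1,-1:] = (- 1) ^ n * char_poly (adj_mat n (complement n G))"
proof -
  let ?h = "\<lambda>q :: int poly. q \<circ>\<^sub>p [:-1,-1:]"
  let ?B = "adj_mat n G + (- 1) \<cdot>\<^sub>m ones_mat n" and ?D = "adj_mat n (complement n G)"
  have B: "?B \<in> carrier_mat n n" by (simp add: ones_mat_def)
  have "map_mat ?h (char_poly_matrix ?B) = (- 1) \<cdot>\<^sub>m char_poly_matrix ?D"
    unfolding adj_mat_complement[OF G]
    by (intro eq_matI) (auto simp: char_poly_matrix_def ones_mat_def adj_mat_def)
  then have "det (map_mat ?h (char_poly_matrix ?B)) = (- 1) ^ n * det (char_poly_matrix ?D)"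
    using carrier_matD[OF char_poly_matrix_closed[OF adj_mat_carrier], of n "complement n G"] by simp
  then show ?thesis
    by (simp add: char_poly_def comm_ring_hom.hom_det[OF pcompose_hom.comm_ring_hom_axioms])
qed

lemma gen_cospectral_char_poly:
  assumes G: "simple_graph n G" and H: "simple_graph n H" and c: "gen_cospectral n G H"
  shows "char_poly (adj_mat n G) = char_poly (adj_mat n H)"
    "num_poly (char_poly (adj_mat n G)) (mom (adj_mat n G) (ones_vec n) (ones_vec n)) =
     num_poly (char_poly (adj_mat n H)) (mom (adj_mat n H) (ones_vec n) (ones_vec n))"
    "char_poly (adj_mat n G + ones_mat n) = char_poly (adj_mat n H + ones_mat n)"
proof -
  let ?B = "\<lambda>G. adj_mat n G + (- 1) \<cdot>\<^sub>m ones_mat n" and ?h = "\<lambda>q :: int poly. q \<circ>\<^sub>p [:-1,-1:]"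
  show eq: "char_poly (adj_mat n G) = char_poly (adj_mat n H)"
    using c by (simp add: gen_cospectral_def spectrum_mset_eq_iff)
  have "?h (char_poly (?B G)) = ?h (char_poly (?B H))"
    using c by (simp add: gen_cospectral_def spectrum_mset_eq_iff char_poly_complement[OF G] char_poly_complement[OF H])
  \<comment> \<open>The substitution t -> -1 - t is an involution, so a second application removes
    it.\<close>
  then have "?h (?h (char_poly (?B G))) = ?h (?h (char_poly (?B H)))" by simp
  then have "char_poly (?B G) = char_poly (?B H)"
    unfolding pcompose_assoc[symmetric] using pcompose_idR[of "char_poly (?B G)"] pcompose_idR[of "char_poly (?B H)"] by simp
  then show n: "num_poly (char_poly (adj_mat n G)) (mom (adj_mat n G) (ones_vec n) (ones_vec n)) =
     num_poly (char_poly (adj_mat n H)) (mom (adj_mat n H) (ones_vec n) (ones_vec n))"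
    unfolding char_poly_add_smult_ones[OF adj_mat_carrier] using eq by simp
  show "char_poly (adj_mat n G + ones_mat n) = char_poly (adj_mat n H + ones_mat n)"
    using eq n by (simp add: char_poly_add_ones)
qed

text \<open>The numerator of the k-fold shifted sequence is the remainder of t^k times the original
  numerator modulo \<chi>. Remainders by a monic polynomial are unique, and the coefficient of
  t^(n-1) is the k-th moment.\<close>

lemma mom_eqI:
  fixes A B :: "int mat"
  assumes A: "A \<in> carrier_mat n n" and B: "B \<in> carrier_mat n n" and n: "n > 0"
    and x: "x \<in> carrier_vec n" "y \<in> carrier_vec n" "x' \<in> carrier_vec n" "y' \<in> carrier_vec n"
    and eq: "char_poly A = char_poly B" "num_poly (char_poly A) (mom A y x) = num_poly (char_poly B) (mom B y' x')"
  shows "mom A y x k = mom B y' x' k"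
proof -
  let ?\<chi> = "char_poly A" and ?f = "monom 1 k :: int poly"
  have \<chi>: "degree ?\<chi> = n" "monic ?\<chi>" using degree_monic_char_poly[OF A] by auto
  define m where "m = (\<lambda>l. mom A y x (k + l))"
  define m' where "m' = (\<lambda>l. mom B y' x' (k + l))"
  have sh: "(\<lambda>l. \<Sum>j\<le>degree ?f. coeff ?f j * \<mu> (j + l)) = (\<lambda>l. \<mu> (k + l))" for \<mu> :: "nat \<Rightarrow> int"
  proof
    fix l
    have "(\<Sum>j\<le>degree ?f. coeff ?f j * \<mu> (j + l)) = (\<Sum>j\<le>k. if j = k then \<mu> (k + l) else 0)"
      by (intro sum.cong) (auto simp: degree_monom_eq)
    then show "(\<Sum>j\<le>degree ?f. coeff ?f j * \<mu> (j + l)) = \<mu> (k + l)" by simp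
  qed
  obtain g where g: "?f * num_poly ?\<chi> (mom A y x) = ?\<chi> * g + num_poly ?\<chi> m"
    using num_poly_mult[OF mom_recurrence[OF A x(1,2)], of ?f] unfolding sh m_def by blast
  obtain g' where g': "?f * num_poly ?\<chi> (mom B y' x') = ?\<chi> * g' + num_poly ?\<chi> m'"
    using num_poly_mult[OF mom_recurrence[OF B x(3,4)], of ?f] unfolding sh m'_def eq(1) by blast
  have e: "?\<chi> * (g - g') = num_poly ?\<chi> m' - num_poly ?\<chi> m"
    using g g' eq by (simp add: algebra_simps)
  have "g - g' = 0"
  proof (rule ccontr)
    assume "g - g' \<noteq> 0"
    then have "n \<le> degree (?\<chi> * (g - g'))" using \<chi> by (subst degree_mult_eq) auto
    moreover have "degree (num_poly ?\<chi> m' - num_poly ?\<chi> m) < n"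
      using degree_num_poly[of ?\<chi> m] degree_num_poly[of ?\<chi> m'] \<chi>(1) n by (intro degree_diff_less) auto
    ultimately show False by (simp add: e)
  qed
  then have "num_poly ?\<chi> m' = num_poly ?\<chi> m" using e by simp
  then have "coeff (num_poly ?\<chi> m') (n - 1) = coeff (num_poly ?\<chi> m) (n - 1)" by simp
  then show ?thesis using \<chi> n by (simp add: coeff_num_poly m_def m'_def)
qed

abbreviation rat_mat :: "int mat \<Rightarrow> rat mat" where "rat_mat \<equiv> map_mat rat_of_int"

text \<open>The matrix \<open>R\<close> is the transpose of the paper's \<open>Q\<close>.\<close>
definition orth_conj :: "nat \<Rightarrow> nat set set \<Rightarrow> nat set set \<Rightarrow> rat mat \<Rightarrow> bool" where
  "orth_conj n G H R \<longleftrightarrow> R \<in> carrier_mat n n \<and> R * transpose_mat R = 1\<^sub>m n \<and> transpose_mat R * R = 1\<^sub>m n \<and>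
     R *\<^sub>v map_vec rat_of_int (ones_vec n) = map_vec rat_of_int (ones_vec n) \<and>
     R * rat_mat (adj_mat n G) = rat_mat (adj_mat n H) * R"

lemma rat_ones_vec [simp]: "map_vec rat_of_int (ones_vec n) = vec n (\<lambda>_. 1)"
  by (auto simp: ones_vec_def)

lemma invertible_rat_mat:
  assumes W: "W \<in> carrier_mat n n" and "det W \<noteq> 0"
  obtains V :: "rat mat" where "V \<in> carrier_mat n n" "rat_mat W * V = 1\<^sub>m n" "V * rat_mat W = 1\<^sub>m n"
proof -
  have d: "det (rat_mat W) \<noteq> 0" using assms by simp
  have rW: "rat_mat W \<in> carrier_mat n n" using W by simp
  note a = Determinant.adj_mat[OF rW]
  show ?thesis
  proof
    let ?V = "inverse (det (rat_mat W)) \<cdot>\<^sub>m Determinant.adj_mat (rat_mat W)"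
    show "?V \<in> carrier_mat n n" using a(1) by simp
    show "rat_mat W * ?V = 1\<^sub>m n" "?V * rat_mat W = 1\<^sub>m n"
      unfolding mult_smult_distrib[OF rW a(1)] mult_smult_assoc_mat[OF a(1) rW] a(2,3)
      using d by (auto intro!: eq_matI)
  qed
qed

lemma gram_inverse:
  fixes X W V :: "'a :: comm_ring_1 mat"
  assumes X: "X \<in> carrier_mat n n" and W: "W \<in> carrier_mat n n" and V: "V \<in> carrier_mat n n"
    and gram: "transpose_mat X * X = transpose_mat W * W" and WV: "W * V = 1\<^sub>m n"
  shows "transpose_mat (X * V) * (X * V) = 1\<^sub>m n"
proof -
  have "transpose_mat (X * V) * (X * V) = transpose_mat V * (transpose_mat X * X) * V"
    unfolding transpose_mult[OF X V] using X V by (simp add: assoc_mult_mat[of _ n n _ n _ n])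
  also have "\<dots> = (transpose_mat V * transpose_mat W) * (W * V)"
    unfolding gram using W V by (simp add: assoc_mult_mat[of _ n n _ n _ n])
  also have "\<dots> = 1\<^sub>m n"
    unfolding transpose_mult[OF W V, symmetric] WV by simp
  finally show ?thesis .
qed

lemma orth_conj_exists:
  assumes G: "simple_graph n G" and H: "simple_graph n H" and n: "n > 0" and c: "controllable n G"
    and cosp: "gen_cospectral n G H"
  shows "\<exists>R. orth_conj n G H R"
proof -
  let ?A = "adj_mat n G" and ?B = "adj_mat n H" and ?e = "ones_vec n"
  let ?W = "rat_mat (walk_mat n G)" and ?X = "rat_mat (walk_mat n H)" and ?C = "companion_mat n (char_poly ?A)"
  note eq = gen_cospectral_char_poly[OF G H cosp]
  have W: "?W \<in> carrier_mat n n" and X: "?X \<in> carrier_mat n n" by simp_all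
  have C: "?C \<in> carrier_mat n n" "rat_mat ?C \<in> carrier_mat n n" by (simp_all add: companion_mat_def)
  have rA: "rat_mat ?A \<in> carrier_mat n n" and rB: "rat_mat ?B \<in> carrier_mat n n" by simp_all
  obtain V where V: "V \<in> carrier_mat n n" "?W * V = 1\<^sub>m n" "V * ?W = 1\<^sub>m n"
    using invertible_rat_mat[OF walk_mat_carrier det_walk_mat[OF c]] by blast
  define R where "R = ?X * V"
  have R: "R \<in> carrier_mat n n" unfolding R_def by (rule mult_carrier_mat[OF X V(1)])
  have RW: "R * ?W = ?X"
    using assoc_mult_mat[OF X V(1) W] V(3) X by (simp add: R_def)
  have gram: "transpose_mat (walk_mat n H) * walk_mat n H = transpose_mat (walk_mat n G) * walk_mat n G"
    by (intro eq_matI) (simp_all add: gram_walk_mat mom_eqI[OF adj_mat_carrier adj_mat_carrier n _ _ _ _ eq(1,2)]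
      carrier_matD[OF walk_mat_carrier] del: index_mult_mat(1))
  have rgram: "transpose_mat ?X * ?X = transpose_mat ?W * ?W"
    using arg_cong[OF gram, of rat_mat] by (simp add: of_int_hom.mat_hom_mult[of _ n n _ n] map_mat_transpose)
  have RR: "transpose_mat R * R = 1\<^sub>m n"
    unfolding R_def by (rule gram_inverse[OF X W V(1) rgram V(2)])
  then have RR': "R * transpose_mat R = 1\<^sub>m n" using R mat_mult_left_right_inverse[of "transpose_mat R" n R] by simp
  have AW: "rat_mat ?A * ?W = ?W * rat_mat ?C"
    using arg_cong[OF adj_mat_mult_walk_mat[of n G], of rat_mat] C(1)
    by (simp add: of_int_hom.mat_hom_mult[of _ n n _ n])
  have BX: "rat_mat ?B * ?X = ?X * rat_mat ?C"
    using arg_cong[OF adj_mat_mult_walk_mat[of n H], of rat_mat] C(1)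
    by (simp add: of_int_hom.mat_hom_mult[of _ n n _ n] eq(1))
  have "R * rat_mat ?A * ?W = R * (?W * rat_mat ?C)" using assoc_mult_mat[OF R rA W] AW by simp
  also have "\<dots> = ?X * rat_mat ?C" using assoc_mult_mat[OF R W C(2)] RW by simp
  also have "\<dots> = rat_mat ?B * R * ?W" using BX assoc_mult_mat[OF rB R W] RW by simp
  finally have "R * rat_mat ?A * ?W * V = rat_mat ?B * R * ?W * V" by simp
  then have RA: "R * rat_mat ?A = rat_mat ?B * R"
    using assoc_mult_mat[OF mult_carrier_mat[OF R rA] W V(1)] assoc_mult_mat[OF mult_carrier_mat[OF rB R] W V(1)]
      V(2) right_mult_one_mat[OF mult_carrier_mat[OF R rA]] right_mult_one_mat[OF mult_carrier_mat[OF rB R]] by simp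
  \<comment> \<open>The first column of every walk matrix is e, so \<open>R * W(G) = W(H)\<close>
    contains the condition R e = e.\<close>
  have c0: "col (rat_mat (walk_mat n K)) 0 = vec n (\<lambda>_. 1)" for K
    using n by (intro eq_vecI) (auto simp: walk_mat_index krylov_def ones_vec_def carrier_matD[OF walk_mat_carrier] carrier_matD[OF adj_mat_carrier])
  have "R *\<^sub>v col ?W 0 = col (R * ?W) 0" using col_mult2[OF R W n] by simp
  then have "R *\<^sub>v vec n (\<lambda>_. 1) = vec n (\<lambda>_. 1)" unfolding RW c0 .
  then show ?thesis using R RR RR' RA unfolding orth_conj_def by auto
qed

lemma orth_conj_krylov:
  assumes R: "orth_conj n G H R"
  shows "R *\<^sub>v map_vec rat_of_int (krylov n G j) = map_vec rat_of_int (krylov n H j)"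
proof (induction j)
  case 0
  have "krylov n K 0 = ones_vec n" for K by (simp add: krylov_def carrier_matD[OF adj_mat_carrier])
  then show ?case using R by (simp add: orth_conj_def)
next
  case (Suc j)
  have RC: "R \<in> carrier_mat n n" and RA: "R * rat_mat (adj_mat n G) = rat_mat (adj_mat n H) * R"
    using R by (auto simp: orth_conj_def)
  have step: "map_vec rat_of_int (krylov n K (Suc j)) = rat_mat (adj_mat n K) *\<^sub>v map_vec rat_of_int (krylov n K j)" for K
    using pow_mat_mult_vec_Suc[OF adj_mat_carrier ones_vec_carrier, of n K j] of_int_hom.mult_mat_vec_hom[OF adj_mat_carrier krylov_carrier]
    by (simp add: krylov_def del: pow_mat.simps)
  have "R *\<^sub>v map_vec rat_of_int (krylov n G (Suc j)) = R * rat_mat (adj_mat n G) *\<^sub>v map_vec rat_of_int (krylov n G j)"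
    unfolding step using RC by (intro assoc_mult_mat_vec[of _ n n _ n, symmetric]) auto
  also have "\<dots> = rat_mat (adj_mat n H) *\<^sub>v (R *\<^sub>v map_vec rat_of_int (krylov n G j))"
    unfolding RA using RC by (intro assoc_mult_mat_vec[of _ n n _ n]) auto
  finally show ?case unfolding Suc step .
qed

lemma orth_conj_walk_mat:
  assumes R: "orth_conj n G H R"
  shows "R * rat_mat (walk_mat n G) = rat_mat (walk_mat n H)"
proof (rule eq_matI)
  have RC: "R \<in> carrier_mat n n" using R by (simp add: orth_conj_def)
  fix i j assume "i < dim_row (rat_mat (walk_mat n H))" "j < dim_col (rat_mat (walk_mat n H))"
  then have ij: "i < n" "j < n" by (auto simp: carrier_matD[OF walk_mat_carrier])
  have col: "col (rat_mat (walk_mat n G)) j = map_vec rat_of_int (krylov n G j)"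
    using ij by (intro eq_vecI) (auto simp: walk_mat_index carrier_matD[OF walk_mat_carrier] carrier_vecD[OF krylov_carrier])
  have "(R * rat_mat (walk_mat n G)) $$ (i,j) = (R *\<^sub>v map_vec rat_of_int (krylov n G j)) $ i"
    using ij RC by (simp add: col carrier_matD[OF walk_mat_carrier])
  also have "\<dots> = rat_mat (walk_mat n H) $$ (i,j)"
    unfolding orth_conj_krylov[OF R] using ij by (simp add: walk_mat_index carrier_matD[OF walk_mat_carrier] carrier_vecD[OF krylov_carrier])
  finally show "(R * rat_mat (walk_mat n G)) $$ (i,j) = rat_mat (walk_mat n H) $$ (i,j)" .
qed (use R in \<open>auto simp: orth_conj_def carrier_matD[OF walk_mat_carrier]\<close>)

lemma orth_conj_unique:
  assumes c: "controllable n G" and R: "orth_conj n G H R" and R': "orth_conj n G H R'"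
  shows "R = R'"
proof -
  obtain V where V: "V \<in> carrier_mat n n" "rat_mat (walk_mat n G) * V = 1\<^sub>m n"
    using invertible_rat_mat[OF walk_mat_carrier det_walk_mat[OF c]] by blast
  have "S = rat_mat (walk_mat n H) * V" if S: "orth_conj n G H S" for S
  proof -
    have SC: "S \<in> carrier_mat n n" using S by (simp add: orth_conj_def)
    show ?thesis
      using assoc_mult_mat[OF SC _ V(1), of "rat_mat (walk_mat n G)"] V(2) SC orth_conj_walk_mat[OF S] by simp
  qed
  then show ?thesis using R R' by blast
qed

section \<open>The level\<close>

lemma rat_mat_smult: "rat_mat (c \<cdot>\<^sub>m X) = rat_of_int c \<cdot>\<^sub>m rat_mat X"
  by (intro eq_matI) auto

lemma char_poly_eq_of_conj:
  fixes A B :: "int mat"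
  assumes A: "A \<in> carrier_mat n n" and B: "B \<in> carrier_mat n n" and R: "R \<in> carrier_mat n n"
    and RR: "R * transpose_mat R = 1\<^sub>m n" "transpose_mat R * R = 1\<^sub>m n" and RA: "R * rat_mat A = rat_mat B * R"
  shows "char_poly A = char_poly B"
proof -
  have rB: "rat_mat B \<in> carrier_mat n n" and rA: "rat_mat A \<in> carrier_mat n n" and tR: "transpose_mat R \<in> carrier_mat n n"
    using A B R by simp_all
  have "R * rat_mat A * transpose_mat R = rat_mat B"
    unfolding RA using assoc_mult_mat[OF rB R tR] RR(1) right_mult_one_mat[OF rB] by simp
  then have "similar_mat (rat_mat B) (rat_mat A)"
    using RR rA rB R tR by (intro similar_matI[of _ _ R "transpose_mat R" n]) auto
  then have "char_poly (rat_mat B) = char_poly (rat_mat A)" by (rule char_poly_similar)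
  then have "map_poly rat_of_int (char_poly B) = map_poly rat_of_int (char_poly A)"
    using A B by (simp add: of_int_hom.char_poly_hom)
  then show ?thesis by simp
qed

text \<open>From R e = e and orthogonality also R^T e = e. Hence R commutes with J = e e^T and
  conjugates J - I - A(G) into J - I - A(H), which are the complements.\<close>

lemma orth_conj_gen_cospectral:
  assumes G: "simple_graph n G" and H: "simple_graph n H" and R: "orth_conj n G H R"
  shows "gen_cospectral n G H"
proof -
  let ?A = "adj_mat n G" and ?B = "adj_mat n H" and ?J = "rat_mat (ones_mat n)" and ?I = "1\<^sub>m n :: rat mat"
  have RC: "R \<in> carrier_mat n n" and RR: "R * transpose_mat R = 1\<^sub>m n" "transpose_mat R * R = 1\<^sub>m n"
    and Re: "R *\<^sub>v vec n (\<lambda>_. 1) = vec n (\<lambda>_. 1)" and RA: "R * rat_mat ?A = rat_mat ?B * R"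
    using R by (auto simp: orth_conj_def)
  have tR: "transpose_mat R \<in> carrier_mat n n" using RC by simp
  have tRe: "transpose_mat R *\<^sub>v vec n (\<lambda>_. 1) = vec n (\<lambda>_. 1)"
    using assoc_mult_mat_vec[OF tR RC, of "vec n (\<lambda>_. 1)"] Re RR(2) by simp
  have J: "?J \<in> carrier_mat n n" by (simp add: ones_mat_def)
  have RJ: "R * ?J = ?J * R"
  proof (rule eq_matI)
    fix i j assume "i < dim_row (?J * R)" "j < dim_col (?J * R)"
    then have ij: "i < n" "j < n" using RC by (auto simp: ones_mat_def)
    have "(R * ?J) $$ (i,j) = (R *\<^sub>v vec n (\<lambda>_. 1)) $ i"
      using ij RC by (auto simp: ones_mat_def scalar_prod_def)
    moreover have "(?J * R) $$ (i,j) = (transpose_mat R *\<^sub>v vec n (\<lambda>_. 1)) $ j"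
      using ij RC by (auto simp: ones_mat_def scalar_prod_def)
    ultimately show "(R * ?J) $$ (i,j) = (?J * R) $$ (i,j)" unfolding Re tRe using ij by simp
  qed (use RC J in \<open>auto simp: ones_mat_def\<close>)
  have rc: "rat_mat (adj_mat n (complement n K)) = ?J - ?I - rat_mat (adj_mat n K)" if "simple_graph n K" for K
    unfolding adj_mat_complement[OF that] by (intro eq_matI) (auto simp: ones_mat_def adj_mat_def)
  have rA: "rat_mat ?A \<in> carrier_mat n n" and rB: "rat_mat ?B \<in> carrier_mat n n" by simp_all
  have JI: "?J - ?I \<in> carrier_mat n n" by (rule minus_carrier_mat) simp
  have "R * (?J - ?I - rat_mat ?A) = R * ?J - R * ?I - R * rat_mat ?A"
    unfolding mult_minus_distrib_mat[OF RC JI rA] mult_minus_distrib_mat[OF RC J one_carrier_mat] ..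
  also have "\<dots> = (?J - ?I - rat_mat ?B) * R"
    unfolding minus_mult_distrib_mat[OF JI rB RC] minus_mult_distrib_mat[OF J one_carrier_mat RC] RJ RA
    using RC by simp
  finally have "R * rat_mat (adj_mat n (complement n G)) = rat_mat (adj_mat n (complement n H)) * R"
    by (simp only: rc[OF G] rc[OF H])
  then show ?thesis
    using char_poly_eq_of_conj[OF adj_mat_carrier adj_mat_carrier RC RR] RA
    by (simp add: gen_cospectral_def spectrum_mset_eq_iff)
qed

text \<open>The factorizations for G and H share the unitriangular and the diagonal factor because
  M_p agrees, and the diagonal factor is invertible over the rationals.\<close>

lemma orth_conj_walk_mat_p:
  assumes G: "simple_graph n G" and H: "simple_graph n H" and n: "n > 0" and p: "prime p" and R: "orth_conj n G H R"
  shows "R * rat_mat (walk_mat_p n G p) = rat_mat (walk_mat_p n H p)"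
proof -
  note cosp = gen_cospectral_char_poly[OF G H orth_conj_gen_cospectral[OF G H R]]
  have M: "M_poly n H p = M_poly n G p" using M_poly_cong[OF cosp(1,3)] by simp
  define f where "f = (\<lambda>j. if j < degree (M_poly n G p) then 1 else p)"
  let ?T = "shift_mat n (M_poly n G p)"
  have T: "?T \<in> carrier_mat n n" by (simp add: shift_mat_def)
  have RC: "R \<in> carrier_mat n n" using R by (simp add: orth_conj_def)
  note facG = walk_mat_p_factor[OF G n p, folded f_def] and facH = walk_mat_p_factor[OF H n p, unfolded M, folded f_def]
  have rG: "rat_mat (walk_mat_p n G p) * rat_mat (mat_diag n f) = rat_mat (walk_mat n G) * rat_mat ?T"
    using arg_cong[OF facG, of rat_mat] T by (simp add: of_int_hom.mat_hom_mult[of _ n n _ n])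
  have rH: "rat_mat (walk_mat_p n H p) * rat_mat (mat_diag n f) = rat_mat (walk_mat n H) * rat_mat ?T"
    using arg_cong[OF facH, of rat_mat] T by (simp add: of_int_hom.mat_hom_mult[of _ n n _ n])
  have D: "rat_mat (mat_diag n f) = mat_diag n (\<lambda>j. rat_of_int (f j))"
    by (intro eq_matI) (auto simp: mat_diag_def)
  have c: "rat_mat (walk_mat_p n K p) \<in> carrier_mat n n" "rat_mat (walk_mat n K) \<in> carrier_mat n n" for K by simp_all
  have rT: "rat_mat ?T \<in> carrier_mat n n" and rD: "rat_mat (mat_diag n f) \<in> carrier_mat n n" using T by simp_all
  let ?Z = "R * rat_mat (walk_mat_p n G p)"
  have Z: "?Z \<in> carrier_mat n n" by (rule mult_carrier_mat[OF RC c(1)])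
  have "?Z * rat_mat (mat_diag n f) = R * (rat_mat (walk_mat n G) * rat_mat ?T)"
    unfolding assoc_mult_mat[OF RC c(1) rD] rG ..
  also have "\<dots> = rat_mat (walk_mat_p n H p) * rat_mat (mat_diag n f)"
    unfolding assoc_mult_mat[OF RC c(2) rT, symmetric] orth_conj_walk_mat[OF R] rH ..
  finally have eq: "?Z * mat_diag n (\<lambda>j. rat_of_int (f j)) = rat_mat (walk_mat_p n H p) * mat_diag n (\<lambda>j. rat_of_int (f j))"
    unfolding D .
  show ?thesis
  proof (rule eq_matI)
    fix i j assume "i < dim_row (rat_mat (walk_mat_p n H p))" "j < dim_col (rat_mat (walk_mat_p n H p))"
    then have ij: "i < n" "j < n" by auto
    have "?Z $$ (i,j) * rat_of_int (f j) = rat_mat (walk_mat_p n H p) $$ (i,j) * rat_of_int (f j)"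
      using arg_cong[OF eq, of "\<lambda>N. N $$ (i,j)"] ij
      unfolding mat_diag_mult_right[OF Z] mat_diag_mult_right[OF c(1)] by (simp del: index_mult_mat(1) index_map_mat(1))
    moreover have "f j \<noteq> 0" using p by (auto simp: f_def)
    ultimately show "?Z $$ (i,j) = rat_mat (walk_mat_p n H p) $$ (i,j)" by simp
  qed (use Z in auto)
qed

lemma smult_eq_of_left_inverse:
  assumes R: "R \<in> carrier_mat n n" and W: "W \<in> carrier_mat n n" and det: "det W \<noteq> 0" and K: "K \<in> carrier_mat n n"
    and RW: "R * rat_mat W = rat_mat K" and N: "N \<in> carrier_mat n n" "N * W = d \<cdot>\<^sub>m 1\<^sub>m n"
  shows "rat_mat (K * N) = rat_of_int d \<cdot>\<^sub>m R"
proof -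
  obtain V where V: "V \<in> carrier_mat n n" "rat_mat W * V = 1\<^sub>m n"
    using invertible_rat_mat[OF W det] by blast
  have rN: "rat_mat N \<in> carrier_mat n n" and rW: "rat_mat W \<in> carrier_mat n n" and rK: "rat_mat K \<in> carrier_mat n n"
    using N W K by simp_all
  have "rat_mat N * rat_mat W = rat_of_int d \<cdot>\<^sub>m 1\<^sub>m n"
    using arg_cong[OF N(2), of rat_mat] N(1) W by (simp add: of_int_hom.mat_hom_mult[of _ n n _ n] rat_mat_smult of_int_hom.mat_hom_one)
  then have "rat_mat N * (rat_mat W * V) = (rat_of_int d \<cdot>\<^sub>m 1\<^sub>m n) * V"
    using assoc_mult_mat[OF rN rW V(1)] by simp
  then have NV: "rat_mat N = rat_of_int d \<cdot>\<^sub>m V"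
    using V rN by (simp add: mult_smult_assoc_mat[of _ n n _ n])
  have "rat_mat (K * N) = R * rat_mat W * (rat_of_int d \<cdot>\<^sub>m V)"
    using K N(1) by (simp add: of_int_hom.mat_hom_mult[of _ n n _ n] RW NV)
  also have "\<dots> = rat_of_int d \<cdot>\<^sub>m (R * (rat_mat W * V))"
    using mult_smult_distrib[OF mult_carrier_mat[OF R rW] V(1)] assoc_mult_mat[OF R rW V(1)] by simp
  finally show ?thesis using V(2) R by simp
qed

text \<open>These m form an ideal of the integers; its positive generator is the level of R.\<close>

definition integral_multiple :: "nat \<Rightarrow> rat mat \<Rightarrow> int \<Rightarrow> bool" where
  "integral_multiple n R m \<longleftrightarrow> (\<exists>X\<in>carrier_mat n n. rat_mat X = rat_of_int m \<cdot>\<^sub>m R)"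

lemma integral_multiple_mult:
  assumes "integral_multiple n R a" "R \<in> carrier_mat n n" shows "integral_multiple n R (a * b)"
proof -
  obtain X where "X \<in> carrier_mat n n" "rat_mat X = rat_of_int a \<cdot>\<^sub>m R" using assms by (auto simp: integral_multiple_def)
  then show ?thesis unfolding integral_multiple_def using assms
    by (intro bexI[of _ "b \<cdot>\<^sub>m X"]) (auto simp: rat_mat_smult intro!: eq_matI)
qed

lemma integral_multiple_diff:
  assumes "integral_multiple n R a" "integral_multiple n R b" "R \<in> carrier_mat n n" shows "integral_multiple n R (a - b)"
proof -
  obtain X Y where X: "X \<in> carrier_mat n n" "rat_mat X = rat_of_int a \<cdot>\<^sub>m R"
    and Y: "Y \<in> carrier_mat n n" "rat_mat Y = rat_of_int b \<cdot>\<^sub>m R"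
    using assms by (auto simp: integral_multiple_def)
  have "rat_mat (X - Y) = rat_of_int (a - b) \<cdot>\<^sub>m R"
  proof (rule eq_matI)
    fix i j assume "i < dim_row (rat_of_int (a - b) \<cdot>\<^sub>m R)" "j < dim_col (rat_of_int (a - b) \<cdot>\<^sub>m R)"
    then have ij: "i < n" "j < n" using assms by auto
    show "rat_mat (X - Y) $$ (i,j) = (rat_of_int (a - b) \<cdot>\<^sub>m R) $$ (i,j)"
      using arg_cong[OF X(2), of "\<lambda>M. M $$ (i,j)"] arg_cong[OF Y(2), of "\<lambda>M. M $$ (i,j)"] ij X(1) Y(1) assms(3)
      by (simp add: algebra_simps)
  qed (use X Y assms in auto)
  then show ?thesis unfolding integral_multiple_def using X Y by (intro bexI[of _ "X - Y"]) auto
qed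

lemma integral_multiple_least:
  assumes R: "R \<in> carrier_mat n n" and d: "integral_multiple n R d" "d > 0"
  obtains l where "l > 0" "integral_multiple n R l" "\<And>m. integral_multiple n R m \<Longrightarrow> l dvd m"
proof -
  define P where "P k \<longleftrightarrow> k > 0 \<and> integral_multiple n R (int k)" for k
  define l where "l = (LEAST k. P k)"
  have "P (nat d)" using d by (simp add: P_def)
  then have l: "P l" unfolding l_def by (rule LeastI)
  have min: "l \<le> k" if "P k" for k unfolding l_def using that by (rule Least_le)
  have "int l dvd m" if "integral_multiple n R m" for m
  proof -
    have "integral_multiple n R (int l)" using l by (simp add: P_def)
    then have "integral_multiple n R (m - int l * (m div int l))"
      by (rule integral_multiple_diff[OF that integral_multiple_mult[OF _ R] R])
    then have i: "integral_multiple n R (m mod int l)" by (simp add: minus_mult_div_eq_mod)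
    have "m mod int l = 0"
    proof (rule ccontr)
      assume "m mod int l \<noteq> 0"
      moreover have l0: "0 < int l" using l by (simp add: P_def)
      ultimately have "0 < m mod int l" using pos_mod_sign[OF l0, of m] by linarith
      then have "P (nat (m mod int l))" using i unfolding P_def by (simp only: zero_less_nat_eq nat_0_le less_imp_le)
      then have "l \<le> nat (m mod int l)" by (rule min)
      then show False using pos_mod_bound[OF l0, of m] \<open>0 < m mod int l\<close> by linarith
    qed
    then show ?thesis by auto
  qed
  moreover have "int l > 0" "integral_multiple n R (int l)" using l by (simp_all add: P_def)
  ultimately show ?thesis using that[of "int l"] by blast
qed

text \<open>The vector c is a nontrivial relation between all n columns, so an independent index set
  is a proper subset of the full one.\<close>

lemma rank_mod_less:
  assumes c: "c \<in> carrier_vec n" "i0 < n" "\<not> p dvd c $ i0" and M: "M \<in> carrier_mat n n"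
    and ker: "\<And>i. i < n \<Longrightarrow> p dvd (M *\<^sub>v c) $ i"
  shows "rank_mod p M < n"
proof -
  let ?C = "{card I | I. I \<subseteq> {..<dim_col M} \<and> cols_indep_mod p M I}"
  have sub: "?C \<subseteq> card ` Pow {..<n}" using M by auto
  then have fin: "finite ?C" by (rule finite_subset) simp
  have "cols_indep_mod p M {}" by (simp add: cols_indep_mod_def)
  then have ne: "?C \<noteq> {}" by blast
  have "x < n" if x: "x \<in> ?C" for x
  proof -
    have "dim_col M = n" using M by simp
    then obtain I where I: "x = card I" "I \<subseteq> {..<n}" "cols_indep_mod p M I" using x by blast
    have "I \<noteq> {..<n}"
    proof
      assume "I = {..<n}"
      moreover have "p dvd (\<Sum>j\<in>{..<n}. c $ j * M $$ (i,j))" if "i < dim_row M" for i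
        using ker[of i] that M c by (simp add: scalar_prod_def atLeast0LessThan mult.commute)
      ultimately have "p dvd c $ i0" using I(3) c(2) unfolding cols_indep_mod_def by blast
      then show False using c(3) by blast
    qed
    then show ?thesis using I psubset_card_mono[of "{..<n}" I] by auto
  qed
  then show ?thesis unfolding rank_mod_def using Max_in[OF fin ne] by blast
qed


text \<open>For a row q of l R the moment q^T A(G)^k q equals l^2 times a diagonal entry of A(H)^k,
  because R A(G)^k R^T = A(H)^k. The factor l^2 supplies the square of p.\<close>

lemma prime_dvd_graph_disc:
  assumes G: "simple_graph n G" and c: "controllable n G" and R: "orth_conj n G H R"
    and X: "X \<in> carrier_mat n n" "rat_mat X = rat_of_int l \<cdot>\<^sub>m R" and p: "prime p" "p dvd l"
    and i: "i < n" "j < n" "\<not> p dvd X $$ (i,j)"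
  shows "p\<^sup>2 dvd graph_disc n G"
proof -
  let ?A = "adj_mat n G"
  have RC: "R \<in> carrier_mat n n" and RR: "R * transpose_mat R = 1\<^sub>m n" and RA: "R * rat_mat ?A = rat_mat (adj_mat n H) * R"
    using R by (auto simp: orth_conj_def)
  have rA: "rat_mat (adj_mat n K) \<in> carrier_mat n n" "rat_mat (adj_mat n K ^\<^sub>m k) \<in> carrier_mat n n" for K k by simp_all
  have tR: "transpose_mat R \<in> carrier_mat n n" using RC by simp
  have rpow: "rat_mat (adj_mat n K ^\<^sub>m Suc k) = rat_mat (adj_mat n K ^\<^sub>m k) * rat_mat (adj_mat n K)" for K k
    by (simp add: of_int_hom.mat_hom_mult[of _ n n _ n])
  have RAk: "R * rat_mat (?A ^\<^sub>m k) = rat_mat (adj_mat n H ^\<^sub>m k) * R" for k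
  proof (induction k)
    case 0
    then show ?case using RC by (simp add: of_int_hom.mat_hom_one)
  next
    case (Suc k)
    have "R * rat_mat (?A ^\<^sub>m Suc k) = R * rat_mat (?A ^\<^sub>m k) * rat_mat ?A"
      unfolding rpow by (rule assoc_mult_mat[OF RC rA(2) rA(1), symmetric])
    also have "\<dots> = rat_mat (adj_mat n H ^\<^sub>m k) * (R * rat_mat ?A)"
      unfolding Suc by (rule assoc_mult_mat[OF rA(2) RC rA(1)])
    also have "\<dots> = rat_mat (adj_mat n H ^\<^sub>m Suc k) * R"
      unfolding RA rpow by (rule assoc_mult_mat[OF rA(2) rA(1) RC, symmetric])
    finally show ?case .
  qed
  have RAR: "R * rat_mat (?A ^\<^sub>m k) * transpose_mat R = rat_mat (adj_mat n H ^\<^sub>m k)" for k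
    unfolding RAk assoc_mult_mat[OF rA(2) RC tR] RR by (rule right_mult_one_mat[OF rA(2)])
  define q where "q = row X i"
  have q: "q \<in> carrier_vec n" using X(1) i by (auto simp: q_def)
  have mom: "mom ?A q q k = l\<^sup>2 * (adj_mat n H ^\<^sub>m k) $$ (i,i)" for k
  proof -
    have qc: "rat_of_int (q $ c) = rat_of_int l * R $$ (i,c)" if "c < n" for c
      using arg_cong[OF X(2), of "\<lambda>M. M $$ (i,c)"] that i RC X(1) by (simp add: q_def)
    have "rat_of_int (mom ?A q q k) = (\<Sum>a<n. \<Sum>b<n. (rat_of_int l)\<^sup>2 * (R $$ (i,a) * rat_of_int ((?A ^\<^sub>m k) $$ (a,b)) * R $$ (i,b)))"
      unfolding mom_alt[OF adj_mat_carrier q q] of_int_sum of_int_mult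
      by (intro sum.cong refl) (simp add: qc power2_eq_square mult_ac)
    also have "\<dots> = (rat_of_int l)\<^sup>2 * (R * rat_mat (?A ^\<^sub>m k) * transpose_mat R) $$ (i,i)"
    proof -
      have "(R * rat_mat (?A ^\<^sub>m k) * transpose_mat R) $$ (i,i) =
        (\<Sum>b<n. (R * rat_mat (?A ^\<^sub>m k)) $$ (i,b) * transpose_mat R $$ (b,i))"
        using i by (intro index_mult_mat_sum[OF mult_carrier_mat[OF RC rA(2)] tR])
      also have "\<dots> = (\<Sum>b<n. \<Sum>a<n. R $$ (i,a) * rat_of_int ((?A ^\<^sub>m k) $$ (a,b)) * R $$ (i,b))"
        using i RC carrier_matD[OF pow_carrier_mat[OF adj_mat_carrier[of n G], of k]]
        by (intro sum.cong refl) (simp add: index_mult_mat_sum[OF RC rA(2)] sum_distrib_right del: index_mult_mat(1))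
      finally show ?thesis by (subst sum.swap) (simp add: sum_distrib_left)
    qed
    also have "\<dots> = rat_of_int (l\<^sup>2 * (adj_mat n H ^\<^sub>m k) $$ (i,i))"
      unfolding RAR using i carrier_matD[OF pow_carrier_mat[OF adj_mat_carrier[of n H], of k]] by simp
    finally show ?thesis by (simp only: of_int_eq_iff)
  qed
  have "p\<^sup>2 dvd mom ?A q q k" for k
    unfolding mom using p(2) by (intro dvd_mult2 dvd_power_same)
  moreover have "\<not> p dvd q $ j" using i X(1) by (simp add: q_def)
  moreover have "det (mat_of_cols n (map (\<lambda>j. (?A ^\<^sub>m j) *\<^sub>v ones_vec n) [0..<n])) \<noteq> 0"
    using det_walk_mat[OF c] by (simp add: walk_mat_def)
  ultimately have "p\<^sup>2 dvd resultant (char_poly ?A) (pderiv (char_poly ?A))"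
    using q p(1) i(2) by (intro prime_square_dvd_resultant[OF adj_mat_carrier transpose_adj_mat ones_vec_carrier]) auto
  then show ?thesis by (simp add: graph_disc_def Let_def)
qed

text \<open>Over an infinite set the product defining \<open>level_bound\<close> would collapse to
  1. Apart from 2, all potential primes divide the last invariant factor of the walk matrix.\<close>

lemma finite_potential_primes:
  assumes c: "controllable n G" and n: "n > 0"
  shows "finite (potential_primes n G)"
proof (rule finite_subset)
  let ?d = "last_invariant_factor (walk_mat n G)"
  have "?d > 0" by (rule last_invariant_factor_props(1)[OF walk_mat_carrier n det_walk_mat[OF c]])
  then show "finite ({2} \<union> {p. p dvd ?d})" using finite_divisors_int[of ?d] by auto
  show "potential_primes n G \<subseteq> {2} \<union> {p. p dvd ?d}"
    by (auto simp: potential_primes_def candidate_primes_def)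
qed

lemma potential_primes_prime: "p \<in> potential_primes n G \<Longrightarrow> prime p"
  by (auto simp: potential_primes_def candidate_primes_def)

lemma level_bound_pos: "level_bound n G > 0"
  unfolding level_bound_def by (intro prod_pos) (auto dest!: potential_primes_prime prime_gt_0_int)

lemma prime_power_dvd_level_bound:
  assumes "controllable n G" "n > 0" "p \<in> potential_primes n G"
  shows "p ^ prime_exponent n G p dvd level_bound n G"
  unfolding level_bound_def using finite_potential_primes[OF assms(1,2)] assms(3) by (rule dvd_prodI)

text \<open>The exponents are compared prime by prime. The last invariant factor of
  \<open>walk_mat_p\<close> bounds the exponent of p in l; it remains to verify that a prime
  dividing l passes every test of \<open>potential_primes\<close>, so that it occurs in the
  product.\<close>

lemma level_dvd_level_bound:
  assumes G: "simple_graph n G" and H: "simple_graph n H" and n: "n > 0" and c: "controllable n G" and R: "orth_conj n G H R"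
    and l: "l > 0" "integral_multiple n R l" "\<And>m. integral_multiple n R m \<Longrightarrow> l dvd m"
  shows "l dvd level_bound n G"
proof (rule multiplicity_le_imp_dvd)
  have RC: "R \<in> carrier_mat n n" using R by (simp add: orth_conj_def)
  obtain X where X: "X \<in> carrier_mat n n" "rat_mat X = rat_of_int l \<cdot>\<^sub>m R" using l(2) by (auto simp: integral_multiple_def)
  have dvd: "l dvd last_invariant_factor W"
    if W: "W \<in> carrier_mat n n" "det W \<noteq> 0" and K: "K \<in> carrier_mat n n" "R * rat_mat W = rat_mat K" for W K
  proof -
    obtain N where N: "N \<in> carrier_mat n n" "N * W = last_invariant_factor W \<cdot>\<^sub>m 1\<^sub>m n"
      using last_invariant_factor_props(2)[OF W(1) n W(2)] by blast
    have "integral_multiple n R (last_invariant_factor W)"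
      unfolding integral_multiple_def using smult_eq_of_left_inverse[OF RC W K N] K(1) N(1)
      by (intro bexI[of _ "K * N"]) auto
    then show ?thesis by (rule l(3))
  qed
  note W = dvd[OF walk_mat_carrier det_walk_mat[OF c] walk_mat_carrier orth_conj_walk_mat[OF R]]
  show "l \<noteq> 0" using l(1) by simp
  fix p :: int assume p: "prime p"
  show "multiplicity p l \<le> multiplicity p (level_bound n G)"
  proof (cases "p dvd l")
    case False
    then show ?thesis by (simp add: not_dvd_imp_multiplicity_0)
  next
    case True
    let ?W = "walk_mat_p n G p"
    have lp: "l dvd last_invariant_factor ?W"
      by (rule dvd[OF walk_mat_p_carrier det_walk_mat_p[OF G n p c] walk_mat_p_carrier orth_conj_walk_mat_p[OF G H n p R]])
    have pos: "last_invariant_factor ?W > 0"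
      by (rule last_invariant_factor_props(1)[OF walk_mat_p_carrier n det_walk_mat_p[OF G n p c]])
    have le: "multiplicity p l \<le> prime_exponent n G p"
      unfolding prime_exponent_def using lp pos by (intro dvd_imp_multiplicity_le) auto
    have "1 \<le> multiplicity p l" using True p l(1) prime_gt_1_int[OF p] by (intro multiplicity_geI) auto
    have pd: "p dvd last_invariant_factor (walk_mat n G)" using W True dvd_trans by blast
    have "\<not> p dvd 1" using p not_prime_unit by blast
    then have rank: "rank_mod p (walk_mat n G) < n"
      using last_invariant_factor_props(3)[OF walk_mat_carrier n det_walk_mat[OF c] pd] rank_mod_less[OF _ _ _ walk_mat_carrier] by blast
    \<comment> \<open>If p divided all of \<open>X\<close>, then l / p would still make R integral,
      against the minimality of l.\<close>
    have ex: "\<exists>i<n. \<exists>j<n. \<not> p dvd X $$ (i,j)"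
    proof (rule ccontr)
      assume "\<not> ?thesis"
      then have all: "p dvd X $$ (i,j)" if "i < n" "j < n" for i j using that by blast
      obtain m where m: "l = p * m" using True by (auto simp: dvd_def)
      have "integral_multiple n R m"
        unfolding integral_multiple_def
      proof (intro bexI eq_matI)
        let ?Y = "mat n n (\<lambda>ij. X $$ ij div p)"
        fix i j assume "i < dim_row (rat_of_int m \<cdot>\<^sub>m R)" "j < dim_col (rat_of_int m \<cdot>\<^sub>m R)"
        then have ij: "i < n" "j < n" using RC by auto
        have "rat_of_int p * rat_of_int (X $$ (i,j) div p) = rat_of_int p * (rat_of_int m * R $$ (i,j))"
          using arg_cong[OF X(2), of "\<lambda>M. M $$ (i,j)"] ij X(1) RC all[OF ij] m
          by (simp flip: of_int_mult add: mult.assoc)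
        then show "rat_mat ?Y $$ (i,j) = (rat_of_int m \<cdot>\<^sub>m R) $$ (i,j)"
          using ij RC p by (auto simp del: of_int_mult)
      qed (use RC in auto)
      then have "l dvd m" by (rule l(3))
      then have "l \<le> m" using m l(1) p by (intro zdvd_imp_le) (auto simp: zero_less_mult_iff dest: prime_gt_0_int)
      moreover have "m > 0" using m l(1) prime_gt_0_int[OF p] by (simp add: zero_less_mult_iff)
      ultimately show False using m prime_gt_1_int[OF p] by (metis mult_less_cancel_right1 not_le)
    qed
    then have "p\<^sup>2 dvd graph_disc n G" using prime_dvd_graph_disc[OF G c R X p True] by blast
    \<comment> \<open>The prime 2 is a candidate without a discriminant condition; an odd p uses the
      square factor of the discriminant and the divisibility \<open>pd\<close>.\<close>
    then have "p \<in> candidate_primes n G"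
      using pd p prime_odd_int[OF p] prime_ge_2_int[OF p] unfolding candidate_primes_def
      by (cases "p = 2") (auto intro: dvd_trans[of p "p\<^sup>2"])
    then have pp: "p \<in> potential_primes n G"
      using rank le \<open>1 \<le> multiplicity p l\<close> by (simp add: potential_primes_def)
    have "prime_exponent n G p \<le> multiplicity p (level_bound n G)"
      using prime_power_dvd_level_bound[OF c n pp] level_bound_pos[of n G] prime_gt_1_int[OF p] by (intro multiplicity_geI) auto
    then show ?thesis using le by simp
  qed
qed

lemma level_bound_integral:
  assumes G: "simple_graph n G" and H: "simple_graph n H" and n: "n > 0" and c: "controllable n G" and R: "orth_conj n G H R"
  shows "integral_multiple n R (level_bound n G)"
proof -
  have RC: "R \<in> carrier_mat n n" using R by (simp add: orth_conj_def)
  let ?W = "walk_mat n G"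
  obtain N where N: "N \<in> carrier_mat n n" "N * ?W = last_invariant_factor ?W \<cdot>\<^sub>m 1\<^sub>m n"
    using last_invariant_factor_props(2)[OF walk_mat_carrier n det_walk_mat[OF c]] by blast
  have "integral_multiple n R (last_invariant_factor ?W)"
    unfolding integral_multiple_def
    using smult_eq_of_left_inverse[OF RC walk_mat_carrier det_walk_mat[OF c] walk_mat_carrier orth_conj_walk_mat[OF R] N] N(1)
    by (intro bexI[of _ "walk_mat n H * N"] mult_carrier_mat[OF walk_mat_carrier]) auto
  then obtain l where l: "l > 0" "integral_multiple n R l" "\<And>m. integral_multiple n R m \<Longrightarrow> l dvd m"
    using integral_multiple_least[OF RC _ last_invariant_factor_props(1)[OF walk_mat_carrier n det_walk_mat[OF c]]] by blast
  obtain k where "level_bound n G = l * k" using level_dvd_level_bound[OF G H n c R l] by (auto simp: dvd_def)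
  then show ?thesis using integral_multiple_mult[OF l(2) RC] by simp
qed

section \<open>Cliques\<close>

lemma isomorphic_refl: "isomorphic n G G"
  unfolding isomorphic_def by (intro exI[of _ id]) (auto simp: bij_betw_def)

lemma isomorphic_sym: assumes "isomorphic n G H" shows "isomorphic n H G"
proof -
  obtain f where f: "bij_betw f {..<n} {..<n}" and e: "\<And>u v. u < n \<Longrightarrow> v < n \<Longrightarrow> {u, v} \<in> G \<longleftrightarrow> {f u, f v} \<in> H"
    using assms by (auto simp: isomorphic_def)
  let ?g = "inv_into {..<n} f"
  have g: "bij_betw ?g {..<n} {..<n}" using f by (rule bij_betw_inv_into)
  have "{u, v} \<in> H \<longleftrightarrow> {?g u, ?g v} \<in> G" if "u < n" "v < n" for u v
    using e[of "?g u" "?g v"] that bij_betw_apply[OF g] bij_betw_inv_into_right[OF f] by auto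
  then show ?thesis using g by (auto simp: isomorphic_def)
qed

lemma isomorphic_trans: assumes "isomorphic n G H" "isomorphic n H K" shows "isomorphic n G K"
proof -
  obtain f g where f: "bij_betw f {..<n} {..<n}" "\<And>u v. u < n \<Longrightarrow> v < n \<Longrightarrow> {u, v} \<in> G \<longleftrightarrow> {f u, f v} \<in> H"
    and g: "bij_betw g {..<n} {..<n}" "\<And>u v. u < n \<Longrightarrow> v < n \<Longrightarrow> {u, v} \<in> H \<longleftrightarrow> {g u, g v} \<in> K"
    using assms by (auto simp: isomorphic_def)
  have "{u, v} \<in> G \<longleftrightarrow> {(g \<circ> f) u, (g \<circ> f) v} \<in> K" if "u < n" "v < n" for u v
    using f(2)[OF that] g(2)[of "f u" "f v"] bij_betw_apply[OF f(1)] that by auto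
  then show ?thesis using bij_betw_trans[OF f(1) g(1)] unfolding isomorphic_def by blast
qed

lemma iso_class_eq_iff:
  assumes "simple_graph n H" "simple_graph n H'"
  shows "iso_class n H = iso_class n H' \<longleftrightarrow> isomorphic n H H'"
proof
  assume "iso_class n H = iso_class n H'"
  then have "H' \<in> iso_class n H" using assms isomorphic_refl by (auto simp: iso_class_def)
  then show "isomorphic n H H'" by (simp add: iso_class_def)
next
  assume "isomorphic n H H'"
  then show "iso_class n H = iso_class n H'"
    unfolding iso_class_def using isomorphic_sym isomorphic_trans by blast
qed

lemma simple_graph_eqI:
  assumes "simple_graph n G" "simple_graph n H" "adj_mat n G = adj_mat n H" shows "G = H"
proof -
  have "{i,j} \<in> G \<longleftrightarrow> {i,j} \<in> H" if "i < n" "j < n" for i j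
    using arg_cong[OF assms(3), of "\<lambda>M. M $$ (i,j)"] that by (simp add: adj_mat_def split: if_splits)
  then have "G \<inter> all_edges n = H \<inter> all_edges n" by (auto simp: all_edges_def)
  then show ?thesis using assms by (auto simp: simple_graph_def)
qed

lemma index_conj_mat:
  fixes X :: "'a :: comm_ring_1 mat"
  assumes X: "X \<in> carrier_mat n n" and A: "A \<in> carrier_mat n n" and "i < n" "j < n"
  shows "(X * (A * transpose_mat X)) $$ (i,j) = row X i \<bullet> (A *\<^sub>v row X j)"
proof -
  have "col (A * transpose_mat X) j = A *\<^sub>v row X j"
    using col_mult2[OF A, of "transpose_mat X" n j] assms by (simp only: transpose_carrier_mat col_transpose carrier_matD)
  then show ?thesis using assms by simp
qed

text \<open>\<open>orth_conj\<close> for X / l with the denominators cleared and stated row by row: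
  with l = L these are the equations for the vertices and edges of a clique in \<Omega>(G).\<close>

definition int_orth_conj :: "nat \<Rightarrow> nat set set \<Rightarrow> nat set set \<Rightarrow> int \<Rightarrow> int mat \<Rightarrow> bool" where
  "int_orth_conj n G H l X \<longleftrightarrow> X \<in> carrier_mat n n \<and> (\<forall>i<n. \<forall>j<n. row X i \<bullet> row X j = (if i = j then l\<^sup>2 else 0)) \<and>
     (\<forall>i<n. ones_vec n \<bullet> row X i = l) \<and>
     (\<forall>i<n. \<forall>j<n. row X i \<bullet> (adj_mat n G *\<^sub>v row X j) = l\<^sup>2 * adj_mat n H $$ (i,j))"

lemma orth_conj_iff_int:
  assumes X: "X \<in> carrier_mat n n" and R: "R \<in> carrier_mat n n" and XR: "rat_mat X = rat_of_int l \<cdot>\<^sub>m R" and l: "l \<noteq> 0"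
  shows "orth_conj n G H R \<longleftrightarrow> int_orth_conj n G H l X"
proof -
  let ?A = "adj_mat n G" and ?B = "adj_mat n H" and ?l = "rat_of_int l"
  have rA: "rat_mat ?A \<in> carrier_mat n n" and rB: "rat_mat ?B \<in> carrier_mat n n" and tR: "transpose_mat R \<in> carrier_mat n n"
    using R by simp_all
  have ent: "rat_of_int (X $$ (i,j)) = ?l * R $$ (i,j)" if "i < n" "j < n" for i j
    using arg_cong[OF XR, of "\<lambda>M. M $$ (i,j)"] that X R by simp
  have 1: "(R * transpose_mat R) $$ (i,j) = (1\<^sub>m n) $$ (i,j) \<longleftrightarrow> row X i \<bullet> row X j = (if i = j then l\<^sup>2 else 0)"
    if ij: "i < n" "j < n" for i j
  proof -
    have "rat_of_int (row X i \<bullet> row X j) = ?l\<^sup>2 * (R * transpose_mat R) $$ (i,j)"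
      using ij X R by (simp add: scalar_prod_def ent power2_eq_square sum_distrib_left mult_ac)
    moreover have "row X i \<bullet> row X j = (if i = j then l\<^sup>2 else 0) \<longleftrightarrow>
       rat_of_int (row X i \<bullet> row X j) = rat_of_int (if i = j then l\<^sup>2 else 0)" by (simp only: of_int_eq_iff)
    ultimately show ?thesis using l ij by simp
  qed
  have 2: "(R *\<^sub>v vec n (\<lambda>_. 1)) $ i = vec n (\<lambda>_. 1) $ i \<longleftrightarrow> ones_vec n \<bullet> row X i = l" if i: "i < n" for i
  proof -
    have "rat_of_int (ones_vec n \<bullet> row X i) = ?l * (R *\<^sub>v vec n (\<lambda>_. 1)) $ i"
      using i X R by (simp add: scalar_prod_def ent ones_vec_def sum_distrib_left)
    moreover have "ones_vec n \<bullet> row X i = l \<longleftrightarrow> rat_of_int (ones_vec n \<bullet> row X i) = ?l" by (simp only: of_int_eq_iff)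
    ultimately show ?thesis using l i by simp
  qed
  have 3: "(R * (rat_mat ?A * transpose_mat R)) $$ (i,j) = rat_mat ?B $$ (i,j) \<longleftrightarrow>
      row X i \<bullet> (?A *\<^sub>v row X j) = l\<^sup>2 * ?B $$ (i,j)" if ij: "i < n" "j < n" for i j
  proof -
    have "rat_of_int (row X i \<bullet> (?A *\<^sub>v row X j)) = ?l\<^sup>2 * (row R i \<bullet> (rat_mat ?A *\<^sub>v row R j))"
      using ij X R by (simp add: scalar_prod_def ent power2_eq_square sum_distrib_left mult_ac)
    moreover have "row X i \<bullet> (?A *\<^sub>v row X j) = l\<^sup>2 * ?B $$ (i,j) \<longleftrightarrow>
      rat_of_int (row X i \<bullet> (?A *\<^sub>v row X j)) = rat_of_int (l\<^sup>2 * ?B $$ (i,j))" by (simp only: of_int_eq_iff)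
    ultimately show ?thesis using l ij index_conj_mat[OF R rA ij] by (simp del: index_mult_mat(1))
  qed
  have e1: "R * transpose_mat R = 1\<^sub>m n \<longleftrightarrow> (\<forall>i<n. \<forall>j<n. (R * transpose_mat R) $$ (i,j) = (1\<^sub>m n) $$ (i,j))"
    using R by (auto simp del: index_mult_mat(1) index_one_mat(1) intro!: eq_matI)
  have e2: "R *\<^sub>v vec n (\<lambda>_. 1) = vec n (\<lambda>_. 1) \<longleftrightarrow> (\<forall>i<n. (R *\<^sub>v vec n (\<lambda>_. 1)) $ i = vec n (\<lambda>_. 1) $ i)"
    using R by (auto simp del: index_mult_mat_vec index_vec intro!: eq_vecI)
  have e3: "R * (rat_mat ?A * transpose_mat R) = rat_mat ?B \<longleftrightarrow>
      (\<forall>i<n. \<forall>j<n. (R * (rat_mat ?A * transpose_mat R)) $$ (i,j) = rat_mat ?B $$ (i,j))"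
    using R by (auto simp del: index_mult_mat(1) index_map_mat(1) intro!: eq_matI)
  have e4: "R * rat_mat ?A = rat_mat ?B * R \<longleftrightarrow> R * (rat_mat ?A * transpose_mat R) = rat_mat ?B"
    if o: "R * transpose_mat R = 1\<^sub>m n" "transpose_mat R * R = 1\<^sub>m n"
  proof
    assume "R * rat_mat ?A = rat_mat ?B * R"
    then show "R * (rat_mat ?A * transpose_mat R) = rat_mat ?B"
      using assoc_mult_mat[OF R rA tR] assoc_mult_mat[OF rB R tR] o(1) right_mult_one_mat[OF rB] by simp
  next
    assume a: "R * (rat_mat ?A * transpose_mat R) = rat_mat ?B"
    have "rat_mat ?B * R = R * (rat_mat ?A * (transpose_mat R * R))"
      unfolding a[symmetric] assoc_mult_mat[OF R mult_carrier_mat[OF rA tR] R] assoc_mult_mat[OF rA tR R] ..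
    then show "R * rat_mat ?A = rat_mat ?B * R" using o(2) right_mult_one_mat[OF rA] by simp
  qed
  have e5: "R * transpose_mat R = 1\<^sub>m n \<Longrightarrow> transpose_mat R * R = 1\<^sub>m n"
    using mat_mult_left_right_inverse[OF R tR] .
  have "orth_conj n G H R \<longleftrightarrow> R * transpose_mat R = 1\<^sub>m n \<and> R *\<^sub>v vec n (\<lambda>_. 1) = vec n (\<lambda>_. 1) \<and>
     R * (rat_mat ?A * transpose_mat R) = rat_mat ?B"
    unfolding orth_conj_def rat_ones_vec using R e4 e5 by blast
  also have "\<dots> \<longleftrightarrow> int_orth_conj n G H l X"
    unfolding e1 e2 e3 int_orth_conj_def using 1 2 3 X by auto
  finally show ?thesis .
qed

text \<open>For a clique the values tested here are 0 or L^2, so being nonzero singles out the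
  entries 1 of Q^T A(G) Q.\<close>

definition clique_graph :: "nat \<Rightarrow> nat set set \<Rightarrow> int vec list \<Rightarrow> nat set set" where
  "clique_graph n G \<xi>s = {{i, j} | i j. i < n \<and> j < n \<and> i \<noteq> j \<and> \<xi>s ! i \<bullet> (adj_mat n G *\<^sub>v \<xi>s ! j) \<noteq> 0}"

lemma simple_graph_clique_graph: "simple_graph n (clique_graph n G \<xi>s)"
  by (auto simp: simple_graph_def clique_graph_def all_edges_def)

lemma omega_vertsD:
  assumes "x \<in> omega_verts n G"
  shows "x \<in> carrier_vec n" "x \<bullet> x = (level_bound n G)\<^sup>2" "ones_vec n \<bullet> x = level_bound n G"
    "x \<bullet> (adj_mat n G *\<^sub>v x) = 0"
  using assms by (auto simp: omega_verts_def Let_def)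

lemma clique_graph_edge_iff:
  assumes "set \<xi>s \<subseteq> carrier_vec n" "length \<xi>s = n" "i < n" "j < n"
  shows "{i, j} \<in> clique_graph n G \<xi>s \<longleftrightarrow> i \<noteq> j \<and> \<xi>s ! i \<bullet> (adj_mat n G *\<^sub>v \<xi>s ! j) \<noteq> 0"
proof -
  have "\<xi>s ! i \<in> carrier_vec n" "\<xi>s ! j \<in> carrier_vec n" using assms by (auto simp: set_conv_nth)
  then have "\<xi>s ! i \<bullet> (adj_mat n G *\<^sub>v \<xi>s ! j) = \<xi>s ! j \<bullet> (adj_mat n G *\<^sub>v \<xi>s ! i)"
    by (intro sym_mat_scalar_prod[OF adj_mat_carrier transpose_adj_mat])
  then show ?thesis using assms by (auto simp: clique_graph_def doubleton_eq_iff)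
qed

lemma clique_int_orth_conj:
  assumes K: "omega_clique n G (set \<xi>s)" and d: "distinct \<xi>s" and len: "length \<xi>s = n"
  shows "int_orth_conj n G (clique_graph n G \<xi>s) (level_bound n G) (mat_of_rows n \<xi>s)"
proof -
  let ?L = "level_bound n G" and ?A = "adj_mat n G" and ?X = "mat_of_rows n \<xi>s"
  have V: "\<xi>s ! i \<in> omega_verts n G" if "i < n" for i using K that len by (auto simp: omega_clique_def)
  have carr: "set \<xi>s \<subseteq> carrier_vec n" using K omega_vertsD(1) by (auto simp: omega_clique_def)
  have row: "row ?X i = \<xi>s ! i" if "i < n" for i using that len omega_vertsD(1)[OF V[OF that]] by simp
  have adj: "omega_adj n G (\<xi>s ! i) (\<xi>s ! j)" if "i < n" "j < n" "i \<noteq> j" for i j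
    using K that len d by (auto simp: omega_clique_def nth_eq_iff_index_eq)
  have "\<xi>s ! i \<bullet> (?A *\<^sub>v \<xi>s ! j) = ?L\<^sup>2 * adj_mat n (clique_graph n G \<xi>s) $$ (i,j)" if "i < n" "j < n" for i j
    using that adj[OF that] omega_vertsD(4)[OF V[OF that(1)]] clique_graph_edge_iff[OF carr len that]
    by (cases "i = j") (auto simp: omega_adj_def adj_mat_def)
  moreover have "\<xi>s ! i \<bullet> \<xi>s ! j = (if i = j then ?L\<^sup>2 else 0)" if "i < n" "j < n" for i j
    using adj[OF that] omega_vertsD(2)[OF V[OF that(1)]] by (auto simp: omega_adj_def)
  moreover have "ones_vec n \<bullet> \<xi>s ! i = ?L" if "i < n" for i using omega_vertsD(3)[OF V[OF that]] .
  moreover have "?X \<in> carrier_mat n n" using mat_of_rows_carrier(1)[of n \<xi>s] len by simp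
  ultimately show ?thesis unfolding int_orth_conj_def by (simp add: row)
qed

lemma int_orth_conj_clique:
  assumes G: "simple_graph n G" and H: "simple_graph n H" and n: "n > 0" and c: "controllable n G"
    and X: "int_orth_conj n G H (level_bound n G) X" and XR: "rat_mat X = rat_of_int (level_bound n G) \<cdot>\<^sub>m R" and R: "orth_conj n G H R"
  defines "\<xi>s \<equiv> map (row X) [0..<n]"
  shows "omega_clique n G (set \<xi>s)" "distinct \<xi>s" "length \<xi>s = n" "clique_graph n G \<xi>s = H"
proof -
  let ?L = "level_bound n G" and ?A = "adj_mat n G"
  have L: "?L > 0" by (rule level_bound_pos)
  have XC: "X \<in> carrier_mat n n" and o: "\<And>i j. i < n \<Longrightarrow> j < n \<Longrightarrow> row X i \<bullet> row X j = (if i = j then ?L\<^sup>2 else 0)"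
    and e: "\<And>i. i < n \<Longrightarrow> ones_vec n \<bullet> row X i = ?L"
    and a: "\<And>i j. i < n \<Longrightarrow> j < n \<Longrightarrow> row X i \<bullet> (?A *\<^sub>v row X j) = ?L\<^sup>2 * adj_mat n H $$ (i,j)"
    using X by (auto simp: int_orth_conj_def)
  have RC: "R \<in> carrier_mat n n" using R by (simp add: orth_conj_def)
  show len: "length \<xi>s = n" by (simp add: \<xi>s_def)
  have nth: "\<xi>s ! i = row X i" if "i < n" for i using that by (simp add: \<xi>s_def)
  have inj: "i = j" if "i < n" "j < n" "row X i = row X j" for i j
    using o[OF that(1,1)] o[OF that(1,2)] that(3) L by (auto split: if_splits)
  then show "distinct \<xi>s" by (auto simp: distinct_conv_nth nth len)
  have A01: "adj_mat n H $$ (i,j) \<in> {0,1}" if "i < n" "j < n" for i j using that by (simp add: adj_mat_def)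
  have vert: "row X i \<in> omega_verts n G" if i: "i < n" for i
  proof -
    have "p ^ prime_exponent n G p dvd (transpose_mat (walk_mat_p n G p) *\<^sub>v row X i) $ j"
      if p: "p \<in> potential_primes n G" and j: "j < n" for p j
    proof -
      \<comment> \<open>The transposed product is row i of
        \<open>X * W^(p)(G) = L * W^(p)(H)\<close>, hence divisible by L and by the prime power
        inside L.\<close>
      let ?W = "walk_mat_p n G p"
      have "rat_of_int ((transpose_mat ?W *\<^sub>v row X i) $ j) = (rat_mat X * rat_mat ?W) $$ (i,j)"
        using i j XC by (simp add: scalar_prod_def mult.commute)
      also have "\<dots> = rat_of_int ?L * (R * rat_mat ?W) $$ (i,j)"
        unfolding XR using i j RC by (subst mult_smult_assoc_mat[of _ n n _ n]) (auto simp del: index_mult_mat(1))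
      also have "R * rat_mat ?W = rat_mat (walk_mat_p n H p)"
        by (rule orth_conj_walk_mat_p[OF G H n potential_primes_prime[OF p] R])
      finally have "rat_of_int ((transpose_mat ?W *\<^sub>v row X i) $ j) = rat_of_int (?L * walk_mat_p n H p $$ (i,j))"
        using i j by simp
      then have "(transpose_mat ?W *\<^sub>v row X i) $ j = ?L * walk_mat_p n H p $$ (i,j)" by (simp only: of_int_eq_iff)
      then show ?thesis using prime_power_dvd_level_bound[OF c n p] by simp
    qed
    then show ?thesis
      using i XC o[OF i i] e[OF i] a[OF i i] adj_mat_diag[OF H i] by (simp add: omega_verts_def Let_def del: index_mult_mat_vec)
  qed
  have "omega_adj n G (row X i) (row X j)" if "i < n" "j < n" "i \<noteq> j" for i j
    using o[OF that(1,2)] a[OF that(1,2)] A01[OF that(1,2)] that(3) by (auto simp: omega_adj_def)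
  then show "omega_clique n G (set \<xi>s)" using vert unfolding omega_clique_def \<xi>s_def by (force simp: image_iff)
  have carr: "set \<xi>s \<subseteq> carrier_vec n" using XC by (auto simp: \<xi>s_def)
  have "adj_mat n (clique_graph n G \<xi>s) = adj_mat n H"
  proof (rule eq_matI)
    fix i j assume "i < dim_row (adj_mat n H)" "j < dim_col (adj_mat n H)"
    then have ij: "i < n" "j < n" by auto
    show "adj_mat n (clique_graph n G \<xi>s) $$ (i,j) = adj_mat n H $$ (i,j)"
      using clique_graph_edge_iff[OF carr len ij, of G] a[OF ij] A01[OF ij] L adj_mat_diag[OF H ij(1)] ij
      by (auto simp: nth adj_mat_def)
  qed auto
  then show "clique_graph n G \<xi>s = H" by (rule simple_graph_eqI[OF simple_graph_clique_graph H])
qed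

text \<open>Among n + 1 pairwise orthogonal vectors of length L the first n form a nonsingular
  matrix Y, and Y maps the last vector to zero.\<close>

lemma omega_clique_card_le:
  assumes K: "omega_clique n G K" shows "finite K \<and> card K \<le> n"
proof -
  let ?L = "level_bound n G"
  have L: "?L > 0" by (rule level_bound_pos)
  have "\<not> (\<exists>S. S \<subseteq> K \<and> finite S \<and> card S = Suc n)"
  proof
    assume "\<exists>S. S \<subseteq> K \<and> finite S \<and> card S = Suc n"
    then obtain S where S: "S \<subseteq> K" "finite S" "card S = Suc n" by blast
    obtain xs where xs: "set xs = S" "distinct xs" using finite_distinct_list[OF S(2)] by blast
    have len: "length xs = Suc n" using xs S(3) distinct_card by fastforce
    have V: "xs ! i \<in> omega_verts n G" if "i \<le> n" for i
      using K S(1) xs(1) nth_mem[of i xs] that len by (auto simp: omega_clique_def)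
    have o: "xs ! i \<bullet> xs ! j = (if i = j then ?L\<^sup>2 else 0)" if "i \<le> n" "j \<le> n" for i j
    proof (cases "i = j")
      case False
      then have "xs ! i \<noteq> xs ! j" using xs(2) len that by (simp add: nth_eq_iff_index_eq)
      then have "omega_adj n G (xs ! i) (xs ! j)"
        using K S(1) xs(1) len that nth_mem[of i xs] nth_mem[of j xs] unfolding omega_clique_def by (metis le_imp_less_Suc subsetD)
      then show ?thesis using False by (simp add: omega_adj_def)
    qed (use omega_vertsD(2)[OF V[OF that(1)]] in simp)
    define Y where "Y = mat n n (\<lambda>(i,j). (xs ! i) $ j)"
    have Y: "Y \<in> carrier_mat n n" by (simp add: Y_def)
    have row: "row Y i = xs ! i" if "i < n" for i
      using that omega_vertsD(1)[OF V[of i]] by (intro eq_vecI) (auto simp: Y_def)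
    have "Y * transpose_mat Y = ?L\<^sup>2 \<cdot>\<^sub>m 1\<^sub>m n"
      using Y by (intro eq_matI) (auto simp: row o)
    then have "det (Y * transpose_mat Y) = (?L\<^sup>2) ^ n" by simp
    then have "det Y \<noteq> 0" using L Y det_mult[of Y n "transpose_mat Y"] by auto
    moreover have v: "xs ! n \<in> carrier_vec n" using omega_vertsD(1)[OF V[of n]] by simp
    moreover have "Y *\<^sub>v xs ! n = 0\<^sub>v n" using Y by (intro eq_vecI) (auto simp: row o)
    ultimately have "xs ! n = 0\<^sub>v n" using det_0_iff_vec_prod_zero[OF Y] by blast
    then show False using o[of n n] L v by simp
  qed
  then have no: "\<And>S. S \<subseteq> K \<Longrightarrow> finite S \<Longrightarrow> card S = Suc n \<Longrightarrow> False" by blast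
  have "finite K" using no infinite_arbitrarily_large[of K "Suc n"] by blast
  moreover have "card K \<le> n"
  proof (rule ccontr)
    assume "\<not> card K \<le> n"
    then obtain S where "S \<subseteq> K" "card S = Suc n" using obtain_subset_with_card_n[of "Suc n" K] by auto
    then show False using no \<open>finite K\<close> finite_subset by blast
  qed
  ultimately show ?thesis by blast
qed


section \<open>Maximum cliques and the correspondence\<close>

lemma orth_conj_one: "orth_conj n G G (1\<^sub>m n)"
  by (simp add: orth_conj_def)

lemma clique_of_orth_conj:
  assumes G: "simple_graph n G" and H: "simple_graph n H" and n: "n > 0" and c: "controllable n G" and R: "orth_conj n G H R"
  obtains \<xi>s where "omega_clique n G (set \<xi>s)" "distinct \<xi>s" "length \<xi>s = n" "clique_graph n G \<xi>s = H"
proof -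
  have RC: "R \<in> carrier_mat n n" using R by (simp add: orth_conj_def)
  obtain X where X: "X \<in> carrier_mat n n" "rat_mat X = rat_of_int (level_bound n G) \<cdot>\<^sub>m R"
    using level_bound_integral[OF G H n c R] by (auto simp: integral_multiple_def)
  have "int_orth_conj n G H (level_bound n G) X"
    using orth_conj_iff_int[OF X(1) RC X(2)] R level_bound_pos[of n G] by simp
  from int_orth_conj_clique[OF G H n c this X(2) R] show ?thesis by (rule that)
qed

text \<open>The upper bound n is attained by the clique that belongs to H = G and R = I.\<close>

lemma omega_max_cliques_eq:
  assumes G: "simple_graph n G" and n: "n > 0" and c: "controllable n G"
  shows "omega_max_cliques n G = {K. omega_clique n G K \<and> card K = n}"
proof -
  obtain \<xi>s where \<xi>s: "omega_clique n G (set \<xi>s)" "distinct \<xi>s" "length \<xi>s = n"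
    using clique_of_orth_conj[OF G G n c orth_conj_one] by metis
  have "card (set \<xi>s) = n" using \<xi>s distinct_card by blast
  then show ?thesis unfolding omega_max_cliques_def
    using omega_clique_card_le[of n G] \<xi>s(1) by (auto intro: antisym)
qed

lemma clique_mat_orth_conj:
  assumes K: "omega_clique n G (set \<xi>s)" and d: "distinct \<xi>s" and len: "length \<xi>s = n"
  shows "orth_conj n G (clique_graph n G \<xi>s) (transpose_mat (clique_mat n G \<xi>s))"
    "rat_mat (mat_of_rows n \<xi>s) = rat_of_int (level_bound n G) \<cdot>\<^sub>m transpose_mat (clique_mat n G \<xi>s)"
proof -
  have L: "level_bound n G \<noteq> 0" using level_bound_pos[of n G] by simp
  have X: "mat_of_rows n \<xi>s \<in> carrier_mat n n" using mat_of_rows_carrier(1)[of n \<xi>s] len by simp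
  have Q: "transpose_mat (clique_mat n G \<xi>s) \<in> carrier_mat n n"
    using len by (simp add: clique_mat_def mat_of_cols_def)
  show XQ: "rat_mat (mat_of_rows n \<xi>s) = rat_of_int (level_bound n G) \<cdot>\<^sub>m transpose_mat (clique_mat n G \<xi>s)"
    using len L by (intro eq_matI) (auto simp: clique_mat_def mat_of_cols_def mat_of_rows_def)
  show "orth_conj n G (clique_graph n G \<xi>s) (transpose_mat (clique_mat n G \<xi>s))"
    using orth_conj_iff_int[OF X Q XQ L] clique_int_orth_conj[OF K d len] by simp
qed

lemma clique_mat_adj_mat:
  assumes K: "omega_clique n G (set \<xi>s)" and d: "distinct \<xi>s" and len: "length \<xi>s = n"
  shows "rat_mat (adj_mat n (clique_graph n G \<xi>s)) =
    transpose_mat (clique_mat n G \<xi>s) * rat_mat (adj_mat n G) * clique_mat n G \<xi>s"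
proof -
  let ?Q = "clique_mat n G \<xi>s"
  have o: "orth_conj n G (clique_graph n G \<xi>s) (transpose_mat ?Q)" by (rule clique_mat_orth_conj(1)[OF K d len])
  have tQ: "transpose_mat ?Q \<in> carrier_mat n n" and QQ: "transpose_mat ?Q * ?Q = 1\<^sub>m n"
    and QA: "transpose_mat ?Q * rat_mat (adj_mat n G) = rat_mat (adj_mat n (clique_graph n G \<xi>s)) * transpose_mat ?Q"
    using o by (auto simp: orth_conj_def)
  have B: "rat_mat (adj_mat n (clique_graph n G \<xi>s)) \<in> carrier_mat n n" by simp
  have Q: "?Q \<in> carrier_mat n n" using tQ by simp
  show ?thesis unfolding QA assoc_mult_mat[OF B tQ Q] QQ using right_mult_one_mat[OF B] by simp
qed

text \<open>The labelled graph determines R by \<open>orth_conj_unique\<close>, and the rows of L R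
  are the vectors in their order. A list of vertices is thus recovered from its graph, which is the
  core of injectivity.\<close>

lemma clique_graph_determines_list:
  assumes c: "controllable n G" and K: "omega_clique n G (set \<xi>s)" "distinct \<xi>s" "length \<xi>s = n"
    and K': "omega_clique n G (set \<eta>s)" "distinct \<eta>s" "length \<eta>s = n" and eq: "clique_graph n G \<xi>s = clique_graph n G \<eta>s"
  shows "\<xi>s = \<eta>s"
proof -
  have "transpose_mat (clique_mat n G \<xi>s) = transpose_mat (clique_mat n G \<eta>s)"
    using clique_mat_orth_conj(1)[OF K] clique_mat_orth_conj(1)[OF K'] eq orth_conj_unique[OF c] by metis
  then have "rat_mat (mat_of_rows n \<xi>s) = rat_mat (mat_of_rows n \<eta>s)"
    using clique_mat_orth_conj(2)[OF K] clique_mat_orth_conj(2)[OF K'] by simp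
  then have "mat_of_rows n \<xi>s = mat_of_rows n \<eta>s" using of_int_hom.mat_hom_inj by blast
  moreover have "set \<xi>s \<subseteq> carrier_vec n" "set \<eta>s \<subseteq> carrier_vec n"
    using K(1) K'(1) omega_vertsD(1) by (auto simp: omega_clique_def)
  ultimately show ?thesis using rows_mat_of_rows by metis
qed

lemma clique_graph_permute:
  assumes f: "bij_betw f {..<n} {..<n}" and len: "length \<eta>s = n" and carr: "set \<eta>s \<subseteq> carrier_vec n"
    and d: "distinct \<eta>s"
  defines "\<xi>s \<equiv> map (\<lambda>i. \<eta>s ! f i) [0..<n]"
  shows "set \<xi>s = set \<eta>s" "distinct \<xi>s" "length \<xi>s = n"
    "u < n \<Longrightarrow> v < n \<Longrightarrow> {u, v} \<in> clique_graph n G \<xi>s \<longleftrightarrow> {f u, f v} \<in> clique_graph n G \<eta>s"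
proof -
  have fn: "f i < n" if "i < n" for i using bij_betw_apply[OF f] that by auto
  have "f ` {0..<n} = {0..<n}" using f by (simp add: bij_betw_def atLeast0LessThan)
  then have "set \<xi>s = (!) \<eta>s ` {0..<n}" unfolding \<xi>s_def set_map set_upt image_image[of "(!) \<eta>s" f, symmetric] by simp
  also have "\<dots> = set \<eta>s" using len by (auto simp: set_conv_nth)
  finally show s: "set \<xi>s = set \<eta>s" .
  show l: "length \<xi>s = n" by (simp add: \<xi>s_def)
  show "distinct \<xi>s" using s d len l by (metis card_distinct distinct_card)
  assume uv: "u < n" "v < n"
  have "f u = f v \<longleftrightarrow> u = v" using f uv by (auto simp: bij_betw_def inj_on_eq_iff)
  then show "{u, v} \<in> clique_graph n G \<xi>s \<longleftrightarrow> {f u, f v} \<in> clique_graph n G \<eta>s"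
    using clique_graph_edge_iff[OF _ l uv, of G] clique_graph_edge_iff[OF carr len fn[OF uv(1)] fn[OF uv(2)], of G] s carr uv
    by (simp add: \<xi>s_def)
qed

lemma clique_graph_isomorphic:
  assumes len: "length \<xi>s = n" "length \<eta>s = n" and d: "distinct \<xi>s" "distinct \<eta>s" and s: "set \<xi>s = set \<eta>s"
    and carr: "set \<eta>s \<subseteq> carrier_vec n"
  shows "isomorphic n (clique_graph n G \<xi>s) (clique_graph n G \<eta>s)"
proof -
  have b: "bij_betw ((!) \<xi>s) {..<n} (set \<xi>s)" "bij_betw ((!) \<eta>s) {..<n} (set \<xi>s)"
    using bij_betw_nth[OF d(1)] bij_betw_nth[OF d(2)] len s by auto
  define f where "f = inv_into {..<n} ((!) \<eta>s) \<circ> (!) \<xi>s"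
  have f: "bij_betw f {..<n} {..<n}"
    unfolding f_def using b(1) bij_betw_inv_into[OF b(2)] by (rule bij_betw_trans)
  have "\<eta>s ! f i = \<xi>s ! i" if "i < n" for i
    using bij_betw_inv_into_right[OF b(2)] bij_betw_apply[OF b(1)] that by (simp add: f_def)
  then have "\<xi>s = map (\<lambda>i. \<eta>s ! f i) [0..<n]" using len by (intro nth_equalityI) auto
  then show ?thesis
    using clique_graph_permute(4)[OF f len(2) carr d(2), where G = G] f unfolding isomorphic_def by auto
qed

text \<open>A clique carries no order; choosing one fixes a labelled graph, and
  \<open>clique_class_eq\<close> shows that every other order yields an isomorphic one.\<close>

definition clique_class :: "nat \<Rightarrow> nat set set \<Rightarrow> int vec set \<Rightarrow> nat set set set" where
  "clique_class n G K = iso_class n (clique_graph n G (SOME \<xi>s. distinct \<xi>s \<and> set \<xi>s = K))"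

lemma clique_class_eq:
  assumes K: "omega_clique n G (set \<xi>s)" and d: "distinct \<xi>s" and len: "length \<xi>s = n"
  shows "clique_class n G (set \<xi>s) = iso_class n (clique_graph n G \<xi>s)"
proof -
  define \<eta>s where "\<eta>s = (SOME \<eta>s. distinct \<eta>s \<and> set \<eta>s = set \<xi>s)"
  have e: "distinct \<eta>s \<and> set \<eta>s = set \<xi>s" unfolding \<eta>s_def by (rule someI[of _ \<xi>s]) (simp add: d)
  then have "length \<eta>s = n" using d len distinct_card by metis
  moreover have "set \<xi>s \<subseteq> carrier_vec n" using K omega_vertsD(1) by (auto simp: omega_clique_def)
  ultimately have "isomorphic n (clique_graph n G \<eta>s) (clique_graph n G \<xi>s)"
    using clique_graph_isomorphic[OF _ len _ d] e by blast
  then show ?thesis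
    unfolding clique_class_def \<eta>s_def[symmetric] by (simp add: iso_class_eq_iff simple_graph_clique_graph)
qed

lemma max_clique_list:
  assumes G: "simple_graph n G" and n: "n > 0" and c: "controllable n G" and K: "K \<in> omega_max_cliques n G"
  obtains \<xi>s where "set \<xi>s = K" "omega_clique n G (set \<xi>s)" "distinct \<xi>s" "length \<xi>s = n"
proof -
  have K': "omega_clique n G K" "card K = n" using K omega_max_cliques_eq[OF G n c] by auto
  then obtain \<xi>s where "set \<xi>s = K" "distinct \<xi>s" using omega_clique_card_le finite_distinct_list by metis
  then show ?thesis using that[of \<xi>s] K' distinct_card by metis
qed

lemma bij_betw_clique_class:
  assumes G: "simple_graph n G" and n: "n > 0" and c: "controllable n G"
  shows "bij_betw (clique_class n G) (omega_max_cliques n G) (gen_cospectral_classes n G)"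
proof (rule bij_betw_imageI)
  show "inj_on (clique_class n G) (omega_max_cliques n G)"
  proof (rule inj_onI)
    fix K K' assume K: "K \<in> omega_max_cliques n G" "K' \<in> omega_max_cliques n G" "clique_class n G K = clique_class n G K'"
    obtain \<xi>s where \<xi>: "set \<xi>s = K" "omega_clique n G (set \<xi>s)" "distinct \<xi>s" "length \<xi>s = n"
      by (rule max_clique_list[OF G n c K(1)])
    obtain \<eta>s where \<eta>: "set \<eta>s = K'" "omega_clique n G (set \<eta>s)" "distinct \<eta>s" "length \<eta>s = n"
      by (rule max_clique_list[OF G n c K(2)])
    have carr: "set \<eta>s \<subseteq> carrier_vec n" using \<eta>(2) omega_vertsD(1) by (auto simp: omega_clique_def)
    have "isomorphic n (clique_graph n G \<xi>s) (clique_graph n G \<eta>s)"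
      using K(3) clique_class_eq[OF \<xi>(2-4)] clique_class_eq[OF \<eta>(2-4)] \<xi>(1) \<eta>(1)
      by (simp add: iso_class_eq_iff simple_graph_clique_graph)
    then obtain f where f: "bij_betw f {..<n} {..<n}"
      and fe: "\<And>u v. u < n \<Longrightarrow> v < n \<Longrightarrow> {u, v} \<in> clique_graph n G \<xi>s \<longleftrightarrow> {f u, f v} \<in> clique_graph n G \<eta>s"
      by (auto simp: isomorphic_def)
    \<comment> \<open>Reordering \<open>\<eta>s\<close> along the isomorphism makes the two labelled
      graphs equal, so that \<open>clique_graph_determines_list\<close> applies.\<close>
    define \<zeta>s where "\<zeta>s = map (\<lambda>i. \<eta>s ! f i) [0..<n]"
    note \<zeta> = clique_graph_permute[OF f \<eta>(4) carr \<eta>(3), folded \<zeta>s_def]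
    have iff: "{u, v} \<in> clique_graph n G \<xi>s \<longleftrightarrow> {u, v} \<in> clique_graph n G \<zeta>s" if "u < n" "v < n" for u v
      using fe[OF that] \<zeta>(4)[OF that] by simp
    have "clique_graph n G \<xi>s = clique_graph n G \<zeta>s"
      by (intro simple_graph_eqI[OF simple_graph_clique_graph simple_graph_clique_graph] eq_matI)
        (auto simp: adj_mat_def iff)
    then have "\<xi>s = \<zeta>s"
      using clique_graph_determines_list[OF c \<xi>(2-4) _ \<zeta>(2,3)] \<zeta>(1) \<eta>(2) by simp
    then show "K = K'" using \<xi>(1) \<eta>(1) \<zeta>(1) by simp
  qed
  show "clique_class n G ` omega_max_cliques n G = gen_cospectral_classes n G"
  proof (intro equalityI subsetI)
    fix C assume "C \<in> clique_class n G ` omega_max_cliques n G"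
    then obtain K where K: "K \<in> omega_max_cliques n G" "C = clique_class n G K" by blast
    obtain \<xi>s where \<xi>: "set \<xi>s = K" "omega_clique n G (set \<xi>s)" "distinct \<xi>s" "length \<xi>s = n"
      by (rule max_clique_list[OF G n c K(1)])
    have "gen_cospectral n G (clique_graph n G \<xi>s)"
      by (rule orth_conj_gen_cospectral[OF G simple_graph_clique_graph clique_mat_orth_conj(1)[OF \<xi>(2-4)]])
    then show "C \<in> gen_cospectral_classes n G"
      using clique_class_eq[OF \<xi>(2-4)] \<xi>(1) K(2) simple_graph_clique_graph unfolding gen_cospectral_classes_def by blast
  next
    fix C assume "C \<in> gen_cospectral_classes n G"
    then obtain H where H: "simple_graph n H" "gen_cospectral n G H" "C = iso_class n H"
      by (auto simp: gen_cospectral_classes_def)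
    obtain R where "orth_conj n G H R" using orth_conj_exists[OF G H(1) n c H(2)] by blast
    then obtain \<xi>s where \<xi>: "omega_clique n G (set \<xi>s)" "distinct \<xi>s" "length \<xi>s = n" "clique_graph n G \<xi>s = H"
      using clique_of_orth_conj[OF G H(1) n c] by metis
    then have "set \<xi>s \<in> omega_max_cliques n G"
      using omega_max_cliques_eq[OF G n c] distinct_card by fastforce
    then show "C \<in> clique_class n G ` omega_max_cliques n G"
      using clique_class_eq[OF \<xi>(1-3)] \<xi>(4) H(3) by blast
  qed
qed

text \<open>For n = 0 no rank is below n, so L is the empty product 1, while the empty vector has
  squared length 0.\<close>

lemma omega_verts_0: "omega_verts 0 G = {}"
proof -
  have "potential_primes 0 G = {}" by (simp add: potential_primes_def)
  then have "level_bound 0 G = 1" by (simp add: level_bound_def)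
  then show ?thesis by (auto simp: omega_verts_def Let_def scalar_prod_def)
qed

theorem theorem3:
  fixes n :: nat and G :: "nat set set"
  assumes "simple_graph n G" and "controllable n G"
  shows "\<exists>\<Phi>. bij_betw \<Phi> (omega_max_cliques n G) (gen_cospectral_classes n G) \<and>
    (\<forall>\<xi>s. distinct \<xi>s \<and> set \<xi>s \<in> omega_max_cliques n G \<longrightarrow>
      (\<exists>H. simple_graph n H \<and>
           map_mat rat_of_int (adj_mat n H) =
             transpose_mat (clique_mat n G \<xi>s) * map_mat rat_of_int (adj_mat n G) * clique_mat n G \<xi>s \<and>
           \<Phi> (set \<xi>s) = iso_class n H))"
proof (cases "n = 0")
  case False
  then have n: "n > 0" by simp
  show ?thesis
  proof (intro exI[of _ "clique_class n G"] conjI allI impI)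
    show "bij_betw (clique_class n G) (omega_max_cliques n G) (gen_cospectral_classes n G)"
      by (rule bij_betw_clique_class[OF assms(1) n assms(2)])
    fix \<xi>s assume "distinct \<xi>s \<and> set \<xi>s \<in> omega_max_cliques n G"
    then have \<xi>: "omega_clique n G (set \<xi>s)" "distinct \<xi>s" "length \<xi>s = n"
      using omega_max_cliques_eq[OF assms(1) n assms(2)] by (auto simp flip: distinct_card)
    show "\<exists>H. simple_graph n H \<and> rat_mat (adj_mat n H) =
             transpose_mat (clique_mat n G \<xi>s) * rat_mat (adj_mat n G) * clique_mat n G \<xi>s \<and>
           clique_class n G (set \<xi>s) = iso_class n H"
      using simple_graph_clique_graph clique_mat_adj_mat[OF \<xi>] clique_class_eq[OF \<xi>] by blast
  qed
next
  case True
  \<comment> \<open>Without vertices the empty clique is the maximum one; it corresponds to the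
    class of the empty graph, the only graph for n = 0.\<close>
  have "omega_clique 0 G K \<longleftrightarrow> K = {}" for K by (auto simp: omega_clique_def omega_verts_0)
  then have cl: "omega_max_cliques 0 G = {{}}" by (auto simp: omega_max_cliques_def)
  have s0: "simple_graph 0 H \<longleftrightarrow> H = {}" for H by (auto simp: simple_graph_def all_edges_def)
  then have "gen_cospectral_classes 0 G = {iso_class 0 {}}"
    using assms(1) True by (auto simp: gen_cospectral_classes_def gen_cospectral_def)
  then have "bij_betw (\<lambda>_. iso_class 0 {}) (omega_max_cliques 0 G) (gen_cospectral_classes 0 G)"
    by (simp add: cl bij_betw_def)
  then show ?thesis unfolding True
    by (intro exI[of _ "\<lambda>_. iso_class 0 {}"] conjI allI impI exI[of _ "{}"])
      (auto simp: cl s0 clique_mat_def mat_of_cols_def intro!: eq_matI)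
qed

end
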